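(* There exists an optimal control solving the reduced minimization problem: there is $\overline u\in U_{ad}$ such that $$\mathcal{J}(\overline u)\le\mathcal{J}(u)\quad\text{for all }u\in U_{ad},$$ where $\mathcal{J}(u)=\frac12\|\mathcal{S}(u)-y_d\|_{L^2(\Omega)}^2+\frac{\alpha}{2}\|u\|_{L^2(\Omega)}^2$.
   Context: Let $n\ge 1$, $\Omega\subset\mathbb{R}^n$ open and bounded with $C^{1,1}$ boundary, and fix a finite $p>n$. $\mathring{W}^1_r(\Omega)$ is the subspace of $W^1_r(\Omega)$ of functions with zero trace. The boundary datum $v\in W^2_p(\Omega)$ is fixed; $\mathcal{Q}(y)=(1+|\nabla y|^2)^{1/2}$; $Y:=\{y\in W^2_p(\Omega): y-v\in\mathring W^1_\infty(\Omega)\}$. The desired state is $y_d\in L^2(\Omega)$ and $\alpha>0$. $U_3\subset L^p(\Omega)$ is an open set containing $0$ on which the control-to-state map $\mathcal{S}:U_3\to Y$ is defined as the unique, twice continuously Fréchet differentiable map such that $y=\mathcal{S}(u)$ solves the state equation $-\operatorname{div}(\nabla y/\mathcal{Q}(y))=u$ in $\Omega$. Fix $B_1>1$ and $\mathbb{B}:=\{y\in Y:\|y\|_{W^2_p(\Omega)}\le B_1\}$; $C_S$ is the embedding constant of $W^2_p(\Omega)$ into $W^1_\infty(\Omega)$. For $y\in\mathbb{B}$, $T(y)=\tilde y\in Y$ solves $-(\mathcal{Q}(y)^2I-\nabla y\nabla y^T):D^2\tilde y=u\mathcal{Q}(y)^3$ in $\Omega$. $C_\Omega,B_2,B_3>0$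 are fixed constants such that, whenever (a) $C_\Omega(\|v\|_{W^2_p}+B_2\|u\|_{L^p})\le B_1$ and (b) $B_3(2\|u\|_{L^p}+\|v\|_{W^2_p})<1$, $T$ is a contraction of $\mathbb{B}$ into itself and the solution $y\in\mathbb{B}$ of the state equation satisfies $C_S\|y\|_{W^2_p(\Omega)}\le \frac{1}{B_1(1+C_S^2B_1^2)^{1/2}}$. $U:=\{u\in L^p(\Omega):\text{(a) and (b) hold}\}\cap U_3$, regarded as an open subset of $L^p(\Omega)$. $U_{ad}:=\{u\in L^2(\Omega):\|u\|_{L^p(\Omega)}\le\theta\}$, where $\theta>0$ is chosen such that $U_{ad}\subset U$. *)

theory Defs
  imports "HOL-Analysis.Analysis" "HOL-Probability.Essential_Supremum"
begin

text \<open>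
  Elements of Lebesgue and Sobolev spaces on \<Omega> are represented by functions on the whole space, of
  which only the values almost everywhere in \<Omega> matter. All norms below are therefore seminorms
  that vanish exactly on the functions that are zero almost everywhere in \<Omega>.
\<close>

section \<open>Domains with C^{1,1} boundary\<close>

text \<open>
  Near every boundary point, \<Omega> is the part of a ball lying above the graph, in direction \<nu>, of a
  C^{1,1} function \<gamma> on the hyperplane orthogonal to \<nu>. Taking \<gamma> on the whole space is no
  restriction: extend it constantly along \<nu>.
\<close>

definition C11_boundary :: "(real^'n) set \<Rightarrow> bool" where
  "C11_boundary \<Omega> \<longleftrightarrow>
    (\<forall>x0\<in>frontier \<Omega>. \<exists>r>0. \<exists>(\<nu>::real^'n) (\<gamma>::real^'n \<Rightarrow> real) (G::real^'n \<Rightarrow> real^'n) L.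
       norm \<nu> = 1 \<and>
       (\<forall>x. (\<gamma> has_derivative (\<lambda>h. G x \<bullet> h)) (at x)) \<and> L-lipschitz_on UNIV G \<and>
       \<Omega> \<inter> ball x0 r = {x \<in> ball x0 r. \<nu> \<bullet> x > \<gamma> (x - (\<nu> \<bullet> x) *\<^sub>R \<nu>)})"


section \<open>Lebesgue spaces\<close>

definition Lp :: "(real^'n) set \<Rightarrow> ennreal \<Rightarrow> (real^'n \<Rightarrow> real) set" where
  "Lp \<Omega> r = {f \<in> borel_measurable (lebesgue_on \<Omega>).
     if r = \<infinity> then esssup (lebesgue_on \<Omega>) (\<lambda>x. ennreal \<bar>f x\<bar>) < \<infinity>
     else integrable (lebesgue_on \<Omega>) (\<lambda>x. \<bar>f x\<bar> powr enn2real r)}"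

text \<open>Only meaningful on \<^term>\<open>Lp \<Omega> r\<close>: outside, Bochner integral and \<^const>\<open>enn2real\<close> default to 0.\<close>

definition Lp_norm :: "(real^'n) set \<Rightarrow> ennreal \<Rightarrow> (real^'n \<Rightarrow> real) \<Rightarrow> real" where
  "Lp_norm \<Omega> r f =
    (if r = \<infinity> then enn2real (esssup (lebesgue_on \<Omega>) (\<lambda>x. ennreal \<bar>f x\<bar>))
     else (LINT x|lebesgue_on \<Omega>. \<bar>f x\<bar> powr enn2real r) powr (1 / enn2real r))"


section \<open>Weak derivatives\<close>

definition partial_deriv :: "'n \<Rightarrow> (real^'n \<Rightarrow> real) \<Rightarrow> real^'n \<Rightarrow> real" where
  "partial_deriv i f x = frechet_derivative f (at x) (axis i 1)"

text \<open>Multi-indices are given as lists of coordinates; the length is the order of the derivative.\<close>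

abbreviation partial_derivs :: "'n list \<Rightarrow> (real^'n \<Rightarrow> real) \<Rightarrow> real^'n \<Rightarrow> real" where
  "partial_derivs is f \<equiv> foldr partial_deriv is f"

definition smooth :: "(real^'n \<Rightarrow> real) \<Rightarrow> bool" where
  "smooth f \<longleftrightarrow> (\<forall>is x. partial_derivs is f differentiable (at x))"

definition test_functions :: "(real^'n) set \<Rightarrow> (real^'n \<Rightarrow> real) set" where
  "test_functions \<Omega> =
    {\<phi>. smooth \<phi> \<and> compact (closure {x. \<phi> x \<noteq> 0}) \<and> closure {x. \<phi> x \<noteq> 0} \<subseteq> \<Omega>}"

definition loc_integrable :: "(real^'n) set \<Rightarrow> (real^'n \<Rightarrow> real) \<Rightarrow> bool" where
  "loc_integrable \<Omega> f \<longleftrightarrow> (\<forall>K. compact K \<and> K \<subseteq> \<Omega> \<longrightarrow> integrable (lebesgue_on K) f)"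

definition has_weak_deriv ::
    "(real^'n) set \<Rightarrow> 'n list \<Rightarrow> (real^'n \<Rightarrow> real) \<Rightarrow> (real^'n \<Rightarrow> real) \<Rightarrow> bool" where
  "has_weak_deriv \<Omega> is f g \<longleftrightarrow> loc_integrable \<Omega> f \<and> loc_integrable \<Omega> g \<and>
    (\<forall>\<phi>\<in>test_functions \<Omega>.
       (LINT x|lebesgue_on \<Omega>. f x * partial_derivs is \<phi> x) =
       (-1) ^ length is * (LINT x|lebesgue_on \<Omega>. g x * \<phi> x))"

text \<open>The weak derivative is unique up to null sets; any representative is chosen.\<close>

definition weak_deriv :: "(real^'n) set \<Rightarrow> 'n list \<Rightarrow> (real^'n \<Rightarrow> real) \<Rightarrow> real^'n \<Rightarrow> real" where
  "weak_deriv \<Omega> is f = (SOME g. has_weak_deriv \<Omega> is f g)"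

definition weak_grad :: "(real^'n) set \<Rightarrow> (real^'n \<Rightarrow> real) \<Rightarrow> real^'n \<Rightarrow> real^'n" where
  "weak_grad \<Omega> f x = (\<chi> i. weak_deriv \<Omega> [i] f x)"

definition weak_hess :: "(real^'n) set \<Rightarrow> (real^'n \<Rightarrow> real) \<Rightarrow> real^'n \<Rightarrow> real^'n^'n" where
  "weak_hess \<Omega> f x = (\<chi> i j. weak_deriv \<Omega> [i, j] f x)"

definition has_weak_div ::
    "(real^'n) set \<Rightarrow> (real^'n \<Rightarrow> real^'n) \<Rightarrow> (real^'n \<Rightarrow> real) \<Rightarrow> bool" where
  "has_weak_div \<Omega> F g \<longleftrightarrow> (\<forall>i. loc_integrable \<Omega> (\<lambda>x. F x $ i)) \<and> loc_integrable \<Omega> g \<and>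
    (\<forall>\<phi>\<in>test_functions \<Omega>.
       (LINT x|lebesgue_on \<Omega>. F x \<bullet> (\<chi> i. partial_deriv i \<phi> x)) =
       - (LINT x|lebesgue_on \<Omega>. g x * \<phi> x))"


section \<open>Sobolev spaces\<close>

definition Sobolev :: "(real^'n) set \<Rightarrow> nat \<Rightarrow> ennreal \<Rightarrow> (real^'n \<Rightarrow> real) set" where
  "Sobolev \<Omega> k r =
    {f \<in> Lp \<Omega> r. \<forall>is. length is \<le> k \<longrightarrow> (\<exists>g\<in>Lp \<Omega> r. has_weak_deriv \<Omega> is f g)}"

definition Sobolev_norm :: "(real^'n) set \<Rightarrow> nat \<Rightarrow> ennreal \<Rightarrow> (real^'n \<Rightarrow> real) \<Rightarrow> real" where
  "Sobolev_norm \<Omega> k r f =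
    (if r = \<infinity> then MAX is\<in>{is. length is \<le> k}. Lp_norm \<Omega> r (weak_deriv \<Omega> is f)
     else (\<Sum>is | length is \<le> k. Lp_norm \<Omega> r (weak_deriv \<Omega> is f) powr enn2real r)
            powr (1 / enn2real r))"

text \<open>
  The trace of a function with a representative F continuous up to the boundary is the restriction
  of F to the boundary. On a bounded domain with C^{1,1} boundary every function in
  \<^term>\<open>Sobolev \<Omega> 1 \<infinity>\<close> has such a representative, so no surface measure is needed here.
\<close>

definition has_trace :: "(real^'n) set \<Rightarrow> (real^'n \<Rightarrow> real) \<Rightarrow> (real^'n \<Rightarrow> real) \<Rightarrow> bool" where
  "has_trace \<Omega> f g \<longleftrightarrow> (\<exists>F. continuous_on (closure \<Omega>) F \<and>
     (AE x in lebesgue_on \<Omega>. F x = f x) \<and> (\<forall>x\<in>frontier \<Omega>. F x = g x))"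

definition W1inf_zero_trace :: "(real^'n) set \<Rightarrow> (real^'n \<Rightarrow> real) set" where
  "W1inf_zero_trace \<Omega> = {f \<in> Sobolev \<Omega> 1 \<infinity>. has_trace \<Omega> f (\<lambda>_. 0)}"


section \<open>The state equation\<close>

definition state_space ::
    "(real^'n) set \<Rightarrow> real \<Rightarrow> (real^'n \<Rightarrow> real) \<Rightarrow> (real^'n \<Rightarrow> real) set" where
  "state_space \<Omega> p v = {y \<in> Sobolev \<Omega> 2 (ennreal p). y - v \<in> W1inf_zero_trace \<Omega>}"

definition state_ball ::
    "(real^'n) set \<Rightarrow> real \<Rightarrow> (real^'n \<Rightarrow> real) \<Rightarrow> real \<Rightarrow> (real^'n \<Rightarrow> real) set" where
  "state_ball \<Omega> p v B1 = {y \<in> state_space \<Omega> p v. Sobolev_norm \<Omega> 2 (ennreal p) y \<le> B1}"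

definition Qop :: "(real^'n) set \<Rightarrow> (real^'n \<Rightarrow> real) \<Rightarrow> real^'n \<Rightarrow> real" where
  "Qop \<Omega> y x = sqrt (1 + (norm (weak_grad \<Omega> y x))\<^sup>2)"

definition solves_state_eq ::
    "(real^'n) set \<Rightarrow> (real^'n \<Rightarrow> real) \<Rightarrow> (real^'n \<Rightarrow> real) \<Rightarrow> bool" where
  "solves_state_eq \<Omega> u y \<longleftrightarrow>
    has_weak_div \<Omega> (\<lambda>x. (1 / Qop \<Omega> y x) *\<^sub>R weak_grad \<Omega> y x) (\<lambda>x. - u x)"

text \<open>The inner product on matrices is the Frobenius product.\<close>

definition solves_linear_eq ::
    "(real^'n) set \<Rightarrow> (real^'n \<Rightarrow> real) \<Rightarrow> (real^'n \<Rightarrow> real) \<Rightarrow> (real^'n \<Rightarrow> real) \<Rightarrow> bool" where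
  "solves_linear_eq \<Omega> u y z \<longleftrightarrow>
    (AE x in lebesgue_on \<Omega>.
       - (((Qop \<Omega> y x)\<^sup>2 *\<^sub>R mat 1 - (\<chi> i j. weak_grad \<Omega> y x $ i * weak_grad \<Omega> y x $ j))
            \<bullet> weak_hess \<Omega> z x) = u x * Qop \<Omega> y x ^ 3)"


section \<open>The control-to-state map\<close>

definition Lp_open :: "(real^'n) set \<Rightarrow> ennreal \<Rightarrow> (real^'n \<Rightarrow> real) set \<Rightarrow> bool" where
  "Lp_open \<Omega> r V \<longleftrightarrow> V \<subseteq> Lp \<Omega> r \<and>
    (\<forall>u\<in>V. \<exists>e>0. \<forall>w\<in>Lp \<Omega> r. Lp_norm \<Omega> r (w - u) < e \<longrightarrow> w \<in> V)"

text \<open>Bounded linear maps between seminormed function spaces; linearity is up to the null space.\<close>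

definition bounded_linear_between ::
    "('a \<Rightarrow> real) set \<Rightarrow> (('a \<Rightarrow> real) \<Rightarrow> real) \<Rightarrow> ('b \<Rightarrow> real) set \<Rightarrow> (('b \<Rightarrow> real) \<Rightarrow> real)
      \<Rightarrow> (('a \<Rightarrow> real) \<Rightarrow> 'b \<Rightarrow> real) \<Rightarrow> bool" where
  "bounded_linear_between X NX Z NZ A \<longleftrightarrow>
    (\<forall>h\<in>X. A h \<in> Z) \<and>
    (\<forall>h\<in>X. \<forall>k\<in>X. NZ (\<lambda>x. A (\<lambda>t. h t + k t) x - (A h x + A k x)) = 0) \<and>
    (\<forall>c. \<forall>h\<in>X. NZ (\<lambda>x. A (\<lambda>t. c * h t) x - c * A h x) = 0) \<and>
    (\<exists>K. \<forall>h\<in>X. NZ (A h) \<le> K * NX h)"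

text \<open>
  \<^term>\<open>S\<close> is twice continuously Frechet differentiable on the open set \<^term>\<open>V\<close>: \<^term>\<open>D1\<close> is its
  derivative, \<^term>\<open>D2\<close> the derivative of \<^term>\<open>D1\<close> in operator norm (\<^term>\<open>D2 u h k\<close> is
  \<^term>\<open>D2 u\<close> applied to the increment \<^term>\<open>h\<close> and then to the argument \<^term>\<open>k\<close>), and
  \<^term>\<open>D2\<close> is continuous in operator norm.
\<close>

definition C2_Frechet ::
    "('a \<Rightarrow> real) set \<Rightarrow> (('a \<Rightarrow> real) \<Rightarrow> real) \<Rightarrow> ('b \<Rightarrow> real) set \<Rightarrow> (('b \<Rightarrow> real) \<Rightarrow> real)
      \<Rightarrow> ('a \<Rightarrow> real) set \<Rightarrow> (('a \<Rightarrow> real) \<Rightarrow> 'b \<Rightarrow> real) \<Rightarrow> bool" where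
  "C2_Frechet X NX Z NZ V S \<longleftrightarrow>
    (\<exists>(D1 :: ('a \<Rightarrow> real) \<Rightarrow> ('a \<Rightarrow> real) \<Rightarrow> 'b \<Rightarrow> real)
      (D2 :: ('a \<Rightarrow> real) \<Rightarrow> ('a \<Rightarrow> real) \<Rightarrow> ('a \<Rightarrow> real) \<Rightarrow> 'b \<Rightarrow> real).
      (\<forall>u\<in>V.
        bounded_linear_between X NX Z NZ (D1 u) \<and>
        (\<forall>e>0. \<exists>d>0. \<forall>h\<in>X. NX h < d \<and> (\<lambda>t. u t + h t) \<in> V \<longrightarrow>
           NZ (\<lambda>x. S (\<lambda>t. u t + h t) x - S u x - D1 u h x) \<le> e * NX h) \<and>
        (\<forall>h\<in>X. bounded_linear_between X NX Z NZ (D2 u h)) \<and>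
        (\<forall>k\<in>X. bounded_linear_between X NX Z NZ (\<lambda>h. D2 u h k)) \<and>
        (\<exists>K. \<forall>h\<in>X. \<forall>k\<in>X. NZ (D2 u h k) \<le> K * NX h * NX k) \<and>
        (\<forall>e>0. \<exists>d>0. \<forall>h\<in>X. NX h < d \<and> (\<lambda>t. u t + h t) \<in> V \<longrightarrow>
           (\<forall>k\<in>X. NZ (\<lambda>x. D1 (\<lambda>t. u t + h t) k x - D1 u k x - D2 u h k x) \<le> e * NX h * NX k)) \<and>
        (\<forall>e>0. \<exists>d>0. \<forall>w\<in>V. NX (w - u) < d \<longrightarrow>
           (\<forall>h\<in>X. \<forall>k\<in>X. NZ (\<lambda>x. D2 w h k x - D2 u h k x) \<le> e * NX h * NX k))))"

definition is_C2_solution_map ::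
    "(real^'n) set \<Rightarrow> real \<Rightarrow> (real^'n \<Rightarrow> real) \<Rightarrow> (real^'n \<Rightarrow> real) set
      \<Rightarrow> ((real^'n \<Rightarrow> real) \<Rightarrow> real^'n \<Rightarrow> real) \<Rightarrow> bool" where
  "is_C2_solution_map \<Omega> p v V S \<longleftrightarrow>
    (\<forall>u\<in>V. S u \<in> state_space \<Omega> p v \<and> solves_state_eq \<Omega> u (S u)) \<and>
    C2_Frechet (Lp \<Omega> (ennreal p)) (Lp_norm \<Omega> (ennreal p))
      (Sobolev \<Omega> 2 (ennreal p)) (Sobolev_norm \<Omega> 2 (ennreal p)) V S"

definition control_to_state_map ::
    "(real^'n) set \<Rightarrow> real \<Rightarrow> (real^'n \<Rightarrow> real) \<Rightarrow> (real^'n \<Rightarrow> real) set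
      \<Rightarrow> ((real^'n \<Rightarrow> real) \<Rightarrow> real^'n \<Rightarrow> real) \<Rightarrow> bool" where
  "control_to_state_map \<Omega> p v V S \<longleftrightarrow> is_C2_solution_map \<Omega> p v V S \<and>
    (\<forall>S'. is_C2_solution_map \<Omega> p v V S' \<longrightarrow>
       (\<forall>u\<in>V. AE x in lebesgue_on \<Omega>. S' u x = S u x))"


section \<open>The optimal control problem\<close>

definition small_data ::
    "(real^'n) set \<Rightarrow> real \<Rightarrow> (real^'n \<Rightarrow> real) \<Rightarrow> real \<Rightarrow> real \<Rightarrow> real \<Rightarrow> real
      \<Rightarrow> (real^'n \<Rightarrow> real) \<Rightarrow> bool" where
  "small_data \<Omega> p v B1 B2 B3 C\<Omega> u \<longleftrightarrow>
    C\<Omega> * (Sobolev_norm \<Omega> 2 (ennreal p) v + B2 * Lp_norm \<Omega> (ennreal p) u) \<le> B1 \<and>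
    B3 * (2 * Lp_norm \<Omega> (ennreal p) u + Sobolev_norm \<Omega> 2 (ennreal p) v) < 1"

definition U_set ::
    "(real^'n) set \<Rightarrow> real \<Rightarrow> (real^'n \<Rightarrow> real) \<Rightarrow> real \<Rightarrow> real \<Rightarrow> real \<Rightarrow> real
      \<Rightarrow> (real^'n \<Rightarrow> real) set \<Rightarrow> (real^'n \<Rightarrow> real) set" where
  "U_set \<Omega> p v B1 B2 B3 C\<Omega> U3 =
    {u \<in> Lp \<Omega> (ennreal p). small_data \<Omega> p v B1 B2 B3 C\<Omega> u} \<inter> U3"

text \<open>Membership in the p-space is explicit because \<^const>\<open>Lp_norm\<close> is not meaningful outside it.\<close>

definition U_ad :: "(real^'n) set \<Rightarrow> real \<Rightarrow> real \<Rightarrow> (real^'n \<Rightarrow> real) set" where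
  "U_ad \<Omega> p \<theta> = {u \<in> Lp \<Omega> 2. u \<in> Lp \<Omega> (ennreal p) \<and> Lp_norm \<Omega> (ennreal p) u \<le> \<theta>}"

definition cost ::
    "(real^'n) set \<Rightarrow> ((real^'n \<Rightarrow> real) \<Rightarrow> real^'n \<Rightarrow> real) \<Rightarrow> (real^'n \<Rightarrow> real) \<Rightarrow> real
      \<Rightarrow> (real^'n \<Rightarrow> real) \<Rightarrow> real" where
  "cost \<Omega> S yd \<alpha> u = 1 / 2 * (Lp_norm \<Omega> 2 (S u - yd))\<^sup>2 + \<alpha> / 2 * (Lp_norm \<Omega> 2 u)\<^sup>2"

end

theory Submission
  imports Defs "HOL-Library.Diagonal_Subsequence"
begin

text \<open>
  A minimizing sequence of controls is bounded in L^2, and a subsequence converges weakly to some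
  admissible u. It remains to see that the states converge in L^1. The flux q / sqrt (1 + |q|^2) of
  the state equation is strictly monotone, so testing the difference of two state equations with the
  difference w of the states bounds the L^1 norm of the gradient of w by the integral of
  (u_k - u) w. For p > n this integral is at most d_k times the L^1 norm of the gradient of w, where
  d_k tends to 0: on cubes of side e, replacing w by its averages costs
  O(e^(1 - n/p)) times that norm, and against the averages only finitely many integrals of u_k - u
  over cubes matter. So the gradient of w tends to 0 in L^1, and the cost is lower semicontinuous by
  Fatou's lemma.
\<close>

section \<open>Smooth functions\<close>

text \<open>The flux is bounded, so its monotonicity degenerates as gradients grow, and the states
  of a minimizing sequence come without a gradient bound uniform in k. The inequality for the flux
  therefore relies on a bound for one gradient only, that of the limit state, and for large
  differences it grows merely linearly. Hence w is controlled in L^1 norms, and u_k - u has to be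
  small in the dual of the L^1 norm of gradients, uniformly in the test function. Plain weak
  convergence does not say this; the L^p bound supplies it, because t^(-n/p) is integrable at 0 when
  p > n.

  Two gaps separate w from an admissible test function: it is only weakly differentiable, and it
  vanishes on the boundary without having compact support. Mollification followed by a smooth
  truncation of small values repairs both.

  The weak limit is built as an almost everywhere limit of convex combinations of the controls. The
  L^p bound and the L^2 norm then pass to it by Fatou's lemma, and a diagonal choice only has to
  make countably many integrals over grid cells converge.\<close>

lemma partial_deriv_eq:
  assumes "(f has_derivative D) (at x)"
  shows "partial_deriv i f x = D (axis i 1)"
  unfolding partial_deriv_def using frechet_derivative_at[OF assms] by simp

lemma has_derivative_partials:
  assumes "f differentiable (at x)"
  shows "(f has_derivative (\<lambda>h. (\<chi> i. partial_deriv i f x) \<bullet> h)) (at x)"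
proof -
  have D: "(f has_derivative frechet_derivative f (at x)) (at x)"
    using assms frechet_derivative_works by blast
  have lin: "linear (frechet_derivative f (at x))"
    using D has_derivative_linear by blast
  have "frechet_derivative f (at x) h = (\<chi> i. partial_deriv i f x) \<bullet> h" for h
  proof -
    have "h = (\<Sum>i\<in>UNIV. (h $ i) *\<^sub>R axis i 1)"
      by (simp add: vec_eq_iff axis_def if_distrib cong: if_cong)
    then have "frechet_derivative f (at x) h
        = frechet_derivative f (at x) (\<Sum>i\<in>UNIV. (h $ i) *\<^sub>R axis i 1)"
      by (rule arg_cong)
    also have "\<dots> = (\<Sum>i\<in>UNIV. (h $ i) * frechet_derivative f (at x) (axis i 1))"
      using lin by (simp add: linear_sum linear_scale)
    finally show ?thesis
      by (simp add: inner_vec_def partial_deriv_def mult.commute)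
  qed
  then have "frechet_derivative f (at x) = (\<lambda>h. (\<chi> i. partial_deriv i f x) \<bullet> h)"
    by (rule ext)
  then show ?thesis using D by simp
qed

lemma partial_derivs_snoc: "partial_derivs is (partial_deriv i f) = partial_derivs (is @ [i]) f"
  by simp

lemma smooth_differentiable: "smooth f \<Longrightarrow> f differentiable (at x)"
  unfolding smooth_def by (metis foldr_Nil id_apply)

lemma smooth_partial_deriv: "smooth f \<Longrightarrow> smooth (partial_deriv i f)"
  unfolding smooth_def by (metis partial_derivs_snoc)

text \<open>Coinduction for smoothness: a class stable under \<open>partial_deriv\<close> contains
  all iterated derivatives of its members. Later smoothness proofs exhibit such a class and never
  compute a higher derivative.\<close>

lemma smooth_class:
  assumes "f \<in> A" and "\<And>g x. g \<in> A \<Longrightarrow> g differentiable (at x)"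
    and "\<And>g i. g \<in> A \<Longrightarrow> partial_deriv i g \<in> A"
  shows "smooth f"
proof -
  have "partial_derivs is f \<in> A" for "is"
    by (induction "is") (use assms in auto)
  then show ?thesis using assms(2) by (auto simp: smooth_def)
qed

lemma smooth_continuous: "smooth f \<Longrightarrow> continuous_on S f"
  by (meson smooth_differentiable continuous_at_imp_continuous_on differentiable_imp_continuous_within)

lemma smooth_has_derivative:
  "smooth f \<Longrightarrow> (f has_derivative (\<lambda>h. (\<chi> i. partial_deriv i f x) \<bullet> h)) (at x)"
  by (intro has_derivative_partials smooth_differentiable)

text \<open>With t = 1 / x, the derivative of q(t) exp(-t) with respect to x is t^2 (q(t) - q'(t))
  exp(-t); the list \<open>[:0, 0, 1:]\<close> is the factor t^2.\<close>

primrec flat_poly :: "nat \<Rightarrow> real poly" where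
  "flat_poly 0 = 1"
| "flat_poly (Suc k) = [:0, 0, 1:] * (flat_poly k - pderiv (flat_poly k))"

text \<open>\<^term>\<open>flat k\<close> is the k-th derivative of the smooth function that equals exp (-1/x) for positive x
  and vanishes elsewhere.\<close>

definition flat :: "nat \<Rightarrow> real \<Rightarrow> real" where
  "flat k x = (if x > 0 then poly (flat_poly k) (1 / x) * exp (- (1 / x)) else 0)"

lemma poly_times_exp_tendsto_0: "((\<lambda>t. poly q t * exp (- t)) \<longlongrightarrow> (0::real)) at_top"
proof -
  have "((\<lambda>t. \<Sum>i\<le>degree q. coeff q i * (t ^ i / exp t)) \<longlongrightarrow> (\<Sum>i\<le>degree q. coeff q i * 0)) at_top"
    by (intro tendsto_intros tendsto_power_div_exp_0)
  then show ?thesis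
    by (simp add: poly_altdef sum_distrib_right exp_minus divide_inverse mult.assoc)
qed

lemma DERIV_flat: "(flat k has_real_derivative flat (Suc k) x) (at x)"
proof -
  consider "x > 0" | "x < 0" | "x = 0" by linarith
  then show ?thesis
  proof cases
    case 1
    have "((\<lambda>x. poly (flat_poly k) (1 / x) * exp (- (1 / x))) has_real_derivative flat (Suc k) x) (at x)"
      using 1 by (auto intro!: derivative_eq_intros DERIV_chain2[OF poly_DERIV]
          simp: flat_def field_simps power2_eq_square)
    moreover have "eventually (\<lambda>y. y > 0) (nhds x)"
      using 1 by (rule eventually_nhds_in_open[of "{0<..}" x, simplified])
    ultimately show ?thesis
      by (subst DERIV_cong_ev[OF refl _ refl]) (auto simp: flat_def elim!: eventually_mono)
  next
    case 2
    have "eventually (\<lambda>y. y < 0) (nhds x)"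
      using 2 by (rule eventually_nhds_in_open[of "{..<0}" x, simplified])
    then show ?thesis
      using 2 by (subst DERIV_cong_ev[OF refl _ refl, where g = "\<lambda>_. 0"])
        (auto simp: flat_def elim!: eventually_mono)
  next
    case 3
    \<comment> \<open>With t = 1 / h the difference quotient at 0 from the right is t q(t) exp(-t);
      \<open>pCons 0\<close> supplies the extra factor t.\<close>
    have "((\<lambda>t. poly (pCons 0 (flat_poly k)) t * exp (- t)) \<longlongrightarrow> 0) at_top"
      by (rule poly_times_exp_tendsto_0)
    then have "((\<lambda>h. poly (pCons 0 (flat_poly k)) (inverse h) * exp (- inverse h)) \<longlongrightarrow> 0) (at_right 0)"
      by (rule filterlim_compose[OF _ filterlim_inverse_at_top_right])
    then have "((\<lambda>h. (flat k (0 + h) - flat k 0) / h) \<longlongrightarrow> 0) (at_right 0)"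
      by (rule Lim_transform_eventually)
        (auto simp: eventually_at_right_field flat_def field_simps intro!: exI[of _ 1])
    moreover have "((\<lambda>h. (flat k (0 + h) - flat k 0) / h) \<longlongrightarrow> 0) (at_left 0)"
      by (rule Lim_transform_eventually[of "\<lambda>_. 0"])
        (auto simp: eventually_at_left_field flat_def intro!: exI[of _ "-1"])
    ultimately have "((\<lambda>h. (flat k (0 + h) - flat k 0) / h) \<longlongrightarrow> 0) (at 0)"
      by (simp add: filterlim_at_split)
    then show ?thesis using 3 by (simp add: has_field_derivative_iff flat_def)
  qed
qed

text \<open>A derivative turns \<open>flat k (f x)\<close> into \<open>flat (Suc k) (f x)\<close>
  times a smooth function. With these compositions as generators for every k, the closure under sums
  and products is stable under \<open>partial_deriv\<close>, and one class settles sums, products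
  and compositions at once.\<close>

inductive_set smooth_alg :: "(real^'n \<Rightarrow> real) set" where
  "smooth f \<Longrightarrow> f \<in> smooth_alg"
| "smooth f \<Longrightarrow> (\<lambda>x. flat k (f x)) \<in> smooth_alg"
| "f \<in> smooth_alg \<Longrightarrow> g \<in> smooth_alg \<Longrightarrow> (\<lambda>x. f x + g x) \<in> smooth_alg"
| "f \<in> smooth_alg \<Longrightarrow> g \<in> smooth_alg \<Longrightarrow> (\<lambda>x. f x * g x) \<in> smooth_alg"

lemma flat_comp_has_derivative:
  assumes "f differentiable (at x)"
  shows "((\<lambda>x. flat k (f x)) has_derivative
      (\<lambda>h. flat (Suc k) (f x) * ((\<chi> i. partial_deriv i f x) \<bullet> h))) (at x)"
  using has_derivative_compose[OF has_derivative_partials[OF assms]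
      DERIV_flat[of k "f x", unfolded has_field_derivative_def]]
  by (simp add: o_def)

lemma partial_deriv_flat_comp:
  "f differentiable (at x) \<Longrightarrow>
    partial_deriv i (\<lambda>x. flat k (f x)) x = flat (Suc k) (f x) * partial_deriv i f x"
  by (subst partial_deriv_eq[OF flat_comp_has_derivative]) (auto simp: inner_axis)

lemma partial_deriv_add:
  assumes "f differentiable (at x)" "g differentiable (at x)"
  shows "partial_deriv i (\<lambda>x. f x + g x) x = partial_deriv i f x + partial_deriv i g x"
  by (subst partial_deriv_eq[OF has_derivative_add[OF has_derivative_partials[OF assms(1)]
          has_derivative_partials[OF assms(2)]]]) (auto simp: inner_axis)

lemma partial_deriv_mult:
  assumes "f differentiable (at x)" "g differentiable (at x)"
  shows "partial_deriv i (\<lambda>x. f x * g x) x = partial_deriv i f x * g x + f x * partial_deriv i g x"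
  by (subst partial_deriv_eq[OF has_derivative_mult[OF has_derivative_partials[OF assms(1)]
          has_derivative_partials[OF assms(2)]]]) (auto simp: inner_axis)

lemma smooth_alg_differentiable: "f \<in> smooth_alg \<Longrightarrow> f differentiable (at x)"
proof (induction rule: smooth_alg.induct)
  case (2 f k)
  then show ?case
    by (rule differentiableI[OF flat_comp_has_derivative[OF smooth_differentiable]])
qed (simp_all add: smooth_differentiable)

lemma smooth_alg_smooth:
  fixes f :: "real^'n \<Rightarrow> real"
  assumes "f \<in> smooth_alg" shows "smooth f"
proof (rule smooth_class[OF assms])
  show "partial_deriv i g \<in> smooth_alg" if "g \<in> smooth_alg" for g :: "real^'n \<Rightarrow> real" and i
    using that
  proof (induction rule: smooth_alg.induct)
    case (1 f)
    then show ?case by (intro smooth_alg.intros smooth_partial_deriv)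
  next
    case (2 f k)
    have "partial_deriv i (\<lambda>x. flat k (f x)) = (\<lambda>x. flat (Suc k) (f x) * partial_deriv i f x)"
      using 2 by (intro ext partial_deriv_flat_comp smooth_differentiable)
    then show ?case
      using smooth_alg.intros(4)[OF smooth_alg.intros(2) smooth_alg.intros(1), of f "partial_deriv i f" "Suc k"] 2
      by (simp add: smooth_partial_deriv)
  next
    case (3 f g)
    have "partial_deriv i (\<lambda>x. f x + g x) = (\<lambda>x. partial_deriv i f x + partial_deriv i g x)"
      using 3 by (intro ext partial_deriv_add smooth_alg_differentiable)
    then show ?case
      using smooth_alg.intros(3)[of "partial_deriv i f" "partial_deriv i g"] 3 by simp
  next
    case (4 f g)
    have "partial_deriv i (\<lambda>x. f x * g x)
        = (\<lambda>x. partial_deriv i f x * g x + f x * partial_deriv i g x)"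
      using 4 by (intro ext partial_deriv_mult smooth_alg_differentiable)
    then show ?case
      using smooth_alg.intros(3)[OF smooth_alg.intros(4) smooth_alg.intros(4),
          of "partial_deriv i f" g f "partial_deriv i g"] 4 by simp
  qed
qed (rule smooth_alg_differentiable)

lemma smooth_flat_comp: "smooth f \<Longrightarrow> smooth (\<lambda>x. flat k (f x))"
  by (simp add: smooth_alg_smooth smooth_alg.intros)

lemma smooth_add: "smooth f \<Longrightarrow> smooth g \<Longrightarrow> smooth (\<lambda>x. f x + g x)"
  by (simp add: smooth_alg_smooth smooth_alg.intros)

lemma smooth_mult: "smooth f \<Longrightarrow> smooth g \<Longrightarrow> smooth (\<lambda>x. f x * g x)"
  by (simp add: smooth_alg_smooth smooth_alg.intros)

lemma smooth_const: "smooth (\<lambda>_::real^'n. c)"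
proof (rule smooth_class[of _ "{g. \<exists>c. g = (\<lambda>_. c)}"])
  fix g :: "real^'n \<Rightarrow> real" and i
  assume "g \<in> {g. \<exists>c. g = (\<lambda>_. c)}"
  then obtain c where g: "g = (\<lambda>_. c)" by auto
  have "partial_deriv i g = (\<lambda>_. 0)"
    unfolding g by (intro ext) (subst partial_deriv_eq[OF has_derivative_const], simp)
  then show "partial_deriv i g \<in> {g. \<exists>c. g = (\<lambda>_. c)}" by auto
qed auto

lemma smooth_component: "smooth (\<lambda>x::real^'n. x $ i)"
proof -
  have D: "((\<lambda>x::real^'n. x $ i) has_derivative (\<lambda>h. h $ i)) (at x)" for x
    by (rule bounded_linear.has_derivative[OF bounded_linear_vec_nth has_derivative_ident])
  have "partial_deriv j (\<lambda>x::real^'n. x $ i) = (\<lambda>_. axis j 1 $ i)" for j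
    by (intro ext partial_deriv_eq D)
  then show ?thesis
    by (intro smooth_class[of _ "{f. f = (\<lambda>x. x $ i) \<or> smooth f}"])
      (auto simp: smooth_const smooth_partial_deriv differentiableI[OF D] smooth_differentiable)
qed

lemma smooth_sum:
  assumes "\<And>i. i \<in> I \<Longrightarrow> smooth (f i)" shows "smooth (\<lambda>x. \<Sum>i\<in>I. f i x)"
  using assms by (induction I rule: infinite_finite_induct) (auto simp: smooth_const smooth_add)

lemma smooth_prod:
  assumes "\<And>i. i \<in> I \<Longrightarrow> smooth (f i)" shows "smooth (\<lambda>x. \<Prod>i\<in>I. f i x)"
  using assms by (induction I rule: infinite_finite_induct) (auto simp: smooth_const smooth_mult)

lemma partial_deriv_support:
  "closure {x. partial_deriv i f x \<noteq> 0} \<subseteq> closure {x. f x \<noteq> 0}"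
proof (rule closure_minimal)
  show "{x. partial_deriv i f x \<noteq> 0} \<subseteq> closure {x. f x \<noteq> 0}"
  proof (rule subsetI, rule ccontr)
    fix x assume x: "x \<in> {x. partial_deriv i f x \<noteq> 0}" "x \<notin> closure {x. f x \<noteq> 0}"
    let ?S = "- closure {x. f x \<noteq> 0}"
    have "(f has_derivative (\<lambda>_. 0)) (at x)"
    proof (rule has_derivative_transform_within_open[of "\<lambda>_. 0" _ _ _ ?S])
      show "0 = f y" if "y \<in> ?S" for y
        using that closure_subset[of "{x. f x \<noteq> 0}"] by auto
    qed (use x in auto)
    then have "partial_deriv i f x = 0" by (simp add: partial_deriv_eq)
    then show False using x by simp
  qed
qed simp

lemma partial_deriv_test_functions:
  assumes "\<phi> \<in> test_functions \<Omega>"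
  shows "partial_deriv i \<phi> \<in> test_functions \<Omega>"
proof -
  have \<phi>: "smooth \<phi>" "compact (closure {x. \<phi> x \<noteq> 0})" "closure {x. \<phi> x \<noteq> 0} \<subseteq> \<Omega>"
    using assms by (auto simp: test_functions_def)
  have "compact (closure {x. \<phi> x \<noteq> 0} \<inter> closure {x. partial_deriv i \<phi> x \<noteq> 0})"
    using \<phi>(2) by (intro compact_Int_closed) auto
  then have "compact (closure {x. partial_deriv i \<phi> x \<noteq> 0})"
    using partial_deriv_support[of i \<phi>] by (simp add: Int_absorb1)
  then show ?thesis
    using smooth_partial_deriv[OF \<phi>(1)] partial_deriv_support[of i \<phi>] \<phi>(3)
    unfolding test_functions_def by blast
qed

section \<open>Test functions and convolution\<close>

lemma test_functions_zero: "\<phi> \<in> test_functions \<Omega> \<Longrightarrow> x \<notin> \<Omega> \<Longrightarrow> \<phi> x = 0"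
  using closure_subset[of "{x. \<phi> x \<noteq> 0}"] by (auto simp: test_functions_def)

lemma test_functions_smooth: "\<phi> \<in> test_functions \<Omega> \<Longrightarrow> smooth \<phi>"
  by (simp add: test_functions_def)

lemma test_functions_borel [measurable (raw)]:
  "\<phi> \<in> test_functions \<Omega> \<Longrightarrow> \<phi> \<in> borel_measurable borel"
  by (intro borel_measurable_continuous_onI smooth_continuous test_functions_smooth)

lemma test_functions_bounded:
  assumes "\<phi> \<in> test_functions \<Omega>"
  obtains B where "B \<ge> 0" "\<And>x. \<bar>\<phi> x\<bar> \<le> B"
proof -
  let ?K = "closure {x. \<phi> x \<noteq> 0}"
  have "compact (\<phi> ` ?K)"
    using assms by (intro compact_continuous_image smooth_continuous) (auto simp: test_functions_def)
  then obtain B where B: "\<And>y. y \<in> \<phi> ` ?K \<Longrightarrow> \<bar>y\<bar> \<le> B"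
    using compact_imp_bounded bounded_iff by (metis real_norm_def)
  have "\<bar>\<phi> x\<bar> \<le> max 0 B" for x
  proof (cases "\<phi> x = 0")
    case False
    then show ?thesis using B[of "\<phi> x"] closure_subset[of "{x. \<phi> x \<noteq> 0}"] by force
  qed auto
  then show ?thesis using that[of "max 0 B"] by auto
qed

lemma test_functions_integrable:
  assumes "\<phi> \<in> test_functions \<Omega>"
  shows "integrable lborel \<phi>"
proof -
  let ?K = "closure {x. \<phi> x \<noteq> 0}"
  have "integrable lborel (\<lambda>x. indicator ?K x *\<^sub>R \<phi> x)"
    using assms by (intro borel_integrable_compact smooth_continuous) (auto simp: test_functions_def)
  moreover have "indicator ?K x *\<^sub>R \<phi> x = \<phi> x" for x
    using closure_subset[of "{x. \<phi> x \<noteq> 0}"] by (cases "\<phi> x = 0") (auto simp: indicator_def)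
  ultimately show ?thesis by (simp only:)
qed

definition grad :: "(real^'n \<Rightarrow> real) \<Rightarrow> real^'n \<Rightarrow> real^'n" where
  "grad \<phi> x = (\<chi> i. partial_deriv i \<phi> x)"

lemma smooth_has_grad: "smooth f \<Longrightarrow> (f has_derivative (\<lambda>h. grad f x \<bullet> h)) (at x within S)"
  unfolding grad_def by (rule has_derivative_at_withinI[OF smooth_has_derivative])

lemma norm_grad_le: "norm (grad \<phi> x) \<le> (\<Sum>i\<in>UNIV. \<bar>partial_deriv i \<phi> x\<bar>)"
  using norm_le_l1_cart[of "grad \<phi> x"] by (simp add: grad_def)

lemma test_functions_grad_bounded:
  assumes "\<phi> \<in> test_functions \<Omega>"
  obtains B where "B \<ge> 0" "\<And>x. norm (grad \<phi> x) \<le> B"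
proof -
  have "\<exists>B. \<forall>x. \<bar>partial_deriv i \<phi> x\<bar> \<le> B" for i
    using test_functions_bounded[OF partial_deriv_test_functions[OF assms]] by metis
  then obtain B where B: "\<And>i x. \<bar>partial_deriv i \<phi> x\<bar> \<le> B i" by metis
  have "norm (grad \<phi> x) \<le> (\<Sum>i\<in>UNIV. B i)" for x
    using norm_grad_le[of \<phi> x] sum_mono[of UNIV "\<lambda>i. \<bar>partial_deriv i \<phi> x\<bar>" B] B by force
  then show ?thesis using that[of "\<Sum>i\<in>UNIV. B i"] norm_ge_zero order_trans by metis
qed

lemma test_functions_grad_borel [measurable (raw)]:
  assumes "\<phi> \<in> test_functions \<Omega>"
  shows "grad \<phi> \<in> borel_measurable borel"
  unfolding grad_def
  by (intro borel_measurable_continuous_onI continuous_on_vec_lambda smooth_continuous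
      smooth_partial_deriv test_functions_smooth[OF assms])

lemma test_functions_grad_zero: "\<phi> \<in> test_functions \<Omega> \<Longrightarrow> x \<notin> \<Omega> \<Longrightarrow> grad \<phi> x = 0"
  using test_functions_zero[OF partial_deriv_test_functions] by (auto simp: grad_def vec_eq_iff)

lemma test_functions_lipschitz:
  assumes "\<phi> \<in> test_functions \<Omega>"
  obtains L where "L \<ge> 0" "\<And>x y. \<bar>\<phi> x - \<phi> y\<bar> \<le> L * norm (x - y)"
proof -
  obtain B where B: "B \<ge> 0" "\<And>x. norm (grad \<phi> x) \<le> B"
    using test_functions_grad_bounded[OF assms] by metis
  have "norm (\<phi> x - \<phi> y) \<le> B * norm (x - y)" for x y
  proof (rule differentiable_bound[of UNIV])
    fix x
    show "(\<phi> has_derivative (\<lambda>h. grad \<phi> x \<bullet> h)) (at x within UNIV)"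
      using assms by (rule smooth_has_grad[OF test_functions_smooth])
    show "onorm ((\<bullet>) (grad \<phi> x)) \<le> B"
    proof (rule onorm_bound[OF B(1)])
      show "norm (grad \<phi> x \<bullet> h) \<le> B * norm h" for h
        using Cauchy_Schwarz_ineq2[of "grad \<phi> x" h] B(2)[of x]
          mult_right_mono[of "norm (grad \<phi> x)" B "norm h"] by auto
    qed
  qed auto
  then show ?thesis using that B(1) by auto
qed

text \<open>The gradient is Lipschitz because each partial derivative is again a test function.
  Uniformity of C in x is the point: the remainder can be integrated against any integrable
  function, which differentiates a convolution under the integral.\<close>

lemma test_functions_taylor:
  assumes "\<phi> \<in> test_functions \<Omega>"
  obtains C where "C \<ge> 0" "\<And>x h. \<bar>\<phi> (x + h) - \<phi> x - grad \<phi> x \<bullet> h\<bar> \<le> C * (norm h)\<^sup>2"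
proof -
  have "\<exists>L\<ge>0. \<forall>x y. \<bar>partial_deriv i \<phi> x - partial_deriv i \<phi> y\<bar> \<le> L * norm (x - y)" for i
    using test_functions_lipschitz[OF partial_deriv_test_functions[OF assms]] by metis
  then obtain L where L0: "\<And>i. L i \<ge> 0"
    and L: "\<And>i x y. \<bar>partial_deriv i \<phi> x - partial_deriv i \<phi> y\<bar> \<le> L i * norm (x - y)"
    by metis
  define C where "C = (\<Sum>i\<in>UNIV. L i)"
  have C0: "C \<ge> 0" unfolding C_def by (intro sum_nonneg L0)
  have grad_lip: "norm (grad \<phi> x - grad \<phi> y) \<le> C * norm (x - y)" for x y
  proof -
    have "norm (grad \<phi> x - grad \<phi> y) \<le> (\<Sum>i\<in>UNIV. \<bar>partial_deriv i \<phi> x - partial_deriv i \<phi> y\<bar>)"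
      using norm_le_l1_cart[of "grad \<phi> x - grad \<phi> y"] by (simp add: grad_def)
    also have "\<dots> \<le> (\<Sum>i\<in>UNIV. L i * norm (x - y))" by (intro sum_mono L)
    finally show ?thesis by (simp add: C_def sum_distrib_right)
  qed
  have "norm (\<phi> (x + h) - \<phi> x - grad \<phi> x \<bullet> (x + h - x)) \<le> norm (x + h - x) * (C * norm h)" for x h
  proof (rule differentiable_bound_linearization[where S = "cball x (norm h)"
        and f' = "\<lambda>y h. grad \<phi> y \<bullet> h" and ?x0.0 = x])
    fix y assume y: "y \<in> cball x (norm h)"
    show "(\<phi> has_derivative (\<lambda>h. grad \<phi> y \<bullet> h)) (at y within cball x (norm h))"
      using assms by (rule smooth_has_grad[OF test_functions_smooth])
    show "onorm ((\<bullet>) (grad \<phi> y) - (\<bullet>) (grad \<phi> x)) \<le> C * norm h"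
    proof (rule onorm_bound)
      fix k
      have "norm (((\<bullet>) (grad \<phi> y) - (\<bullet>) (grad \<phi> x)) k) \<le> norm (grad \<phi> y - grad \<phi> x) * norm k"
        using Cauchy_Schwarz_ineq2[of "grad \<phi> y - grad \<phi> x" k] by (simp add: inner_diff_left)
      also have "\<dots> \<le> C * norm h * norm k"
        using y grad_lip[of y x] C0
        by (intro mult_right_mono order_trans[OF grad_lip] mult_left_mono)
          (auto simp: dist_norm norm_minus_commute)
      finally show "norm (((\<bullet>) (grad \<phi> y) - (\<bullet>) (grad \<phi> x)) k) \<le> C * norm h * norm k" .
    qed (use C0 in auto)
  next
    fix t :: real assume "t \<in> {0..1}"
    then show "x + t *\<^sub>R (x + h - x) \<in> cball x (norm h)"
      by (auto simp: dist_norm mult_left_le_one_le)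
  qed auto
  then show ?thesis using that[of C] C0 by (auto simp: power2_eq_square algebra_simps)
qed

lemma has_derivative_quadratic:
  assumes "\<And>h. \<bar>f (x + h) - f x - D \<bullet> h\<bar> \<le> C * (norm h)\<^sup>2"
  shows "(f has_derivative (\<lambda>h. D \<bullet> h)) (at x)"
proof -
  have "((\<lambda>h. norm (f (x + h) - f x - D \<bullet> h) / norm h) \<longlongrightarrow> 0) (at 0)"
  proof (rule Lim_null_comparison)
    show "\<forall>\<^sub>F h in at 0. norm (norm (f (x + h) - f x - D \<bullet> h) / norm h) \<le> C * norm h"
      using assms by (auto simp: eventually_at_filter divide_simps power2_eq_square mult.assoc)
    show "((\<lambda>h. C * norm h) \<longlongrightarrow> 0) (at 0)"
      by (auto intro!: tendsto_eq_intros)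
  qed
  then show ?thesis by (simp add: has_derivative_at bounded_linear_inner_right)
qed

section \<open>Convolution with test functions\<close>

definition conv :: "(real^'n \<Rightarrow> real) \<Rightarrow> (real^'n \<Rightarrow> real) \<Rightarrow> real^'n \<Rightarrow> real" where
  "conv f \<eta> x = (LINT z|lborel. f z * \<eta> (x - z))"

lemma conv_integrable:
  assumes f: "integrable lborel f" and \<eta>: "\<eta> \<in> test_functions UNIV"
  shows "integrable lborel (\<lambda>z. f z * \<eta> (x - z))"
proof -
  obtain B where B: "\<And>x. \<bar>\<eta> x\<bar> \<le> B" using test_functions_bounded[OF \<eta>] by metis
  have [measurable]: "f \<in> borel_measurable borel" using f by auto
  have [measurable]: "\<eta> \<in> borel_measurable borel" by (rule test_functions_borel[OF \<eta>])
  show ?thesis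
  proof (rule Bochner_Integration.integrable_bound[of _ "\<lambda>z. B * \<bar>f z\<bar>"])
    show "AE z in lborel. norm (f z * \<eta> (x - z)) \<le> norm (B * \<bar>f z\<bar>)"
    proof (rule AE_I2)
      fix z
      have "\<bar>\<eta> (x - z)\<bar> * \<bar>f z\<bar> \<le> B * \<bar>f z\<bar>" by (intro mult_right_mono B) auto
      also have "\<dots> \<le> \<bar>B * \<bar>f z\<bar>\<bar>" by simp
      finally show "norm (f z * \<eta> (x - z)) \<le> norm (B * \<bar>f z\<bar>)"
        by (simp add: abs_mult mult.commute)
    qed
  qed (use f in auto)
qed

lemma conv_has_derivative:
  assumes f: "integrable lborel f" and \<eta>: "\<eta> \<in> test_functions UNIV"
  shows "(conv f \<eta> has_derivative (\<lambda>h. (\<chi> i. conv f (partial_deriv i \<eta>) x) \<bullet> h)) (at x)"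
proof -
  obtain C where C: "C \<ge> 0" "\<And>x h. \<bar>\<eta> (x + h) - \<eta> x - grad \<eta> x \<bullet> h\<bar> \<le> C * (norm h)\<^sup>2"
    using test_functions_taylor[OF \<eta>] by metis
  show ?thesis
  proof (rule has_derivative_quadratic)
    fix h
    have i1: "integrable lborel (\<lambda>z. f z * \<eta> (y - z))" for y
      by (rule conv_integrable[OF f \<eta>])
    have i2: "integrable lborel (\<lambda>z. f z * partial_deriv i \<eta> (x - z))" for i
      by (rule conv_integrable[OF f partial_deriv_test_functions[OF \<eta>]])
    have "(\<chi> i. conv f (partial_deriv i \<eta>) x) \<bullet> h
        = (LINT z|lborel. (\<Sum>i\<in>UNIV. f z * partial_deriv i \<eta> (x - z) * h $ i))"
      using i2 by (simp add: inner_vec_def conv_def)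
    also have "\<dots> = (LINT z|lborel. f z * (grad \<eta> (x - z) \<bullet> h))"
      by (simp add: grad_def inner_vec_def sum_distrib_left mult.assoc)
    finally have grad: "(\<chi> i. conv f (partial_deriv i \<eta>) x) \<bullet> h
        = (LINT z|lborel. f z * (grad \<eta> (x - z) \<bullet> h))" .
    have "integrable lborel (\<lambda>z. \<Sum>i\<in>UNIV. f z * partial_deriv i \<eta> (x - z) * h $ i)"
      using i2 by auto
    then have i3: "integrable lborel (\<lambda>z. f z * (grad \<eta> (x - z) \<bullet> h))"
      by (simp add: grad_def inner_vec_def sum_distrib_left mult.assoc)
    have "conv f \<eta> (x + h) - conv f \<eta> x - (\<chi> i. conv f (partial_deriv i \<eta>) x) \<bullet> h
       = (LINT z|lborel. f z * (\<eta> ((x - z) + h) - \<eta> (x - z) - grad \<eta> (x - z) \<bullet> h))"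
    proof -
      have "(LINT z|lborel. f z * (\<eta> ((x - z) + h) - \<eta> (x - z) - grad \<eta> (x - z) \<bullet> h))
        = (LINT z|lborel. f z * \<eta> ((x + h) - z) - f z * \<eta> (x - z) - f z * (grad \<eta> (x - z) \<bullet> h))"
        by (simp add: right_diff_distrib add_diff_eq diff_add_eq)
      then show ?thesis
        unfolding grad using i1[of x] i1[of "x + h"] i3 by (simp add: conv_def)
    qed
    also have "\<bar>\<dots>\<bar> \<le> (LINT z|lborel. \<bar>f z\<bar> * (C * (norm h)\<^sup>2))"
    proof (rule integral_abs_bound_integral)
      show "integrable lborel (\<lambda>z. f z * (\<eta> (x - z + h) - \<eta> (x - z) - grad \<eta> (x - z) \<bullet> h))"
        using Bochner_Integration.integrable_diff[OF Bochner_Integration.integrable_diff[OF i1[of "x + h"] i1[of x]] i3]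
        by (simp add: right_diff_distrib add_diff_eq diff_add_eq)
      show "\<bar>f z * (\<eta> (x - z + h) - \<eta> (x - z) - grad \<eta> (x - z) \<bullet> h)\<bar> \<le> \<bar>f z\<bar> * (C * (norm h)\<^sup>2)" for z
        unfolding abs_mult by (intro mult_left_mono C) auto
    qed (use f in auto)
    finally show "\<bar>conv f \<eta> (x + h) - conv f \<eta> x - (\<chi> i. conv f (partial_deriv i \<eta>) x) \<bullet> h\<bar>
       \<le> ((LINT z|lborel. \<bar>f z\<bar>) * C) * (norm h)\<^sup>2"
      by (simp add: mult.assoc)
  qed
qed

lemma partial_deriv_conv:
  assumes "integrable lborel f" and "\<eta> \<in> test_functions UNIV"
  shows "partial_deriv i (conv f \<eta>) = conv f (partial_deriv i \<eta>)"
  by (intro ext) (simp add: partial_deriv_eq[OF conv_has_derivative[OF assms]] inner_axis)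

lemma smooth_conv:
  assumes f: "integrable lborel f" and "\<eta> \<in> test_functions UNIV"
  shows "smooth (conv f \<eta>)"
proof (rule smooth_class[of _ "conv f ` test_functions UNIV"])
  show "g differentiable (at x)" if "g \<in> conv f ` test_functions UNIV" for g x
    using that conv_has_derivative[OF f] by (auto simp: differentiable_def)
  show "partial_deriv i g \<in> conv f ` test_functions UNIV" if "g \<in> conv f ` test_functions UNIV" for g i
    using that partial_deriv_conv[OF f] partial_deriv_test_functions by fastforce
qed (use assms in auto)

lemma mollifier_exists:
  assumes "e > 0"
  obtains \<eta> :: "real^'n \<Rightarrow> real"
  where "\<eta> \<in> test_functions UNIV" "\<And>x. \<eta> x \<ge> 0" "\<And>x. norm x \<ge> e \<Longrightarrow> \<eta> x = 0"
    "(LINT x|lborel. \<eta> x) = 1"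
proof -
  \<comment> \<open>The argument is e^2 - |x|^2, positive exactly on the open ball; it is spelled
    out with sums and products so that the closure rules for \<open>smooth\<close> match.\<close>
  define b where "b x = flat 0 (e\<^sup>2 + (\<Sum>i\<in>UNIV. (-1) * (x $ i * x $ i)))" for x :: "real^'n"
  have b_eq: "b x = flat 0 (e\<^sup>2 - (norm x)\<^sup>2)" for x
    by (simp add: b_def sum_negf power2_norm_eq_inner inner_vec_def)
  have sm: "smooth b"
    unfolding b_def
    by (intro smooth_flat_comp smooth_add smooth_sum smooth_mult smooth_const smooth_component)
  have b_nonneg: "b x \<ge> 0" for x by (simp add: b_eq flat_def)
  have b_pos: "b x > 0 \<longleftrightarrow> norm x < e" for x
    using power_mono_iff[of e "norm x" 2] assms by (auto simp: b_eq flat_def not_le[symmetric])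
  have supp: "{x. b x \<noteq> 0} \<subseteq> cball 0 e"
    using b_pos b_nonneg by (force simp: less_le)
  have clos: "closure {x. b x \<noteq> 0} \<subseteq> cball 0 e"
    by (rule closure_minimal[OF supp]) auto
  have "compact (closure {x. b x \<noteq> 0})"
    using clos by (metis bounded_cball bounded_subset closed_closure compact_eq_bounded_closed)
  then have bt: "b \<in> test_functions UNIV"
    using sm by (simp add: test_functions_def)
  define c where "c = (LINT x|lborel. b x)"
  have "c \<noteq> 0"
  proof
    assume "c = 0"
    then have "AE x in lborel. b x = 0"
      unfolding c_def
      by (subst (asm) integral_nonneg_eq_0_iff_AE) (auto intro: test_functions_integrable[OF bt] b_nonneg)
    then have "AE x::real^'n in lborel. x \<notin> ball 0 e"
    proof (rule AE_mp, intro AE_I2 impI)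
      show "x \<notin> ball 0 e" if "b x = 0" for x using b_pos[of x] that by simp
    qed
    then have "ball (0::real^'n) e \<in> null_sets lborel"
      by (subst AE_iff_null_sets) auto
    then have "negligible (ball (0::real^'n) e)"
      by (simp add: negligible_iff_null_sets null_sets_completionI)
    then show False
      using assms open_not_negligible[of "ball (0::real^'n) e"] by simp
  qed
  moreover have "c \<ge> 0" unfolding c_def by (intro integral_nonneg_AE AE_I2 b_nonneg)
  ultimately have c: "c > 0" by simp
  have "(\<lambda>x. b x * (1 / c)) \<in> test_functions UNIV"
  proof -
    have "{x. b x * (1 / c) \<noteq> 0} = {x. b x \<noteq> 0}" using c by auto
    moreover have "smooth (\<lambda>x. b x * (1 / c))" by (intro smooth_mult sm smooth_const)
    ultimately show ?thesis using bt by (simp only: test_functions_def mem_Collect_eq)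
  qed
  moreover have "b x * (1 / c) = 0" if "norm x \<ge> e" for x
    using that b_pos[of x] b_nonneg[of x] by (auto simp: less_le)
  moreover have "(LINT x|lborel. b x * (1 / c)) = 1"
    using c by (simp add: c_def)
  ultimately show ?thesis
    using that[of "\<lambda>x. b x * (1 / c)"] c b_nonneg by auto
qed

section \<open>The fundamental lemma of the calculus of variations\<close>

lemma AE_lebesgue_on_iff:
  fixes \<Omega> :: "'a::euclidean_space set"
  assumes "open \<Omega>"
  shows "(AE x in lebesgue_on \<Omega>. P x) \<longleftrightarrow> (AE x in lborel. x \<in> \<Omega> \<longrightarrow> P x)"
  using assms by (simp add: AE_restrict_space_iff AE_completion_iff)

lemma lebesgue_borel_rep:
  fixes f :: "'a::euclidean_space \<Rightarrow> real"
  assumes "f \<in> borel_measurable lebesgue"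
  obtains g where "g \<in> borel_measurable borel" "AE x in lborel. f x = g x"
  using completion_ex_borel_measurable_real[OF assms] by auto

text \<open>Entrance to the setting of the later estimates: Borel functions on the whole space,
  extended by zero, where Tonelli's theorem and affine substitution for \<open>lborel\<close>
  apply.\<close>

lemma lebesgue_on_borel_rep:
  fixes f :: "'a::euclidean_space \<Rightarrow> real"
  assumes "open \<Omega>" and f: "f \<in> borel_measurable (lebesgue_on \<Omega>)"
  obtains g where "g \<in> borel_measurable borel" "\<And>x. x \<notin> \<Omega> \<Longrightarrow> g x = 0"
    "AE x in lebesgue_on \<Omega>. f x = g x"
proof -
  have [measurable]: "\<Omega> \<in> sets borel" using assms by auto
  have "(\<lambda>x. if x \<in> \<Omega> then f x else 0) \<in> borel_measurable lebesgue"
    using f assms(1) by (simp add: borel_measurable_if)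
  then obtain g where g [measurable]: "g \<in> borel_measurable borel"
    and eq: "AE x in lborel. (if x \<in> \<Omega> then f x else 0) = g x"
    using lebesgue_borel_rep by blast
  show ?thesis
  proof (rule that)
    show "AE x in lebesgue_on \<Omega>. f x = (if x \<in> \<Omega> then g x else 0)"
      using eq by (auto simp: AE_lebesgue_on_iff[OF assms(1)])
  qed auto
qed

lemma integral_lebesgue_on_borel:
  fixes g :: "'a::euclidean_space \<Rightarrow> real"
  assumes "open \<Omega>" and g: "g \<in> borel_measurable borel" and z: "\<And>x. x \<notin> \<Omega> \<Longrightarrow> g x = 0"
  shows "(LINT x|lebesgue_on \<Omega>. g x) = (LINT x|lborel. g x)"
    and "integrable (lebesgue_on \<Omega>) g \<longleftrightarrow> integrable lborel g"
proof -
  have "(\<lambda>x. indicator \<Omega> x *\<^sub>R g x) = g"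
    using z by (auto simp: indicator_def fun_eq_iff)
  then show "(LINT x|lebesgue_on \<Omega>. g x) = (LINT x|lborel. g x)"
    "integrable (lebesgue_on \<Omega>) g \<longleftrightarrow> integrable lborel g"
    using assms by (simp_all add: integral_restrict_space integrable_restrict_space
        integral_completion integrable_completion)
qed

text \<open>The measures with the positive and the negative part of f as densities agree on boxes,
  an intersection stable generator, hence everywhere; densities with respect to a sigma-finite
  measure are unique almost everywhere.\<close>

lemma AE_zero_if_box_integrals_zero:
  fixes f :: "'a::euclidean_space \<Rightarrow> real"
  assumes f: "integrable lborel f"
    and z: "\<And>a b. (LINT x|lborel. indicator (box a b) x * f x) = 0"
  shows "AE x in lborel. f x = 0"
proof -
  have [measurable]: "f \<in> borel_measurable borel" using f by auto
  define P where "P = density lborel (\<lambda>x. ennreal (max 0 (f x)))"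
  define N where "N = density lborel (\<lambda>x. ennreal (max 0 (- f x)))"
  have em: "emeasure (density lborel (\<lambda>x. ennreal (max 0 (g x)))) (box a b)
      = ennreal (LINT x|lborel. indicator (box a b) x * max 0 (g x))"
    if "integrable lborel g" for g :: "'a \<Rightarrow> real" and a b
  proof -
    have [measurable]: "g \<in> borel_measurable borel" using that by auto
    have "emeasure (density lborel (\<lambda>x. ennreal (max 0 (g x)))) (box a b)
        = (\<integral>\<^sup>+x. ennreal (indicator (box a b) x * max 0 (g x)) \<partial>lborel)"
      by (subst emeasure_density) (auto simp: indicator_def intro!: nn_integral_cong)
    also have "\<dots> = ennreal (LINT x|lborel. indicator (box a b) x * max 0 (g x))"
    proof (rule nn_integral_eq_integral)
      show "integrable lborel (\<lambda>x. indicator (box a b) x * max 0 (g x))"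
        by (rule Bochner_Integration.integrable_bound[OF that]) (auto simp: indicator_def)
    qed auto
    finally show ?thesis .
  qed
  have "P = N"
  proof (rule measure_eqI_generator_eq)
    let ?E = "range (\<lambda>(a, b). box a b::'a set)"
    show "Int_stable ?E"
      by (auto simp: Int_stable_def box_Int_box)
    show "?E \<subseteq> Pow UNIV" "sets P = sigma_sets UNIV ?E" "sets N = sigma_sets UNIV ?E"
      by (simp_all add: borel_eq_box P_def N_def)
    let ?A = "\<lambda>n::nat. box (- (real n *\<^sub>R One)) (real n *\<^sub>R One) :: 'a set"
    show "range ?A \<subseteq> ?E" "(\<Union>i. ?A i) = UNIV"
      unfolding UN_box_eq_UNIV by auto
    show "emeasure P (?A i) \<noteq> \<infinity>" for i
      using em[OF f] by (simp add: P_def)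
    show "emeasure P X = emeasure N X" if X: "X \<in> ?E" for X
    proof -
      obtain a b where X: "X = box a b" using X by auto
      have bd: "integrable lborel (\<lambda>x. indicator (box a b) x * max 0 (f x))"
        "integrable lborel (\<lambda>x. indicator (box a b) x * max 0 (- f x))"
        by (rule Bochner_Integration.integrable_bound[OF f], auto simp: indicator_def)+
      have "(LINT x|lborel. indicator (box a b) x * max 0 (f x))
          - (LINT x|lborel. indicator (box a b) x * max 0 (- f x))
          = (LINT x|lborel. indicator (box a b) x * f x)"
        by (subst Bochner_Integration.integral_diff[OF bd, symmetric], intro Bochner_Integration.integral_cong)
          (auto simp: indicator_def max_def)
      then show ?thesis
        using z[of a b] em[OF f, of a b] em[of "\<lambda>x. - f x" a b] f by (simp add: X P_def N_def)
    qed
  qed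
  then have "AE x in lborel. ennreal (max 0 (f x)) = ennreal (max 0 (- f x))"
    unfolding P_def N_def by (intro sigma_finite_measure.density_unique[OF lborel.sigma_finite_measure_axioms]) auto
  then show ?thesis
    by eventually_elim (auto simp: max_def split: if_splits)
qed

lemma flat_0_bounds: "0 \<le> flat 0 x" "flat 0 x \<le> 1" "x \<le> 0 \<Longrightarrow> flat 0 x = 0"
  by (auto simp: flat_def)

lemma flat_0_scale_tendsto:
  "(\<lambda>j. flat 0 (real j * y)) \<longlonglongrightarrow> (if y > 0 then 1 else 0)"
proof (cases "y > 0")
  case True
  have "(\<lambda>j. exp (- (1 / (real j * y)))) \<longlonglongrightarrow> exp (- 0)"
  proof (intro tendsto_intros)
    have "(\<lambda>j. inverse (real j) * (1 / y)) \<longlonglongrightarrow> 0 * (1 / y)"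
      by (intro tendsto_intros lim_inverse_n)
    then show "(\<lambda>j. 1 / (real j * y)) \<longlonglongrightarrow> 0"
      by (simp add: field_simps)
  qed
  moreover have "\<forall>\<^sub>F j in sequentially. exp (- (1 / (real j * y))) = flat 0 (real j * y)"
    using eventually_gt_at_top[of 0] by eventually_elim (use True in \<open>auto simp: flat_def\<close>)
  ultimately show ?thesis
    using True by (simp add: tendsto_cong)
next
  case False
  then have "flat 0 (real j * y) = 0" for j
    by (intro flat_0_bounds) (simp add: mult_nonneg_nonpos)
  then show ?thesis using False by simp
qed

text \<open>A product over the faces of the box of profiles \<open>flat 0\<close>, each tending to a
  step function as j grows. It vanishes off the box for every j, so dominated convergence leads from
  test functions to the indicator of the box.\<close>

definition box_bump :: "real^'n \<Rightarrow> real^'n \<Rightarrow> nat \<Rightarrow> real^'n \<Rightarrow> real" where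
  "box_bump a b j x =
    (\<Prod>i\<in>UNIV. flat 0 (real j * (x $ i + - a $ i)) * flat 0 (real j * (b $ i + -1 * x $ i)))"

lemma box_bump_smooth: "smooth (box_bump a b j)"
  unfolding box_bump_def[abs_def]
  by (intro smooth_prod smooth_mult smooth_flat_comp smooth_add smooth_const smooth_component)

lemma box_bump_bounds: "0 \<le> box_bump a b j x" "box_bump a b j x \<le> 1"
  unfolding box_bump_def
  by (auto intro!: prod_nonneg prod_le_1 mult_le_one mult_nonneg_nonneg flat_0_bounds)

lemma box_bump_zero: "x \<notin> box a b \<Longrightarrow> box_bump a b j x = 0"
  unfolding box_bump_def
  by (fastforce simp: mem_box_cart not_less intro!: flat_0_bounds(3) mult_nonneg_nonpos)

lemma box_bump_tendsto: "(\<lambda>j. box_bump a b j x) \<longlonglongrightarrow> indicator (box a b) x"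
proof (cases "x \<in> box a b")
  case False
  then show ?thesis by (simp add: box_bump_zero)
next
  case True
  have "(\<lambda>j. box_bump a b j x) \<longlonglongrightarrow>
      (\<Prod>i\<in>UNIV. (if x $ i + - a $ i > 0 then 1 else 0) * (if b $ i + -1 * x $ i > 0 then 1 else 0))"
    unfolding box_bump_def by (intro tendsto_intros flat_0_scale_tendsto)
  then show ?thesis using True by (simp add: mem_box_cart)
qed

lemma box_bump_test_function:
  assumes "cbox a b \<subseteq> \<Omega>" "box a' b' \<subseteq> cbox a b"
  shows "box_bump a' b' j \<in> test_functions \<Omega>"
proof -
  have "{x. box_bump a' b' j x \<noteq> 0} \<subseteq> cbox a b"
    using assms(2) box_bump_zero by blast
  then have cl: "closure {x. box_bump a' b' j x \<noteq> 0} \<subseteq> cbox a b"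
    by (rule closure_minimal) auto
  then have "compact (closure {x. box_bump a' b' j x \<noteq> 0})"
    by (metis bounded_cbox bounded_subset closed_closure compact_eq_bounded_closed)
  then show ?thesis
    using cl assms(1) by (auto simp: test_functions_def box_bump_smooth)
qed

text \<open>On a closed box inside \<Omega> the function is integrable, and box bumps in the limit
  show that its integrals over smaller boxes vanish. Countably many closed boxes exhaust
  \<Omega>.\<close>

lemma fundamental_lemma:
  assumes "open \<Omega>" and g: "loc_integrable \<Omega> g"
    and z: "\<And>\<phi>. \<phi> \<in> test_functions \<Omega> \<Longrightarrow> (LINT x|lebesgue_on \<Omega>. g x * \<phi> x) = 0"
  shows "AE x in lebesgue_on \<Omega>. g x = 0"
proof -
  have cbox_zero: "AE x in lborel. x \<in> cbox a b \<longrightarrow> g x = 0" if ab: "cbox a b \<subseteq> \<Omega>" for a b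
  proof -
    have "integrable (lebesgue_on (cbox a b)) g"
      using g ab by (simp add: loc_integrable_def)
    then have f0: "integrable lebesgue (\<lambda>x. indicator (cbox a b) x * g x)"
      by (simp add: integrable_restrict_space)
    then obtain f where fm [measurable]: "f \<in> borel_measurable borel"
      and eq: "AE x in lborel. indicator (cbox a b) x * g x = f x"
      using lebesgue_borel_rep borel_measurable_integrable by blast
    have eq': "AE x in lebesgue. indicator (cbox a b) x * g x = f x"
      using eq by (simp add: AE_completion_iff)
    have fm': "f \<in> borel_measurable lebesgue" by (intro measurable_completion) simp
    have f: "integrable lborel f"
      using f0 integrable_cong_AE[OF borel_measurable_integrable[OF f0] fm' eq']
      by (simp add: integrable_completion)
    have test: "(LINT x|lborel. f x * \<phi> x) = 0"
      if \<phi>: "\<phi> \<in> test_functions \<Omega>" "\<And>x. x \<notin> cbox a b \<Longrightarrow> \<phi> x = 0" for \<phi>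
    proof -
      have [measurable]: "\<phi> \<in> borel_measurable borel" by (rule test_functions_borel[OF \<phi>(1)])
      have \<phi>m: "\<phi> \<in> borel_measurable lebesgue" by (intro measurable_completion) simp
      have "(LINT x|lborel. f x * \<phi> x) = (LINT x|lebesgue. f x * \<phi> x)"
        by (intro integral_completion[symmetric]) auto
      also have "\<dots> = (LINT x|lebesgue. (indicator (cbox a b) x * g x) * \<phi> x)"
      proof (rule integral_cong_AE)
        show "(\<lambda>x. f x * \<phi> x) \<in> borel_measurable lebesgue"
          using fm' \<phi>m by (rule borel_measurable_times)
        show "(\<lambda>x. indicator (cbox a b) x * g x * \<phi> x) \<in> borel_measurable lebesgue"
          using borel_measurable_integrable[OF f0] \<phi>m by (rule borel_measurable_times)
        show "AE x in lebesgue. f x * \<phi> x = indicator (cbox a b) x * g x * \<phi> x"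
          using eq' by eventually_elim auto
      qed
      also have "\<dots> = (LINT x|lebesgue. indicator \<Omega> x *\<^sub>R (g x * \<phi> x))"
        using \<phi>(2) ab by (intro Bochner_Integration.integral_cong) (auto simp: indicator_def)
      also have "\<dots> = (LINT x|lebesgue_on \<Omega>. g x * \<phi> x)"
        using assms(1) by (simp add: integral_restrict_space)
      finally show ?thesis using z[OF \<phi>(1)] by simp
    qed
    have "AE x in lborel. indicator (box a b) x * f x = 0"
    proof (rule AE_zero_if_box_integrals_zero)
      show "integrable lborel (\<lambda>x. indicator (box a b) x * f x)"
        by (rule Bochner_Integration.integrable_bound[OF f]) (auto simp: indicator_def)
      fix a' b'
      obtain c d where cd: "box a' b' \<inter> box a b = box c d"
        using box_Int_box by blast
      have sub: "box c d \<subseteq> cbox a b"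
        using cd box_subset_cbox[of a b] by blast
      have "(\<lambda>j. LINT x|lborel. f x * box_bump c d j x) \<longlonglongrightarrow> (LINT x|lborel. f x * indicator (box c d) x)"
      proof (rule integral_dominated_convergence[where w = "\<lambda>x. \<bar>f x\<bar>"])
        show "(\<lambda>x. f x * box_bump c d j x) \<in> borel_measurable lborel" for j
          using borel_measurable_continuous_onI[OF smooth_continuous[OF box_bump_smooth]] by measurable
        show "AE x in lborel. (\<lambda>j. f x * box_bump c d j x) \<longlonglongrightarrow> f x * indicator (box c d) x"
          by (intro AE_I2 tendsto_intros box_bump_tendsto)
        show "AE x in lborel. norm (f x * box_bump c d j x) \<le> \<bar>f x\<bar>" for j
          by (intro AE_I2) (simp add: abs_mult box_bump_bounds mult_left_le)
      qed (use f in auto)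
      moreover have "(LINT x|lborel. f x * box_bump c d j x) = 0" for j
        using sub by (intro test box_bump_test_function[OF ab sub] box_bump_zero) auto
      ultimately have "(LINT x|lborel. f x * indicator (box c d) x) = 0"
        by (simp add: LIMSEQ_const_iff)
      moreover have "f x * indicator (box c d) x = indicator (box a' b') x * (indicator (box a b) x * f x)" for x
        unfolding cd[symmetric] by (simp add: indicator_def)
      ultimately show "(LINT x|lborel. indicator (box a' b') x * (indicator (box a b) x * f x)) = 0"
        by simp
    qed
    \<comment> \<open>The cover consists of closed boxes while the integrals only see the open one;
      the faces form a null set.\<close>
    moreover have "AE x in lborel. x \<notin> cbox a b - box a b"
    proof -
      have "AE x in lebesgue. x \<notin> cbox a b - box a b"
        using negligible_frontier_interval[of a b] by (intro AE_not_in) (simp add: negligible_iff_null_sets)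
      then show ?thesis by (simp add: AE_completion_iff)
    qed
    ultimately show ?thesis
      using eq by eventually_elim (auto simp: indicator_def split: if_splits)
  qed
  obtain D where D: "countable D" "D \<subseteq> Pow \<Omega>" "\<And>X. X \<in> D \<Longrightarrow> \<exists>a b. X = cbox a b" "\<Union>D = \<Omega>"
    using open_countable_Union_open_cbox[OF assms(1)] by metis
  have "AE x in lborel. \<forall>X\<in>D. x \<in> X \<longrightarrow> g x = 0"
  proof (subst AE_ball_countable[OF D(1)], rule ballI)
    fix X assume X: "X \<in> D"
    then obtain a b where "X = cbox a b" using D(3) by blast
    then show "AE x in lborel. x \<in> X \<longrightarrow> g x = 0" using cbox_zero X D(2) by blast
  qed
  then show ?thesis
    unfolding AE_lebesgue_on_iff[OF assms(1)] using D(4) by (auto elim!: eventually_mono)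
qed

lemma loc_integrable_times_test:
  assumes "open \<Omega>" and g: "loc_integrable \<Omega> g" and \<phi>: "\<phi> \<in> test_functions \<Omega>"
  shows "integrable (lebesgue_on \<Omega>) (\<lambda>x. g x * \<phi> x)"
proof -
  let ?K = "closure {x. \<phi> x \<noteq> 0}"
  have K: "compact ?K" "?K \<subseteq> \<Omega>" using \<phi> by (auto simp: test_functions_def)
  have Km: "?K \<in> sets lebesgue" by (simp add: borel_closed)
  have gK: "integrable lebesgue (\<lambda>x. indicator ?K x * g x)"
  proof -
    have "integrable (lebesgue_on ?K) g" using g K unfolding loc_integrable_def by blast
    then show ?thesis using Km by (simp add: integrable_restrict_space)
  qed
  obtain B where B: "\<And>x. \<bar>\<phi> x\<bar> \<le> B" using test_functions_bounded[OF \<phi>] by metis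
  have \<phi>m: "\<phi> \<in> borel_measurable lebesgue"
    using test_functions_borel[OF \<phi>] by (intro measurable_completion) simp
  have "integrable lebesgue (\<lambda>x. (indicator ?K x * g x) * \<phi> x)"
  proof (rule Bochner_Integration.integrable_bound[of _ "\<lambda>x. B * (indicator ?K x * g x)"])
    show "(\<lambda>x. (indicator ?K x * g x) * \<phi> x) \<in> borel_measurable lebesgue"
      using borel_measurable_integrable[OF gK] \<phi>m by (rule borel_measurable_times)
    show "AE x in lebesgue. norm (indicator ?K x * g x * \<phi> x) \<le> norm (B * (indicator ?K x * g x))"
    proof (rule AE_I2)
      fix x
      have "\<bar>\<phi> x\<bar> * \<bar>indicator ?K x * g x\<bar> \<le> \<bar>B\<bar> * \<bar>indicator ?K x * g x\<bar>"
        using B[of x] by (intro mult_right_mono) auto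
      then show "norm (indicator ?K x * g x * \<phi> x) \<le> norm (B * (indicator ?K x * g x))"
        by (simp add: abs_mult mult_ac)
    qed
  qed (use gK in auto)
  moreover have "(indicator ?K x * g x) * \<phi> x = indicator \<Omega> x *\<^sub>R (g x * \<phi> x)" for x
    using K(2) closure_subset[of "{x. \<phi> x \<noteq> 0}"] by (cases "\<phi> x = 0") (auto simp: indicator_def)
  ultimately have "integrable lebesgue (\<lambda>x. indicator \<Omega> x *\<^sub>R (g x * \<phi> x))" by (simp only:)
  then show ?thesis using assms(1) by (simp add: integrable_restrict_space)
qed

lemma loc_integrable_diff:
  "loc_integrable \<Omega> f \<Longrightarrow> loc_integrable \<Omega> g \<Longrightarrow> loc_integrable \<Omega> (\<lambda>x. f x - g x)"
  by (simp add: loc_integrable_def)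

lemma has_weak_deriv_diff:
  assumes "open \<Omega>" and f: "has_weak_deriv \<Omega> [i] f f'" and g: "has_weak_deriv \<Omega> [i] g g'"
  shows "has_weak_deriv \<Omega> [i] (\<lambda>x. f x - g x) (\<lambda>x. f' x - g' x)"
  unfolding has_weak_deriv_def
proof (intro conjI ballI)
  fix \<phi> assume \<phi>: "\<phi> \<in> test_functions \<Omega>"
  note d\<phi> = partial_deriv_test_functions[OF \<phi>, of i]
  show "(LINT x|lebesgue_on \<Omega>. (f x - g x) * partial_derivs [i] \<phi> x) =
      (-1) ^ length [i] * (LINT x|lebesgue_on \<Omega>. (f' x - g' x) * \<phi> x)"
    using f g \<phi> d\<phi> loc_integrable_times_test[OF assms(1)]
    by (simp add: has_weak_deriv_def left_diff_distrib)
qed (use f g in \<open>auto simp: has_weak_deriv_def intro: loc_integrable_diff\<close>)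

lemma has_weak_deriv_unique:
  assumes "open \<Omega>" and "has_weak_deriv \<Omega> is f g" and "has_weak_deriv \<Omega> is f h"
  shows "AE x in lebesgue_on \<Omega>. g x = h x"
proof -
  have "AE x in lebesgue_on \<Omega>. g x - h x = 0"
  proof (rule fundamental_lemma[OF assms(1)])
    show "loc_integrable \<Omega> (\<lambda>x. g x - h x)"
      using assms by (intro loc_integrable_diff) (auto simp: has_weak_deriv_def)
    show "(LINT x|lebesgue_on \<Omega>. (g x - h x) * \<phi> x) = 0" if \<phi>: "\<phi> \<in> test_functions \<Omega>" for \<phi>
      using assms \<phi> loc_integrable_times_test[OF assms(1)]
      by (simp add: has_weak_deriv_def left_diff_distrib)
  qed
  then show ?thesis by eventually_elim simp
qed

section \<open>Truncation and mollification\<close>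

lemma lborel_distr_reflect:
  fixes c :: "'a::euclidean_space"
  shows "distr lborel borel (\<lambda>x. c - x) = lborel"
  by (subst lborel_affine[of "-1" c], auto simp: density_1)

lemma lborel_integral_reflect:
  fixes f :: "'a::euclidean_space \<Rightarrow> real"
  assumes [measurable]: "f \<in> borel_measurable borel"
  shows "integrable lborel (\<lambda>z. f (x - z)) \<longleftrightarrow> integrable lborel f"
    and "(LINT z|lborel. f (x - z)) = (LINT z|lborel. f z)"
  by (subst (2) lborel_distr_reflect[of x, symmetric], simp add: integrable_distr_eq)
    (subst (2) lborel_distr_reflect[of x, symmetric], simp add: integral_distr)

text \<open>Convolution with a nonnegative kernel of mass 1 averages the values of f over the ball
  of radius \<rho> around x. With a = 0 and e = 0 the same bound shows that supports grow by at most
  \<rho>.\<close>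

lemma conv_near:
  assumes f: "integrable lborel f" and \<eta>: "\<eta> \<in> test_functions UNIV"
    and \<eta>0: "\<And>x. \<eta> x \<ge> 0" and supp: "\<And>x. norm x \<ge> \<rho> \<Longrightarrow> \<eta> x = 0" and one: "(LINT x|lborel. \<eta> x) = 1"
    and near: "\<And>z. norm (x - z) < \<rho> \<Longrightarrow> \<bar>f z - a\<bar> \<le> e"
  shows "\<bar>conv f \<eta> x - a\<bar> \<le> e"
proof -
  have m: "\<eta> \<in> borel_measurable borel" by (rule test_functions_borel[OF \<eta>])
  have i1: "integrable lborel (\<lambda>z. \<eta> (x - z))"
    using test_functions_integrable[OF \<eta>] lborel_integral_reflect(1)[OF m] by simp
  have i2: "integrable lborel (\<lambda>z. f z * \<eta> (x - z))"
    by (rule conv_integrable[OF f \<eta>])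
  have i3: "integrable lborel (\<lambda>z. (f z - a) * \<eta> (x - z))"
    using i1 i2 by (simp add: left_diff_distrib)
  have "conv f \<eta> x - a = (LINT z|lborel. (f z - a) * \<eta> (x - z))"
    using i1 i2 lborel_integral_reflect(2)[OF m, of x] one
    by (simp add: conv_def left_diff_distrib)
  also have "\<bar>\<dots>\<bar> \<le> (LINT z|lborel. e * \<eta> (x - z))"
  proof (rule integral_abs_bound_integral[OF i3])
    show "\<bar>(f z - a) * \<eta> (x - z)\<bar> \<le> e * \<eta> (x - z)" for z
    proof (cases "norm (x - z) < \<rho>")
      case True
      then show ?thesis
        using near[OF True] \<eta>0[of "x - z"] by (simp add: abs_mult mult_right_mono)
    qed (simp add: supp)
  qed (use i1 in auto)
  also have "\<dots> = e"
    using lborel_integral_reflect(2)[OF m, of x] one by simp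
  finally show ?thesis .
qed

lemma nn_integral_translate:
  fixes f :: "'a::euclidean_space \<Rightarrow> ennreal"
  assumes [measurable]: "f \<in> borel_measurable borel"
  shows "(\<integral>\<^sup>+x. f (c + x) \<partial>lborel) = (\<integral>\<^sup>+x. f x \<partial>lborel)"
  by (subst (2) lborel_distr_plus[of c, symmetric]) (simp add: nn_integral_distr)

lemma nn_integral_affine:
  fixes f :: "'a::euclidean_space \<Rightarrow> ennreal"
  assumes [measurable]: "f \<in> borel_measurable borel" and "t > 0"
  shows "(\<integral>\<^sup>+x. f (c + t *\<^sub>R x) \<partial>lborel) = ennreal ((1 / t) ^ DIM('a)) * (\<integral>\<^sup>+x. f x \<partial>lborel)"
proof -
  have "(\<integral>\<^sup>+x. f x \<partial>lborel) = ennreal (t ^ DIM('a)) * (\<integral>\<^sup>+x. f (c + t *\<^sub>R x) \<partial>lborel)"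
    by (subst lborel_affine[of t c]) (use assms in \<open>simp_all add: nn_integral_density nn_integral_distr nn_integral_cmult\<close>)
  then show ?thesis
    using assms(2) by (simp add: mult.assoc[symmetric] ennreal_mult'[symmetric] power_divide)
qed

section \<open>Smooth truncation of small values\<close>

lemma flat_continuous [continuous_intros]:
  "continuous_on S f \<Longrightarrow> continuous_on S (\<lambda>x. flat k (f x))"
  using continuous_on_compose2[of UNIV "flat k" S f] DERIV_flat[of k]
  by (meson DERIV_isCont continuous_at_imp_continuous_on subset_UNIV)

lemma flat_nonpos: "x \<le> 0 \<Longrightarrow> flat k x = 0"
  by (simp add: flat_def)

lemma flat_1: "x > 0 \<Longrightarrow> flat (Suc 0) x = exp (- (1 / x)) / x\<^sup>2"
  by (simp add: flat_def power2_eq_square divide_inverse)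

text \<open>Composition with \<^term>\<open>trunc d\<close> turns a function vanishing on the boundary into one with compact
  support, with \<^term>\<open>trunc'\<close> in the chain rule.\<close>

definition trunc :: "real \<Rightarrow> real \<Rightarrow> real" where
  "trunc d s = s * flat 0 ((s / d)\<^sup>2 - 1)"

definition trunc' :: "real \<Rightarrow> real \<Rightarrow> real" where
  "trunc' d s = flat 0 ((s / d)\<^sup>2 - 1) + 2 * (s / d)\<^sup>2 * flat 1 ((s / d)\<^sup>2 - 1)"

lemma trunc_small:
  assumes "d > 0" "\<bar>s\<bar> \<le> d"
  shows "trunc d s = 0" "trunc' d s = 0"
proof -
  have "(s / d)\<^sup>2 - 1 \<le> 0"
    using assms by (simp add: power_divide divide_le_eq abs_le_square_iff[symmetric])
  then show "trunc d s = 0" "trunc' d s = 0"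
    by (simp_all add: trunc_def trunc'_def flat_nonpos)
qed

lemma trunc_bound: "\<bar>trunc d s\<bar> \<le> \<bar>s\<bar>"
  unfolding trunc_def abs_mult using flat_0_bounds by (simp add: mult_left_le)

text \<open>The bound does not depend on d, which is what dominated convergence for d tending to 0
  asks for. With r = (s / d)^2 - 1 and t = 1 / r the second summand is 2 (t + t^2) exp(-t), at most
  4 because t + t^2 \<le> 2 exp t; the first is at most 1.\<close>

lemma trunc'_bound: "\<bar>trunc' d s\<bar> \<le> 5"
proof -
  define r where "r = (s / d)\<^sup>2 - 1"
  have "0 \<le> (r + 1) * flat 1 r \<and> (r + 1) * flat 1 r \<le> 2"
  proof (cases "r > 0")
    case True
    define t where "t = 1 / r"
    have t: "t > 0" using True by (simp add: t_def)
    have eq: "(r + 1) * flat 1 r = (t + t\<^sup>2) * exp (- t)"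
      using True by (simp add: flat_1 t_def power2_eq_square field_simps)
    have "t + t\<^sup>2 \<le> 2 * exp t"
      using exp_lower_Taylor_quadratic[of t] t by (simp add: power2_eq_square)
    then have "(t + t\<^sup>2) * exp (- t) \<le> 2 * exp t * exp (- t)"
      by (rule mult_right_mono) simp
    moreover have "0 \<le> (t + t\<^sup>2) * exp (- t)" using t by simp
    ultimately show ?thesis
      unfolding eq by (simp add: mult.assoc mult_exp_exp)
  qed (simp add: flat_nonpos)
  moreover have "trunc' d s = flat 0 r + 2 * ((r + 1) * flat 1 r)"
    by (simp add: trunc'_def r_def)
  ultimately show ?thesis
    using flat_0_bounds[of r] by simp
qed

lemma trunc_continuous: "continuous_on S (trunc d)" "continuous_on S (trunc' d)"
  unfolding trunc_def trunc'_def divide_inverse by (intro continuous_intros)+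

lemma flat_tendsto_at_top:
  "(flat 0 \<longlongrightarrow> 1) at_top" "((\<lambda>r. (r + 1) * flat 1 r) \<longlongrightarrow> 0) at_top"
proof -
  have inv: "((\<lambda>r::real. inverse r) \<longlongrightarrow> 0) at_top"
    by (rule tendsto_inverse_0_at_top) (rule filterlim_ident)
  have "((\<lambda>r::real. exp (- inverse r)) \<longlongrightarrow> exp (- 0)) at_top"
    by (intro tendsto_intros inv)
  moreover have "\<forall>\<^sub>F r in at_top. exp (- inverse r) = flat 0 r"
    using eventually_gt_at_top[of 0] by eventually_elim (auto simp: flat_def inverse_eq_divide)
  ultimately show "(flat 0 \<longlongrightarrow> 1) at_top"
    by (simp add: tendsto_cong)
  have "((\<lambda>r::real. (inverse r + inverse r * inverse r) * exp (- inverse r)) \<longlongrightarrow> (0 + 0 * 0) * exp (- 0)) at_top"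
    by (intro tendsto_intros inv)
  moreover have "\<forall>\<^sub>F r in at_top. (inverse r + inverse r * inverse r) * exp (- inverse r) = (r + 1) * flat 1 r"
    using eventually_gt_at_top[of 0]
    by eventually_elim (auto simp: flat_1 power2_eq_square field_simps)
  ultimately show "((\<lambda>r. (r + 1) * flat 1 r) \<longlongrightarrow> 0) at_top"
    by (simp add: tendsto_cong)
qed

text \<open>The derivatives tend to 0, not to 1, at s = 0. This is the origin of the factor
  \<open>if W x \<noteq> 0 then 1 else 0\<close> in the statements about gradients below.\<close>

lemma trunc_tendsto:
  "(\<lambda>j. trunc (1 / real (Suc j)) s) \<longlonglongrightarrow> s"
  "(\<lambda>j. trunc' (1 / real (Suc j)) s) \<longlonglongrightarrow> (if s \<noteq> 0 then 1 else 0)"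
proof -
  have "(\<lambda>j. trunc (1 / real (Suc j)) s) \<longlonglongrightarrow> s \<and>
    (\<lambda>j. trunc' (1 / real (Suc j)) s) \<longlonglongrightarrow> (if s \<noteq> 0 then 1 else 0)"
  proof (cases "s = 0")
    case True
    then show ?thesis by (simp add: trunc_def trunc'_def flat_nonpos)
  next
    case False
    define r where "r j = (s / (1 / real (Suc j)))\<^sup>2 - 1" for j
    have "filterlim (\<lambda>j. \<bar>s\<bar> * real (Suc j)) at_top sequentially"
      using False by (intro filterlim_tendsto_pos_mult_at_top[OF tendsto_const])
        (auto simp del: of_nat_Suc intro: filterlim_compose[OF filterlim_real_sequentially filterlim_Suc])
    then have "filterlim (\<lambda>j. -1 + (\<bar>s\<bar> * real (Suc j)) ^ 2) at_top sequentially"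
      by (intro filterlim_tendsto_add_at_top[OF tendsto_const] filterlim_pow_at_top) auto
    moreover have "r j = -1 + (\<bar>s\<bar> * real (Suc j)) ^ 2" for j
      by (simp add: r_def power_mult_distrib)
    ultimately have r: "filterlim r at_top sequentially" by presburger
    have "(\<lambda>j. s * flat 0 (r j)) \<longlonglongrightarrow> s * 1"
      by (intro tendsto_intros filterlim_compose[OF flat_tendsto_at_top(1) r])
    moreover have "(\<lambda>j. flat 0 (r j) + 2 * ((r j + 1) * flat 1 (r j))) \<longlonglongrightarrow> 1 + 2 * 0"
      by (intro tendsto_intros filterlim_compose[OF flat_tendsto_at_top(1) r]
          filterlim_compose[OF flat_tendsto_at_top(2) r])
    ultimately show ?thesis
      using False by (simp add: trunc_def trunc'_def r_def mult.assoc)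
  qed
  then show "(\<lambda>j. trunc (1 / real (Suc j)) s) \<longlonglongrightarrow> s"
    "(\<lambda>j. trunc' (1 / real (Suc j)) s) \<longlonglongrightarrow> (if s \<noteq> 0 then 1 else 0)"
    by auto
qed

lemma trunc_comp_eq:
  "trunc d (f x) = f x * flat 0 ((1 / d)\<^sup>2 * (f x * f x) + -1)"
  by (simp add: trunc_def power2_eq_square)

lemma smooth_trunc_comp: "smooth f \<Longrightarrow> smooth (\<lambda>x. trunc d (f x))"
  unfolding trunc_comp_eq
  by (intro smooth_mult smooth_flat_comp smooth_add smooth_const)

lemma DERIV_trunc:
  assumes "d \<noteq> 0"
  shows "(trunc d has_real_derivative trunc' d s) (at s)"
  unfolding trunc_def[abs_def] trunc'_def using assms
  by (auto intro!: derivative_eq_intros DERIV_chain2[OF DERIV_flat] simp: power2_eq_square field_simps)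

lemma partial_deriv_trunc_comp:
  assumes "smooth f" "d \<noteq> 0"
  shows "partial_deriv i (\<lambda>x. trunc d (f x)) x = trunc' d (f x) * partial_deriv i f x"
proof -
  have "((\<lambda>x. trunc d (f x)) has_derivative
      (\<lambda>h. trunc' d (f x) * ((\<chi> i. partial_deriv i f x) \<bullet> h))) (at x)"
    using has_derivative_compose[OF smooth_has_derivative[OF assms(1)]
        DERIV_trunc[OF assms(2), of "f x", unfolded has_field_derivative_def]]
    by (simp add: o_def)
  then show ?thesis by (simp add: partial_deriv_eq inner_axis)
qed

lemma smooth_reflect:
  assumes "smooth f"
  shows "smooth (\<lambda>z. f (x - z))"
    and "partial_deriv i (\<lambda>z. f (x - z)) z = - partial_deriv i f (x - z)"
proof -
  \<comment> \<open>The scalar s keeps the class stable under derivatives, each of which flips its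
    sign.\<close>
  have D: "((\<lambda>z. s * f (x - z)) has_derivative (\<lambda>h. s * ((\<chi> i. partial_deriv i f (x - z)) \<bullet> (- h)))) (at z)"
    if "smooth f" for s f z
  proof -
    have "((\<lambda>z. x - z) has_derivative (\<lambda>h. - h)) (at z)"
      by (auto intro!: derivative_eq_intros)
    from has_derivative_mult_right[OF has_derivative_compose[OF this smooth_has_derivative[OF that]], of s]
    show ?thesis by (simp add: o_def)
  qed
  have pd: "partial_deriv i (\<lambda>z. s * f (x - z)) = (\<lambda>z. (- s) * partial_deriv i f (x - z))"
    if "smooth f" for s f i
    using partial_deriv_eq[OF D[OF that]] by (auto simp: inner_axis)
  let ?A = "{g. \<exists>s f. smooth f \<and> g = (\<lambda>z. s * f (x - z))}"
  show "smooth (\<lambda>z. f (x - z))"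
  proof (rule smooth_class[of _ ?A])
    have "(\<lambda>z. f (x - z)) = (\<lambda>z. 1 * f (x - z))" by simp
    then show "(\<lambda>z. f (x - z)) \<in> ?A" using assms by blast
    show "g differentiable (at y)" if "g \<in> ?A" for g y
      using that D by (auto simp: differentiable_def)
    show "partial_deriv i g \<in> ?A" if "g \<in> ?A" for g i
      using that pd smooth_partial_deriv by blast
  qed
  show "partial_deriv i (\<lambda>z. f (x - z)) z = - partial_deriv i f (x - z)"
    using pd[OF assms, of i 1] by simp
qed

section \<open>Mollification in L^1\<close>

lemma integrable_bounded_support:
  fixes f :: "'a::euclidean_space \<Rightarrow> real"
  assumes [measurable]: "f \<in> borel_measurable borel"
    and "\<And>x. \<bar>f x\<bar> \<le> M" and "\<And>x. x \<notin> cball 0 R \<Longrightarrow> f x = 0"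
  shows "integrable lborel f" "(LINT x|lborel. \<bar>f x\<bar>) \<le> M * measure lborel (cball (0::'a) R)"
proof -
  have M: "0 \<le> M" using assms(2)[of 0] by simp
  have i: "integrable lborel (\<lambda>x. M * indicator (cball (0::'a) R) x)"
    using emeasure_lborel_cball_finite[of "0::'a" R] by simp
  have b: "\<bar>f x\<bar> \<le> M * indicator (cball 0 R) x" for x
    using assms(2)[of x] assms(3)[of x] by (cases "x \<in> cball 0 R") (auto simp del: mem_cball)
  show "integrable lborel f"
    using b M by (intro Bochner_Integration.integrable_bound[OF i]) auto
  then have "(LINT x|lborel. \<bar>f x\<bar>) \<le> (LINT x|lborel. M * indicator (cball (0::'a) R) x)"
    using b by (intro integral_mono[OF _ i]) auto
  then show "(LINT x|lborel. \<bar>f x\<bar>) \<le> M * measure lborel (cball (0::'a) R)" by simp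
qed

lemma continuous_support_uniform:
  fixes c :: "'a::euclidean_space \<Rightarrow> real"
  assumes c: "continuous_on UNIV c" and z: "\<And>x. x \<notin> cball 0 R \<Longrightarrow> c x = 0" and "e > 0"
  obtains d where "d > 0" "\<And>x y. norm (x - y) < d \<Longrightarrow> \<bar>c x - c y\<bar> < e"
proof -
  have "uniformly_continuous_on (cball 0 (R + 1)) c"
    using c by (intro compact_uniformly_continuous) (auto intro: continuous_on_subset)
  then obtain d where d: "d > 0"
    "\<And>x y. x \<in> cball 0 (R + 1) \<Longrightarrow> y \<in> cball 0 (R + 1) \<Longrightarrow> norm (x - y) < d \<Longrightarrow> \<bar>c x - c y\<bar> < e"
    unfolding uniformly_continuous_on_def dist_norm real_norm_def using \<open>e > 0\<close> by metis
  have "\<bar>c x - c y\<bar> < e" if xy: "norm (x - y) < min d 1" for x y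
  proof (cases "x \<in> cball 0 R \<or> y \<in> cball 0 R")
    case True
    have "norm x \<le> norm (x - y) + norm y" "norm y \<le> norm (x - y) + norm x"
      using norm_triangle_ineq[of "x - y" y] norm_triangle_ineq[of "y - x" x]
      by (auto simp: norm_minus_commute)
    then have "x \<in> cball 0 (R + 1)" "y \<in> cball 0 (R + 1)"
      using True xy by auto
    then show ?thesis using d(2) xy by auto
  next
    case False
    then show ?thesis using z \<open>e > 0\<close> by auto
  qed
  then show ?thesis using that[of "min d 1"] d(1) by auto
qed

text \<open>A measurable function is an almost everywhere limit of continuous ones. Clamping these
  to [-M, M] and multiplying by a radial cutoff that is 1 on radius R and 0 beyond R + 1 leaves the
  limit g unchanged and provides a dominating function.\<close>

lemma continuous_L1_approx:
  fixes g :: "'a::euclidean_space \<Rightarrow> real"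
  assumes g [measurable]: "g \<in> borel_measurable borel"
    and M: "\<And>x. \<bar>g x\<bar> \<le> M" and z: "\<And>x. x \<notin> cball 0 R \<Longrightarrow> g x = 0" and "e > 0"
  obtains c where "continuous_on UNIV c" "\<And>x. \<bar>c x\<bar> \<le> M" "\<And>x. x \<notin> cball 0 (R + 1) \<Longrightarrow> c x = 0"
    "(LINT x|lborel. \<bar>g x - c x\<bar>) < e"
proof -
  have M0: "0 \<le> M" using M[of 0] by simp
  have "g measurable_on UNIV"
    by (rule lebesgue_measurable_imp_measurable_on_real) (simp_all add: measurable_completion)
  then obtain N h where Nh: "negligible N \<and> (\<forall>n. continuous_on UNIV (h n)) \<and>
      (\<forall>x. x \<notin> N \<longrightarrow> (\<lambda>n. h n x) \<longlonglongrightarrow> (if x \<in> UNIV then g x else 0))"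
    unfolding measurable_on_def by (elim exE)
  then have N: "negligible N" and h: "\<And>n. continuous_on UNIV (h n)"
    and lim: "\<And>x. x \<notin> N \<Longrightarrow> (\<lambda>n. h n x) \<longlonglongrightarrow> g x"
    by simp_all
  define cut where "cut x = max 0 (min 1 (R + 1 - norm x))" for x :: 'a
  define c where "c n x = cut x * max (- M) (min M (h n x))" for n x
  have c_cont: "continuous_on UNIV (c n)" for n
    unfolding c_def cut_def by (intro continuous_intros continuous_on_max continuous_on_min h)
  have c_bd: "\<bar>c n x\<bar> \<le> M" for n x
  proof -
    have "\<bar>cut x\<bar> * \<bar>max (- M) (min M (h n x))\<bar> \<le> 1 * M"
      using M0 by (intro mult_mono) (auto simp: cut_def)
    then show ?thesis by (simp add: c_def abs_mult)
  qed
  have c_z: "c n x = 0" if "x \<notin> cball 0 (R + 1)" for n x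
    using that by (simp add: c_def cut_def)
  have [measurable]: "c n \<in> borel_measurable borel" for n
    by (rule borel_measurable_continuous_onI[OF c_cont])
  have c_lim: "(\<lambda>n. c n x) \<longlonglongrightarrow> g x" if "x \<notin> N" for x
  proof -
    have "(\<lambda>n. cut x * max (- M) (min M (h n x))) \<longlonglongrightarrow> cut x * max (- M) (min M (g x))"
      by (intro tendsto_intros tendsto_max tendsto_min lim that)
    moreover have "max (- M) (min M (g x)) = g x" using M[of x] by auto
    moreover have "cut x * g x = g x"
      using z[of x] by (cases "norm x \<le> R") (auto simp: cut_def)
    ultimately show ?thesis by (simp add: c_def)
  qed
  have "(\<lambda>n. LINT x|lborel. \<bar>g x - c n x\<bar>) \<longlonglongrightarrow> (LINT x::'a|lborel. (0::real))"
  proof (rule integral_dominated_convergence[where w = "\<lambda>x. 2 * M * indicator (cball (0::'a) (R + 1)) x"])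
    show "integrable lborel (\<lambda>x. 2 * M * indicator (cball (0::'a) (R + 1)) x)"
      using emeasure_lborel_cball_finite[of "0::'a" "R + 1"] by simp
    have "AE x in lborel. x \<notin> N"
      using N AE_not_in[of N lebesgue] by (simp add: negligible_iff_null_sets AE_completion_iff)
    then show "AE x in lborel. (\<lambda>n. \<bar>g x - c n x\<bar>) \<longlonglongrightarrow> 0"
    proof eventually_elim
      case (elim x)
      show ?case
        using tendsto_rabs[OF tendsto_diff[OF tendsto_const c_lim[OF elim], of "g x"]] by simp
    qed
    show "AE x in lborel. norm \<bar>g x - c n x\<bar> \<le> 2 * M * indicator (cball (0::'a) (R + 1)) x" for n
    proof (rule AE_I2)
      fix x
      show "norm \<bar>g x - c n x\<bar> \<le> 2 * M * indicator (cball (0::'a) (R + 1)) x"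
        using M[of x] c_bd[of n x] z[of x] c_z[of x n]
        by (cases "norm x \<le> R + 1"; cases "norm x \<le> R") auto
    qed
  qed auto
  then have "\<forall>\<^sub>F n in sequentially. (LINT x|lborel. \<bar>g x - c n x\<bar>) < e"
    using \<open>e > 0\<close> by (intro order_tendstoD(2)) auto
  then obtain n where "(LINT x|lborel. \<bar>g x - c n x\<bar>) < e"
    by (auto simp: eventually_sequentially)
  then show ?thesis using that c_cont c_bd c_z by blast
qed

definition mollifier :: "real \<Rightarrow> (real^'n \<Rightarrow> real) \<Rightarrow> bool" where
  "mollifier \<rho> \<eta> \<longleftrightarrow> \<eta> \<in> test_functions UNIV \<and> (\<forall>x. \<eta> x \<ge> 0) \<and>
    (\<forall>x. norm x \<ge> \<rho> \<longrightarrow> \<eta> x = 0) \<and> (LINT x|lborel. \<eta> x) = 1"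

lemma ex_mollifier: "\<rho> > 0 \<Longrightarrow> \<exists>\<eta>. mollifier \<rho> \<eta>"
  unfolding mollifier_def using mollifier_exists by metis

lemma mollifier_mono: "mollifier \<rho> \<eta> \<Longrightarrow> \<rho> \<le> \<rho>' \<Longrightarrow> mollifier \<rho>' \<eta>"
  by (auto simp: mollifier_def)

lemma conv_mollifier_near:
  assumes "integrable lborel f" "mollifier \<rho> \<eta>" "\<And>z. norm (x - z) < \<rho> \<Longrightarrow> \<bar>f z - a\<bar> \<le> e"
  shows "\<bar>conv f \<eta> x - a\<bar> \<le> e"
  using assms by (intro conv_near[where \<rho> = \<rho>]) (auto simp: mollifier_def)

text \<open>Young's inequality for a kernel of mass 1, by Tonelli. Mollification is thus a
  contraction of L^1, and its convergence extends from continuous functions to their L^1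
  limits.\<close>

lemma conv_L1_le:
  assumes f: "integrable lborel f" and "mollifier \<rho> \<eta>"
  shows "integrable lborel (conv f \<eta>)" "(LINT x|lborel. \<bar>conv f \<eta> x\<bar>) \<le> (LINT x|lborel. \<bar>f x\<bar>)"
proof -
  have \<eta>: "\<eta> \<in> test_functions UNIV" "\<And>x. \<eta> x \<ge> 0" "(LINT x|lborel. \<eta> x) = 1"
    using assms(2) by (auto simp: mollifier_def)
  have [measurable]: "f \<in> borel_measurable borel" using f by auto
  have [measurable]: "\<eta> \<in> borel_measurable borel" by (rule test_functions_borel[OF \<eta>(1)])
  have [measurable]: "conv f \<eta> \<in> borel_measurable borel"
    by (intro borel_measurable_continuous_onI smooth_continuous smooth_conv[OF f \<eta>(1)])
  have "(\<integral>\<^sup>+x. ennreal \<bar>conv f \<eta> x\<bar> \<partial>lborel) \<le> (\<integral>\<^sup>+x. (\<integral>\<^sup>+z. ennreal (\<bar>f z\<bar> * \<eta> (x - z)) \<partial>lborel) \<partial>lborel)"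
  proof (rule nn_integral_mono)
    fix x
    have i: "integrable lborel (\<lambda>z. \<bar>f z\<bar> * \<eta> (x - z))"
      using integrable_abs[OF conv_integrable[OF f \<eta>(1), of x]] \<eta>(2) by (simp add: abs_mult)
    have "\<bar>conv f \<eta> x\<bar> \<le> (LINT z|lborel. \<bar>f z\<bar> * \<eta> (x - z))"
      unfolding conv_def using \<eta>(2)
      by (intro integral_abs_bound_integral[OF conv_integrable[OF f \<eta>(1)] i]) (simp add: abs_mult)
    then show "ennreal \<bar>conv f \<eta> x\<bar> \<le> (\<integral>\<^sup>+z. ennreal (\<bar>f z\<bar> * \<eta> (x - z)) \<partial>lborel)"
      using \<eta>(2) by (subst nn_integral_eq_integral[OF i]) (auto intro: ennreal_leI)
  qed
  also have "\<dots> = (\<integral>\<^sup>+z. (\<integral>\<^sup>+x. ennreal (\<bar>f z\<bar> * \<eta> (x - z)) \<partial>lborel) \<partial>lborel)"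
    by (rule lborel_pair.Fubini') measurable
  also have "\<dots> = (\<integral>\<^sup>+z. ennreal \<bar>f z\<bar> * (\<integral>\<^sup>+x. ennreal (\<eta> (x - z)) \<partial>lborel) \<partial>lborel)"
    using \<eta>(2) by (simp add: ennreal_mult' nn_integral_cmult)
  also have "\<dots> = (\<integral>\<^sup>+z. ennreal \<bar>f z\<bar> \<partial>lborel)"
  proof -
    have "(\<integral>\<^sup>+x. ennreal (\<eta> (x - z)) \<partial>lborel) = 1" for z
      using nn_integral_translate[of "\<lambda>x. ennreal (\<eta> x)" "- z"] \<eta>
      by (simp add: nn_integral_eq_integral test_functions_integrable)
    then show ?thesis by simp
  qed
  also have "\<dots> = ennreal (LINT z|lborel. \<bar>f z\<bar>)"
    using f by (intro nn_integral_eq_integral) auto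
  finally have le: "(\<integral>\<^sup>+x. ennreal \<bar>conv f \<eta> x\<bar> \<partial>lborel) \<le> ennreal (LINT z|lborel. \<bar>f z\<bar>)" .
  show i: "integrable lborel (conv f \<eta>)"
    using le by (intro integrableI_bounded) (auto simp: le_less_trans)
  show "(LINT x|lborel. \<bar>conv f \<eta> x\<bar>) \<le> (LINT x|lborel. \<bar>f x\<bar>)"
    using le i by (subst (asm) nn_integral_eq_integral) auto
qed

text \<open>Approximate by a continuous function, mollify it, and return by the contraction
  property. The radius is fixed before the mollifier and serves every mollifier of that radius, so
  that a single one can later treat all components of a gradient together.\<close>

lemma mollification_L1:
  fixes g :: "real^'n \<Rightarrow> real"
  assumes g [measurable]: "g \<in> borel_measurable borel"
    and M: "\<And>x. \<bar>g x\<bar> \<le> M" and z: "\<And>x. x \<notin> cball 0 R \<Longrightarrow> g x = 0" and "e > 0"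
  obtains \<rho> where "\<rho> > 0" "\<And>\<eta>. mollifier \<rho> \<eta> \<Longrightarrow> (LINT x|lborel. \<bar>conv g \<eta> x - g x\<bar>) < e"
proof -
  have gi: "integrable lborel g" by (rule integrable_bounded_support[OF g M z])
  obtain c where c: "continuous_on UNIV c" "\<And>x. \<bar>c x\<bar> \<le> M" "\<And>x. x \<notin> cball 0 (R + 1) \<Longrightarrow> c x = 0"
    "(LINT x|lborel. \<bar>g x - c x\<bar>) < e / 3"
    by (rule continuous_L1_approx[OF g M z, where e = "e / 3"]) (use \<open>e > 0\<close> in auto)
  have [measurable]: "c \<in> borel_measurable borel"
    by (rule borel_measurable_continuous_onI[OF c(1)])
  have ci: "integrable lborel c" by (rule integrable_bounded_support[OF _ c(2,3)]) auto
  \<comment> \<open>The approximation lives in radius R + 1, and a kernel of radius at most 1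
    enlarges this to R + 2. The constant \<open>e'\<close> makes the uniform error integrate to at
    most e / 3.\<close>
  define V where "V = measure lborel (cball (0::real^'n) (R + 2))"
  define e' where "e' = e / (3 * (V + 1))"
  have V: "V \<ge> 0" by (simp add: V_def)
  then have e': "e' > 0" using \<open>e > 0\<close> by (simp add: e'_def)
  obtain d where d: "d > 0" "\<And>x y. norm (x - y) < d \<Longrightarrow> \<bar>c x - c y\<bar> < e'"
    using continuous_support_uniform[OF c(1,3) e'] by metis
  show ?thesis
  proof (rule that[of "min d 1"])
    fix \<eta> :: "real^'n \<Rightarrow> real" assume m: "mollifier (min d 1) \<eta>"
    have \<eta>: "\<eta> \<in> test_functions UNIV" using m by (simp add: mollifier_def)
    have [measurable]: "conv c \<eta> \<in> borel_measurable borel"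
      by (intro borel_measurable_continuous_onI smooth_continuous smooth_conv[OF ci \<eta>])
    have b1: "(LINT x|lborel. \<bar>conv c \<eta> x - c x\<bar>) \<le> e' * V"
      unfolding V_def
    proof (rule integrable_bounded_support(2))
      show "\<bar>conv c \<eta> x - c x\<bar> \<le> e'" for x
        using d(2) by (intro conv_mollifier_near[OF ci m]) (auto intro: less_imp_le simp: norm_minus_commute)
      show "conv c \<eta> x - c x = 0" if x: "x \<notin> cball 0 (R + 2)" for x
      proof -
        have "\<bar>conv c \<eta> x - 0\<bar> \<le> 0"
        proof (rule conv_mollifier_near[OF ci m])
          fix z assume "norm (x - z) < min d 1"
          then have "z \<notin> cball 0 (R + 1)"
            using x norm_triangle_ineq[of "x - z" z] by auto
          then show "\<bar>c z - 0\<bar> \<le> 0" using c(3) by simp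
        qed
        moreover have "c x = 0" using x by (intro c(3)) auto
        ultimately show ?thesis by simp
      qed
    qed auto
    have gci: "integrable lborel (\<lambda>x. g x - c x)" using gi ci by auto
    have split: "conv g \<eta> x - g x = conv (\<lambda>x. g x - c x) \<eta> x + (conv c \<eta> x - c x) - (g x - c x)" for x
      using conv_integrable[OF gi \<eta>] conv_integrable[OF ci \<eta>]
      by (simp add: conv_def left_diff_distrib)
    note i1 = conv_L1_le[OF gci m]
    have i2: "integrable lborel (\<lambda>x. conv c \<eta> x - c x)"
      using conv_L1_le(1)[OF ci m] ci by auto
    have "(LINT x|lborel. \<bar>conv g \<eta> x - g x\<bar>)
        \<le> (LINT x|lborel. \<bar>conv (\<lambda>x. g x - c x) \<eta> x\<bar> + \<bar>conv c \<eta> x - c x\<bar> + \<bar>g x - c x\<bar>)"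
    proof (rule integral_mono)
      show "integrable lborel (\<lambda>x. \<bar>conv g \<eta> x - g x\<bar>)"
        using conv_L1_le(1)[OF gi m] gi by auto
      show "integrable lborel (\<lambda>x. \<bar>conv (\<lambda>x. g x - c x) \<eta> x\<bar> + \<bar>conv c \<eta> x - c x\<bar> + \<bar>g x - c x\<bar>)"
        using i1(1) i2 gci by (intro Bochner_Integration.integrable_add integrable_abs)
      show "\<bar>conv g \<eta> x - g x\<bar>
          \<le> \<bar>conv (\<lambda>x. g x - c x) \<eta> x\<bar> + \<bar>conv c \<eta> x - c x\<bar> + \<bar>g x - c x\<bar>" for x
        unfolding split by linarith
    qed
    also have "\<dots> = (LINT x|lborel. \<bar>conv (\<lambda>x. g x - c x) \<eta> x\<bar>)
        + (LINT x|lborel. \<bar>conv c \<eta> x - c x\<bar>) + (LINT x|lborel. \<bar>g x - c x\<bar>)"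
      using i1(1) i2 gci by simp
    also have "\<dots> \<le> e' * V + 2 * (LINT x|lborel. \<bar>g x - c x\<bar>)"
      using i1(2) b1 by simp
    also have "e' * V \<le> e / 3"
      using V \<open>e > 0\<close> by (simp add: e'_def field_simps)
    finally show "(LINT x|lborel. \<bar>conv g \<eta> x - g x\<bar>) < e" using c(4) by simp
  qed (use d(1) in auto)
qed

section \<open>Approximation of zero trace functions by test functions\<close>

text \<open>The weak identity is tested with the reflected kernel, admissible because its support
  lies in \<open>cball x \<rho>\<close>. The minus sign of the weak identity cancels the one from
  the reflection.\<close>

lemma partial_deriv_conv_weak:
  fixes W :: "real^'n \<Rightarrow> real" and g :: "real^'n \<Rightarrow> real"
  assumes W: "integrable lborel W" and m: "mollifier \<rho> \<eta>" and sub: "cball x \<rho> \<subseteq> \<Omega>"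
    and weak: "\<And>\<psi>. \<psi> \<in> test_functions \<Omega> \<Longrightarrow>
      (LINT z|lborel. W z * partial_deriv i \<psi> z) = - (LINT z|lborel. g z * \<psi> z)"
  shows "partial_deriv i (conv W \<eta>) x = conv g \<eta> x"
proof -
  have \<eta>: "\<eta> \<in> test_functions UNIV" "\<And>x. norm x \<ge> \<rho> \<Longrightarrow> \<eta> x = 0"
    using m by (auto simp: mollifier_def)
  note sm = test_functions_smooth[OF \<eta>(1)]
  have "{z. \<eta> (x - z) \<noteq> 0} \<subseteq> cball x \<rho>"
    using \<eta>(2) by (force simp: dist_norm not_le[symmetric])
  then have cl: "closure {z. \<eta> (x - z) \<noteq> 0} \<subseteq> cball x \<rho>"
    by (rule closure_minimal) auto
  then have "compact (closure {z. \<eta> (x - z) \<noteq> 0})"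
    by (metis bounded_cball bounded_subset closed_closure compact_eq_bounded_closed)
  then have "(\<lambda>z. \<eta> (x - z)) \<in> test_functions \<Omega>"
    using cl sub smooth_reflect(1)[OF sm, of x] by (auto simp: test_functions_def)
  from weak[OF this] show ?thesis
    by (simp add: partial_deriv_conv[OF W \<eta>(1)] conv_def smooth_reflect(2)[OF sm])
qed

lemma continuous_uniform_on_interval:
  fixes f :: "real \<Rightarrow> real"
  assumes "continuous_on {- B..B} f" and "e > 0"
  obtains d where "d > 0"
    "\<And>s t. \<bar>s\<bar> \<le> B \<Longrightarrow> \<bar>t\<bar> \<le> B \<Longrightarrow> \<bar>s - t\<bar> < d \<Longrightarrow> \<bar>f s - f t\<bar> < e"
proof -
  have "uniformly_continuous_on {- B..B} f"
    using assms(1) by (intro compact_uniformly_continuous compact_Icc)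
  then obtain d where d: "d > 0"
    "\<And>s t. s \<in> {- B..B} \<Longrightarrow> t \<in> {- B..B} \<Longrightarrow> \<bar>t - s\<bar> < d \<Longrightarrow> \<bar>f t - f s\<bar> < e"
    unfolding uniformly_continuous_on_def dist_real_def using assms(2) by meson
  show ?thesis
    by (rule that[OF d(1)], rule d(2)) auto
qed

text \<open>Mollification alone may spread the support beyond \<Omega>. Composing the mollified
  function with \<open>trunc d\<close> removes all values of size up to d; what remains lies where
  |W| \<ge> d / 2, a compact part of \<Omega> because W is continuous and vanishes outside. The
  level d is fixed first, the radius afterwards.\<close>

lemma test_approximation:
  fixes W :: "real^'n \<Rightarrow> real" and g :: "'n \<Rightarrow> real^'n \<Rightarrow> real"
  assumes "open \<Omega>" and \<Omega>R: "\<Omega> \<subseteq> cball 0 R"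
    and W: "continuous_on UNIV W" and W0: "\<And>x. x \<notin> \<Omega> \<Longrightarrow> W x = 0"
    and g [measurable]: "\<And>i. g i \<in> borel_measurable borel"
    and gM: "\<And>i x. \<bar>g i x\<bar> \<le> M" and g0: "\<And>i x. x \<notin> \<Omega> \<Longrightarrow> g i x = 0"
    and weak: "\<And>\<psi> i. \<psi> \<in> test_functions \<Omega> \<Longrightarrow>
      (LINT z|lborel. W z * partial_deriv i \<psi> z) = - (LINT z|lborel. g i z * \<psi> z)"
    and "e > 0"
  obtains \<phi> where "\<phi> \<in> test_functions \<Omega>"
    "\<And>i. (LINT x|lborel. \<bar>partial_deriv i \<phi> x - (if W x \<noteq> 0 then 1 else 0) * g i x\<bar>) < e"
    "(LINT x|lborel. \<bar>\<phi> x - W x\<bar>) < e"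
proof -
  have [measurable]: "W \<in> borel_measurable borel" by (rule borel_measurable_continuous_onI[OF W])
  have W0': "\<And>x. x \<notin> cball 0 R \<Longrightarrow> W x = 0" and g0': "\<And>i x. x \<notin> cball 0 R \<Longrightarrow> g i x = 0"
    using W0 g0 \<Omega>R by blast+
  have M0: "0 \<le> M" using order_trans[OF abs_ge_zero gM] .
  have "compact (W ` cball 0 R)"
    using W by (intro compact_continuous_image) (auto intro: continuous_on_subset)
  then obtain B0 where B0: "\<And>x. x \<in> cball 0 R \<Longrightarrow> \<bar>W x\<bar> \<le> B0"
    using compact_imp_bounded bounded_iff by (metis imageI real_norm_def)
  define B where "B = max 0 B0"
  have B: "\<bar>W x\<bar> \<le> B" "0 \<le> B" for x
    using B0[of x] W0'[of x] by (cases "x \<in> cball 0 R"; simp add: B_def)+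
  have Wi: "integrable lborel W" by (rule integrable_bounded_support[OF _ B(1) W0']) auto
  have gi: "integrable lborel (g i)" for i by (rule integrable_bounded_support[OF g gM g0'])
  have [measurable]: "trunc d \<in> borel_measurable borel" "trunc' d \<in> borel_measurable borel" for d
    by (intro borel_measurable_continuous_onI trunc_continuous)+
  define V where "V = measure lborel (cball (0::real^'n) R)"
  have V0: "V \<ge> 0" by (simp add: V_def)

  define D where "D j = 1 / real (Suc j)" for j
  have lim1: "(\<lambda>j. LINT x|lborel. \<bar>trunc' (D j) (W x) * g i x - (if W x \<noteq> 0 then 1 else 0) * g i x\<bar>)
      \<longlonglongrightarrow> (LINT x::real^'n|lborel. (0::real))" for i
  proof (rule integral_dominated_convergence[where w = "\<lambda>x. 6 * \<bar>g i x\<bar>"])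
    show "AE x in lborel. (\<lambda>j. \<bar>trunc' (D j) (W x) * g i x - (if W x \<noteq> 0 then 1 else 0) * g i x\<bar>) \<longlonglongrightarrow> 0"
    proof (rule AE_I2)
      fix x
      have "(\<lambda>j. \<bar>trunc' (D j) (W x) * g i x - (if W x \<noteq> 0 then 1 else 0) * g i x\<bar>)
        \<longlonglongrightarrow> \<bar>(if W x \<noteq> 0 then 1 else 0) * g i x - (if W x \<noteq> 0 then 1 else 0) * g i x\<bar>"
        unfolding D_def by (intro tendsto_intros trunc_tendsto)
      then show "(\<lambda>j. \<bar>trunc' (D j) (W x) * g i x - (if W x \<noteq> 0 then 1 else 0) * g i x\<bar>) \<longlonglongrightarrow> 0"
        by simp
    qed
    show "AE x in lborel. norm \<bar>trunc' (D j) (W x) * g i x - (if W x \<noteq> 0 then 1 else 0) * g i x\<bar> \<le> 6 * \<bar>g i x\<bar>" for j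
    proof (rule AE_I2)
      fix x
      have "\<bar>trunc' (D j) (W x) - (if W x \<noteq> 0 then 1 else 0)\<bar> \<le> 6"
        using trunc'_bound[of "D j" "W x"] by auto
      then have "\<bar>trunc' (D j) (W x) - (if W x \<noteq> 0 then 1 else 0)\<bar> * \<bar>g i x\<bar> \<le> 6 * \<bar>g i x\<bar>"
        by (rule mult_right_mono) simp
      then show "norm \<bar>trunc' (D j) (W x) * g i x - (if W x \<noteq> 0 then 1 else 0) * g i x\<bar> \<le> 6 * \<bar>g i x\<bar>"
        by (simp only: left_diff_distrib[symmetric] abs_mult real_norm_def abs_abs)
    qed
  qed (use gi in auto)
  have lim2: "(\<lambda>j. LINT x|lborel. \<bar>trunc (D j) (W x) - W x\<bar>) \<longlonglongrightarrow> (LINT x::real^'n|lborel. (0::real))"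
  proof (rule integral_dominated_convergence[where w = "\<lambda>x. 2 * \<bar>W x\<bar>"])
    show "AE x in lborel. (\<lambda>j. \<bar>trunc (D j) (W x) - W x\<bar>) \<longlonglongrightarrow> 0"
    proof (rule AE_I2)
      fix x
      have "(\<lambda>j. \<bar>trunc (D j) (W x) - W x\<bar>) \<longlonglongrightarrow> \<bar>W x - W x\<bar>"
        unfolding D_def by (intro tendsto_intros trunc_tendsto)
      then show "(\<lambda>j. \<bar>trunc (D j) (W x) - W x\<bar>) \<longlonglongrightarrow> 0" by simp
    qed
    show "AE x in lborel. norm \<bar>trunc (D j) (W x) - W x\<bar> \<le> 2 * \<bar>W x\<bar>" for j
    proof (rule AE_I2)
      fix x
      show "norm \<bar>trunc (D j) (W x) - W x\<bar> \<le> 2 * \<bar>W x\<bar>"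
        using trunc_bound[of "D j" "W x"] by simp
    qed
  qed (use Wi in auto)
  \<comment> \<open>The truncation error is spent first and fixes d. A common index j exists because
    there are finitely many components.\<close>
  have "\<forall>\<^sub>F j in sequentially. (\<forall>i\<in>UNIV. (LINT x|lborel. \<bar>trunc' (D j) (W x) * g i x - (if W x \<noteq> 0 then 1 else 0) * g i x\<bar>) < e / 2)
      \<and> (LINT x|lborel. \<bar>trunc (D j) (W x) - W x\<bar>) < e / 2"
    using \<open>e > 0\<close> lim1 lim2
    by (intro eventually_conj eventually_ball_finite ballI order_tendstoD(2)) auto
  then obtain j where j1: "\<And>i. (LINT x|lborel. \<bar>trunc' (D j) (W x) * g i x - (if W x \<noteq> 0 then 1 else 0) * g i x\<bar>) < e / 2"
    and j2: "(LINT x|lborel. \<bar>trunc (D j) (W x) - W x\<bar>) < e / 2"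
    by (auto simp: eventually_sequentially)
  define d where "d = D j"
  have d: "d > 0" by (simp add: d_def D_def)

  define K where "K = {x. \<bar>W x\<bar> \<ge> d / 2}"
  have K: "compact K" "K \<subseteq> \<Omega>"
  proof -
    have "closed K" unfolding K_def using W by (intro closed_Collect_le continuous_intros)
    moreover have "K \<subseteq> cball 0 R" unfolding K_def using W0' d by (force simp del: mem_cball)
    ultimately show "compact K" by (metis bounded_cball bounded_subset compact_eq_bounded_closed)
    show "K \<subseteq> \<Omega>" unfolding K_def using W0 d by force
  qed
  obtain r where r: "r > 0" "(\<Union>x\<in>K. cball x r) \<subseteq> \<Omega>"
    using compact_subset_open_imp_cball_epsilon_subset[OF K(1) \<open>open \<Omega>\<close> K(2)] by metis
  \<comment> \<open>Pointwise error of \<open>trunc d\<close> and \<open>trunc' d\<close> when W is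
    replaced by its mollification. The denominator keeps both e1 M V and e1 V below e / 4; the
    summands 1 keep it positive.\<close>
  define e1 where "e1 = e / 4 / ((1 + M) * (1 + V))"
  have e1: "e1 > 0" using \<open>e > 0\<close> M0 V0 by (simp add: e1_def)
  obtain o1 where o1: "o1 > 0"
    "\<And>s t. \<bar>s\<bar> \<le> B + 1 \<Longrightarrow> \<bar>t\<bar> \<le> B + 1 \<Longrightarrow> \<bar>s - t\<bar> < o1 \<Longrightarrow> \<bar>trunc d s - trunc d t\<bar> < e1"
    using continuous_uniform_on_interval[OF trunc_continuous(1) e1] by metis
  obtain o2 where o2: "o2 > 0"
    "\<And>s t. \<bar>s\<bar> \<le> B + 1 \<Longrightarrow> \<bar>t\<bar> \<le> B + 1 \<Longrightarrow> \<bar>s - t\<bar> < o2 \<Longrightarrow> \<bar>trunc' d s - trunc' d t\<bar> < e1"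
    using continuous_uniform_on_interval[OF trunc_continuous(2) e1] by metis
  \<comment> \<open>Allowed distance between W and its mollification w: below the moduli
    \<open>o1\<close> and \<open>o2\<close>; at most 1, so that w stays in the range of these
    moduli; at most d / 2, so that |w| \<le> d off K, where \<open>trunc d\<close> vanishes.\<close>
  define \<omega> where "\<omega> = min (min (o1 / 2) (o2 / 2)) (min 1 (d / 2))"
  have \<omega>_pos: "\<omega> > 0" using o1(1) o2(1) d by (simp add: \<omega>_def)
  have \<omega>: "\<omega> < o1" "\<omega> < o2" "\<omega> \<le> 1" "\<omega> \<le> d / 2"
    using o1(1) o2(1) by (auto simp: \<omega>_def min_def)
  obtain r1 where r1: "r1 > 0" "\<And>x y. norm (x - y) < r1 \<Longrightarrow> \<bar>W x - W y\<bar> < \<omega>"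
    using continuous_support_uniform[OF W W0' \<omega>_pos] by metis
  \<comment> \<open>The bound 5 for \<open>trunc'\<close> will multiply this error, whence e / 20
    for a share of e / 4.\<close>
  have "\<exists>\<rho>>0. \<forall>\<eta>. mollifier \<rho> \<eta> \<longrightarrow> (LINT x|lborel. \<bar>conv (g i) \<eta> x - g i x\<bar>) < e / 20" for i
  proof -
    have "e / 20 > 0" using \<open>e > 0\<close> by simp
    then show ?thesis using mollification_L1[of "g i" M R "e / 20"] g gM g0' by metis
  qed
  then obtain \<rho> where \<rho>: "\<And>i. \<rho> i > 0"
    "\<And>i \<eta>. mollifier (\<rho> i) \<eta> \<Longrightarrow> (LINT x|lborel. \<bar>conv (g i) \<eta> x - g i x\<bar>) < e / 20"
    by metis
  \<comment> \<open>Here r keeps the balls around points of K inside \<Omega>, r1 gives the uniform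
    distance \<omega>, and each \<rho> i controls one component of the gradient.\<close>
  define \<rho>0 where "\<rho>0 = Min (insert r (insert r1 (range \<rho>)))"
  have \<rho>0: "\<rho>0 > 0" "\<rho>0 \<le> r" "\<rho>0 \<le> r1" "\<And>i. \<rho>0 \<le> \<rho> i"
    using r(1) r1(1) \<rho>(1) by (auto simp: \<rho>0_def min_le_iff_disj)
  obtain \<eta> :: "real^'n \<Rightarrow> real" where m: "mollifier \<rho>0 \<eta>" using ex_mollifier[OF \<rho>0(1)] by blast
  have \<eta>: "\<eta> \<in> test_functions UNIV" using m by (simp add: mollifier_def)
  define w where "w = conv W \<eta>"
  have w_smooth: "smooth w" unfolding w_def by (rule smooth_conv[OF Wi \<eta>])
  have w_near: "\<bar>w x - W x\<bar> \<le> \<omega>" for x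
    unfolding w_def using r1(2) \<rho>0(3)
    by (intro conv_mollifier_near[OF Wi m]) (auto intro!: less_imp_le simp: norm_minus_commute)
  have w_B: "\<bar>w x\<bar> \<le> B + 1" for x
    using w_near[of x] B(1)[of x] \<omega>(3) by linarith
  have w_off: "\<bar>w x\<bar> \<le> d" if "x \<notin> K" for x
  proof -
    have "\<bar>W x\<bar> < d / 2" using that by (simp add: K_def)
    then show ?thesis using w_near[of x] \<omega>(4) by linarith
  qed
  define \<phi> where "\<phi> x = trunc d (w x)" for x
  have \<phi>_test: "\<phi> \<in> test_functions \<Omega>"
  proof -
    have "{x. \<phi> x \<noteq> 0} \<subseteq> K"
      using w_off trunc_small(1)[OF d] by (auto simp: \<phi>_def)
    then have cl: "closure {x. \<phi> x \<noteq> 0} \<subseteq> K"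
      by (rule closure_minimal) (rule compact_imp_closed[OF K(1)])
    then have "compact (closure {x. \<phi> x \<noteq> 0})"
      by (metis K(1) closed_closure compact_Int_closed inf.absorb_iff2)
    moreover have "smooth \<phi>" unfolding \<phi>_def[abs_def] by (rule smooth_trunc_comp[OF w_smooth])
    ultimately show ?thesis using cl K(2) by (auto simp: test_functions_def)
  qed
  \<comment> \<open>Off K the kernel may reach beyond \<Omega>, where the weak identity says
    nothing; but there |w| \<le> d and both sides vanish.\<close>
  have \<phi>_deriv: "partial_deriv i \<phi> x = trunc' d (w x) * conv (g i) \<eta> x" for i x
  proof (cases "x \<in> K")
    case True
    then have "cball x \<rho>0 \<subseteq> \<Omega>" using r(2) \<rho>0(2) by (force intro: order_trans)
    then have "partial_deriv i w x = conv (g i) \<eta> x"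
      unfolding w_def by (rule partial_deriv_conv_weak[OF Wi m _ weak])
    then show ?thesis
      unfolding \<phi>_def[abs_def] using d by (simp add: partial_deriv_trunc_comp[OF w_smooth])
  next
    case False
    then show ?thesis
      unfolding \<phi>_def[abs_def] using d w_off trunc_small(2)[OF d] by (simp add: partial_deriv_trunc_comp[OF w_smooth])
  qed
  have [measurable]: "w \<in> borel_measurable borel" "conv (g i) \<eta> \<in> borel_measurable borel" for i
    using w_smooth smooth_conv[OF gi \<eta>] by (auto intro!: borel_measurable_continuous_onI smooth_continuous)
  have d1: "\<bar>trunc d (w x) - trunc d (W x)\<bar> \<le> e1" and d2: "\<bar>trunc' d (w x) - trunc' d (W x)\<bar> \<le> e1" for x
  proof -
    have "\<bar>W x\<bar> \<le> B + 1" "\<bar>w x - W x\<bar> < o1" "\<bar>w x - W x\<bar> < o2"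
      using B(1)[of x] w_near[of x] \<omega> by linarith+
    then show "\<bar>trunc d (w x) - trunc d (W x)\<bar> \<le> e1" "\<bar>trunc' d (w x) - trunc' d (W x)\<bar> \<le> e1"
      using o1(2)[OF w_B] o2(2)[OF w_B] by (auto intro: less_imp_le)
  qed
  have e1_le: "e1 * M * V \<le> e / 4" "e1 * V \<le> e / 4"
  proof -
    have "M * V \<le> (1 + M) * (1 + V)" "V \<le> (1 + M) * (1 + V)"
      using M0 V0 by (auto simp: algebra_simps)
    then have "e1 * (M * V) \<le> e1 * ((1 + M) * (1 + V))" "e1 * V \<le> e1 * ((1 + M) * (1 + V))"
      using e1 by (auto intro!: mult_left_mono)
    moreover have "e1 * ((1 + M) * (1 + V)) = e / 4"
    proof -
      have "1 + M \<noteq> 0" "1 + V \<noteq> 0" using M0 V0 by linarith+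
      then show ?thesis by (simp add: e1_def)
    qed
    ultimately show "e1 * M * V \<le> e / 4" "e1 * V \<le> e / 4" by (auto simp: mult.assoc)
  qed
  show ?thesis
  proof (rule that[OF \<phi>_test])
    fix i
    \<comment> \<open>\<open>?A\<close> is the mollification error of the derivative,
      \<open>?B\<close> the error from evaluating \<open>trunc' d\<close> at w instead of W,
      \<open>?C\<close> the truncation error; their shares are e / 4, e / 4 and e / 2.\<close>
    let ?A = "\<lambda>x. conv (g i) \<eta> x - g i x"
    let ?B = "\<lambda>x. (trunc' d (w x) - trunc' d (W x)) * g i x"
    let ?C = "\<lambda>x. trunc' d (W x) * g i x - (if W x \<noteq> 0 then 1 else 0) * g i x"
    have iA: "integrable lborel ?A" using conv_L1_le(1)[OF gi m] gi by auto
    have B_bd: "\<bar>?B x\<bar> \<le> e1 * M" for x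
      unfolding abs_mult using d2 gM e1 by (intro mult_mono) auto
    have B_0: "?B x = 0" if "x \<notin> cball 0 R" for x using g0'[OF that] by simp
    have iB: "integrable lborel ?B" and leB: "(LINT x|lborel. \<bar>?B x\<bar>) \<le> e1 * M * V"
      unfolding V_def by (rule integrable_bounded_support[OF _ B_bd B_0]; measurable)+
    have iC: "integrable lborel ?C"
    proof (rule integrable_bounded_support)
      show "\<bar>?C x\<bar> \<le> 5 * M + M" for x
      proof -
        have "\<bar>trunc' d (W x) * g i x\<bar> \<le> 5 * M"
          unfolding abs_mult using trunc'_bound gM by (intro mult_mono) auto
        moreover have "\<bar>(if W x \<noteq> 0 then 1 else 0) * g i x\<bar> \<le> M" using gM[of i x] M0 by auto
        ultimately show ?thesis by linarith
      qed
      show "?C x = 0" if "x \<notin> cball 0 R" for x using g0'[OF that] by simp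
    qed auto
    have "(LINT x|lborel. \<bar>partial_deriv i \<phi> x - (if W x \<noteq> 0 then 1 else 0) * g i x\<bar>)
      \<le> (LINT x|lborel. 5 * \<bar>?A x\<bar> + \<bar>?B x\<bar> + \<bar>?C x\<bar>)"
    proof (rule integral_mono_AE')
      show "integrable lborel (\<lambda>x. 5 * \<bar>?A x\<bar> + \<bar>?B x\<bar> + \<bar>?C x\<bar>)"
        using iA iB iC by auto
      show "AE x in lborel. \<bar>partial_deriv i \<phi> x - (if W x \<noteq> 0 then 1 else 0) * g i x\<bar>
          \<le> 5 * \<bar>?A x\<bar> + \<bar>?B x\<bar> + \<bar>?C x\<bar>"
      proof (rule AE_I2)
        fix x
        have "\<bar>trunc' d (w x) * ?A x\<bar> \<le> 5 * \<bar>?A x\<bar>"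
          unfolding abs_mult by (intro mult_right_mono trunc'_bound) auto
        moreover have "partial_deriv i \<phi> x - (if W x \<noteq> 0 then 1 else 0) * g i x
            = trunc' d (w x) * ?A x + ?B x + ?C x"
          unfolding \<phi>_deriv by (simp add: algebra_simps)
        ultimately show "\<bar>partial_deriv i \<phi> x - (if W x \<noteq> 0 then 1 else 0) * g i x\<bar>
          \<le> 5 * \<bar>?A x\<bar> + \<bar>?B x\<bar> + \<bar>?C x\<bar>" by linarith
      qed
    qed auto
    also have "\<dots> = 5 * (LINT x|lborel. \<bar>?A x\<bar>) + (LINT x|lborel. \<bar>?B x\<bar>) + (LINT x|lborel. \<bar>?C x\<bar>)"
      using iA iB iC by simp
    also have "\<dots> < e"
      using \<rho>(2)[OF mollifier_mono[OF m \<rho>0(4)], of i] leB e1_le(1) j1[of i] \<open>e > 0\<close>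
      unfolding d_def by linarith
    finally show "(LINT x|lborel. \<bar>partial_deriv i \<phi> x - (if W x \<noteq> 0 then 1 else 0) * g i x\<bar>) < e" .
  next
    let ?B = "\<lambda>x. trunc d (w x) - trunc d (W x)"
    let ?C = "\<lambda>x. trunc d (W x) - W x"
    have B_0: "?B x = 0" if "x \<notin> cball 0 R" for x
      using that W0'[OF that] w_off[of x] d trunc_small(1)[OF d] by (auto simp: K_def)
    have iB: "integrable lborel ?B" and leB: "(LINT x|lborel. \<bar>?B x\<bar>) \<le> e1 * V"
      unfolding V_def by (rule integrable_bounded_support[OF _ d1 B_0]; measurable)+
    have iC: "integrable lborel ?C"
    proof (rule integrable_bounded_support)
      show "\<bar>?C x\<bar> \<le> 2 * B" for x
        using trunc_bound[of d "W x"] B(1)[of x] by linarith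
      show "?C x = 0" if "x \<notin> cball 0 R" for x
        using W0'[OF that] trunc_bound[of d "W x"] by simp
    qed auto
    have "(LINT x|lborel. \<bar>\<phi> x - W x\<bar>) \<le> (LINT x|lborel. \<bar>?B x\<bar> + \<bar>?C x\<bar>)"
      by (rule integral_mono_AE') (use iB iC in \<open>auto simp: \<phi>_def\<close>)
    also have "\<dots> = (LINT x|lborel. \<bar>?B x\<bar>) + (LINT x|lborel. \<bar>?C x\<bar>)"
      using iB iC by simp
    also have "\<dots> < e" using leB e1_le(2) j2 \<open>e > 0\<close> unfolding d_def by linarith
    finally show "(LINT x|lborel. \<bar>\<phi> x - W x\<bar>) < e" .
  qed
qed

section \<open>A Poincare estimate on cubes\<close>

text \<open>A closed ball of the maximum norm, with half side r. Membership is symmetric in point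
  and centre, and scaling about the centre maps cubes to cubes; both facts drive the change of
  variables in the kernel estimate.\<close>

definition cube :: "real^'n \<Rightarrow> real \<Rightarrow> (real^'n) set" where
  "cube z r = {x. \<forall>i. \<bar>x $ i - z $ i\<bar> \<le> r}"

lemma cube_eq_cbox: "cube z r = cbox (z - vec r) (z + vec r)"
  by (auto simp: cube_def mem_box_cart abs_le_iff algebra_simps)

lemma cube_sym: "x \<in> cube z r \<longleftrightarrow> z \<in> cube x r"
  by (simp add: cube_def abs_minus_commute)

lemma emeasure_cube:
  fixes z :: "real^'n"
  assumes "r \<ge> 0"
  shows "emeasure lborel (cube z r) = ennreal ((2 * r) ^ CARD('n))"
proof -
  have "emeasure lborel (cube z r) = ennreal (\<Prod>b\<in>Basis. ((z + vec r) - (z - vec r)) \<bullet> b)"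
    unfolding cube_eq_cbox using assms
    by (intro emeasure_lborel_cbox) (auto simp: Basis_vec_def inner_axis inner_simps)
  also have "(\<Prod>b\<in>Basis. ((z + vec r) - (z - vec r)) \<bullet> b) = (\<Prod>b\<in>(Basis::(real^'n) set). 2 * r)"
    by (intro prod.cong) (auto simp: Basis_vec_def inner_axis inner_simps)
  also have "\<dots> = (2 * r) ^ CARD('n)" by simp
  finally show ?thesis .
qed

text \<open>Point and centre both vary in the applications of Tonelli's theorem, so measurability is
  needed jointly.\<close>

lemma cube_measurable [measurable (raw)]:
  fixes f g :: "'a \<Rightarrow> real^'n"
  assumes "f \<in> borel_measurable M" "g \<in> borel_measurable M"
  shows "Measurable.pred M (\<lambda>x. f x \<in> cube (g x) r)"
proof -
  have "closed {p::(real^'n) \<times> (real^'n). \<forall>i. \<bar>fst p $ i - snd p $ i\<bar> \<le> r}"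
    by (intro closed_Collect_all closed_Collect_le continuous_intros)
  then have "{p::(real^'n) \<times> (real^'n). fst p \<in> cube (snd p) r} \<in> sets borel"
    by (simp add: cube_def)
  then have "Measurable.pred (borel \<Otimes>\<^sub>M borel) (\<lambda>p::(real^'n) \<times> (real^'n). fst p \<in> cube (snd p) r)"
    by (simp add: borel_prod pred_def)
  from measurable_compose[OF measurable_Pair[OF assms] this] show ?thesis by simp
qed

text \<open>The fundamental theorem of calculus along the segment from x to y. Nonnegative integrals
  allow Tonelli's theorem to be applied later without integrability conditions.\<close>

lemma diff_le_integral_grad:
  assumes \<phi>: "\<phi> \<in> test_functions \<Omega>"
  shows "ennreal \<bar>\<phi> x - \<phi> y\<bar> \<le> ennreal (norm (x - y)) *
    (\<integral>\<^sup>+t. indicator {0..1} t * ennreal (norm (grad \<phi> (x + t *\<^sub>R (y - x)))) \<partial>lborel)"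
proof -
  have [measurable]: "grad \<phi> \<in> borel_measurable borel" by (rule test_functions_grad_borel[OF \<phi>])
  let ?F = "\<lambda>t. \<phi> (x + t *\<^sub>R (y - x))" and ?f = "\<lambda>t. grad \<phi> (x + t *\<^sub>R (y - x)) \<bullet> (y - x)"
  have grad_cont: "continuous_on UNIV (grad \<phi>)"
    unfolding grad_def by (intro continuous_on_vec_lambda smooth_continuous smooth_partial_deriv
        test_functions_smooth[OF \<phi>])
  have "continuous_on {0..1} (\<lambda>t. x + t *\<^sub>R (y - x))"
    by (intro continuous_intros)
  then have f_cont: "continuous_on {0..1} ?f"
    by (intro continuous_on_inner continuous_on_const continuous_on_compose2[OF grad_cont]) auto
  have F: "(?F has_vector_derivative ?f t) (at t within {0..1})" for t
  proof -
    have "((\<lambda>t. x + t *\<^sub>R (y - x)) has_derivative (\<lambda>s. s *\<^sub>R (y - x))) (at t within {0..1})"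
      by (auto intro!: derivative_eq_intros)
    from has_derivative_compose[OF this smooth_has_grad[OF test_functions_smooth[OF \<phi>]]]
    show ?thesis by (simp add: has_vector_derivative_def)
  qed
  have "has_bochner_integral lborel (\<lambda>t. indicator {0..1} t *\<^sub>R ?f t) (?F 1 - ?F 0)"
    by (rule has_bochner_integral_FTC_Icc) (use F f_cont in auto)
  then have i: "integrable lborel (\<lambda>t. indicator {0..1} t *\<^sub>R ?f t)"
    and eq: "(LINT t|lborel. indicator {0..1} t *\<^sub>R ?f t) = \<phi> y - \<phi> x"
    by (auto simp: has_bochner_integral_iff)
  have "ennreal \<bar>\<phi> x - \<phi> y\<bar> \<le> (\<integral>\<^sup>+t. ennreal (norm (indicator {0..1} t *\<^sub>R ?f t)) \<partial>lborel)"
    using integral_norm_bound_ennreal[OF i] eq by (simp add: abs_minus_commute)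
  also have "\<dots> \<le> (\<integral>\<^sup>+t. ennreal (norm (x - y)) *
      (indicator {0..1} t * ennreal (norm (grad \<phi> (x + t *\<^sub>R (y - x))))) \<partial>lborel)"
  proof (rule nn_integral_mono)
    fix t :: real
    have "\<bar>?f t\<bar> \<le> norm (x - y) * norm (grad \<phi> (x + t *\<^sub>R (y - x)))"
      using Cauchy_Schwarz_ineq2[of "grad \<phi> (x + t *\<^sub>R (y - x))" "y - x"]
      by (simp add: norm_minus_commute mult.commute)
    then show "ennreal (norm (indicator {0..1} t *\<^sub>R ?f t)) \<le> ennreal (norm (x - y)) *
        (indicator {0..1} t * ennreal (norm (grad \<phi> (x + t *\<^sub>R (y - x)))))"
      by (auto simp: indicator_def ennreal_mult'[symmetric] intro!: ennreal_leI)
  qed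
  also have "\<dots> = ennreal (norm (x - y)) *
      (\<integral>\<^sup>+t. indicator {0..1} t * ennreal (norm (grad \<phi> (x + t *\<^sub>R (y - x)))) \<partial>lborel)"
    by (intro nn_integral_cmult) measurable
  finally show ?thesis .
qed

text \<open>A shift by a vector h of length 2 R + 1 moves every point of \<Omega> out of \<Omega>,
  so \<phi> at x is a difference of values along the segment to x + h. Tonelli's theorem and
  translation invariance give the constant 2 R + 1. The coordinate direction is arbitrary.\<close>

lemma poincare:
  fixes \<phi> :: "real^'n \<Rightarrow> real"
  assumes \<phi>: "\<phi> \<in> test_functions \<Omega>" and \<Omega>: "\<Omega> \<subseteq> cball 0 R" and R: "R \<ge> 0"
  shows "(\<integral>\<^sup>+x. ennreal \<bar>\<phi> x\<bar> \<partial>lborel)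
    \<le> ennreal (2 * R + 1) * (\<integral>\<^sup>+x. ennreal (norm (grad \<phi> x)) \<partial>lborel)"
proof -
  have [measurable]: "grad \<phi> \<in> borel_measurable borel" by (rule test_functions_grad_borel[OF \<phi>])
  let ?G = "\<lambda>x. ennreal (norm (grad \<phi> x))"
  define h :: "real^'n" where "h = (2 * R + 1) *\<^sub>R axis undefined 1"
  have h: "norm h = 2 * R + 1" using R by (simp add: h_def)
  have "ennreal \<bar>\<phi> x\<bar> \<le> ennreal (2 * R + 1) * (\<integral>\<^sup>+t. indicator {0..1} t * ?G (x + t *\<^sub>R h) \<partial>lborel)" for x
  proof (cases "x \<in> \<Omega>")
    case True
    then have "norm x \<le> R" using \<Omega> by auto
    moreover have "norm h \<le> norm (x + h) + norm x"
      using norm_triangle_ineq4[of "x + h" x] by simp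
    ultimately have "x + h \<notin> \<Omega>" using h R \<Omega> by (auto dest!: subsetD)
    then have "\<phi> (x + h) = 0" by (rule test_functions_zero[OF \<phi>])
    then show ?thesis
      using diff_le_integral_grad[OF \<phi>, of x "x + h"] h by simp
  qed (simp add: test_functions_zero[OF \<phi>])
  then have "(\<integral>\<^sup>+x. ennreal \<bar>\<phi> x\<bar> \<partial>lborel)
      \<le> (\<integral>\<^sup>+x. ennreal (2 * R + 1) * (\<integral>\<^sup>+t. indicator {0..1} t * ?G (x + t *\<^sub>R h) \<partial>lborel) \<partial>lborel)"
    by (intro nn_integral_mono)
  also have "\<dots> = ennreal (2 * R + 1) * (\<integral>\<^sup>+x. (\<integral>\<^sup>+t. indicator {0..1} t * ?G (x + t *\<^sub>R h) \<partial>lborel) \<partial>lborel)"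
    by (intro nn_integral_cmult) measurable
  also have "(\<integral>\<^sup>+x. (\<integral>\<^sup>+t. indicator {0..1} t * ?G (x + t *\<^sub>R h) \<partial>lborel) \<partial>lborel)
      = (\<integral>\<^sup>+t. (\<integral>\<^sup>+x. indicator {0..1} t * ?G (x + t *\<^sub>R h) \<partial>lborel) \<partial>lborel)"
    by (rule lborel_pair.Fubini') measurable
  also have "\<dots> = (\<integral>\<^sup>+t. indicator {0..1::real} t * (\<integral>\<^sup>+x. ?G x \<partial>lborel) \<partial>lborel)"
  proof (rule nn_integral_cong)
    fix t :: real
    have "(\<integral>\<^sup>+x. indicator {0..1} t * ?G (x + t *\<^sub>R h) \<partial>lborel)
        = indicator {0..1} t * (\<integral>\<^sup>+x. ?G (t *\<^sub>R h + x) \<partial>lborel)"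
      by (simp add: nn_integral_cmult add.commute)
    then show "(\<integral>\<^sup>+x. indicator {0..1} t * ?G (x + t *\<^sub>R h) \<partial>lborel) = indicator {0..1} t * (\<integral>\<^sup>+x. ?G x \<partial>lborel)"
      by (simp add: nn_integral_translate[of ?G])
  qed
  also have "\<dots> = (\<integral>\<^sup>+x. ?G x \<partial>lborel)"
    by (simp add: nn_integral_multc)
  finally show ?thesis .
qed

text \<open>A substitute for Hoelder's inequality between an L^p function and an indicator.\<close>

lemma cube_integral_le:
  fixes u :: "real^'n \<Rightarrow> real"
  assumes [measurable]: "u \<in> borel_measurable borel"
    and A: "(\<integral>\<^sup>+x. ennreal (\<bar>u x\<bar> powr p) \<partial>lborel) \<le> ennreal A" "A \<ge> 0"
    and p: "p \<ge> 1" and r: "r > 0"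
  shows "(\<integral>\<^sup>+x. indicator (cube z r) x * ennreal \<bar>u x\<bar> \<partial>lborel)
    \<le> ennreal ((1 + A) * (2 * r) powr (real CARD('n) - real CARD('n) / p))"
proof -
  define n where "n = real CARD('n)"
  \<comment> \<open>Values up to s are counted by s times the volume, larger ones by s^(1 - p)
    |u|^p. This s balances the two: both scale like (2 r)^(n - n/p).\<close>
  define s where "s = (2 * r) powr (- (n / p))"
  have s: "s > 0" using r by (simp add: s_def)
  have pt: "\<bar>u x\<bar> \<le> s + s powr (1 - p) * \<bar>u x\<bar> powr p" for x
  proof (cases "\<bar>u x\<bar> \<le> s")
    case False
    have "1 \<le> (\<bar>u x\<bar> / s) powr (p - 1)"
      using False s p by (intro ge_one_powr_ge_zero) (auto simp: field_simps)
    then have "\<bar>u x\<bar> * 1 \<le> \<bar>u x\<bar> * (\<bar>u x\<bar> / s) powr (p - 1)" by (intro mult_left_mono) auto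
    also have "\<dots> = s powr (1 - p) * \<bar>u x\<bar> powr p"
      using False s by (simp add: powr_divide powr_diff powr_one field_simps)
    finally show ?thesis using s by simp
  qed (simp add: add_increasing2)
  have [measurable]: "cube z r \<in> sets borel" by (simp add: cube_eq_cbox)
  have "(\<integral>\<^sup>+x. indicator (cube z r) x * ennreal \<bar>u x\<bar> \<partial>lborel)
      \<le> (\<integral>\<^sup>+x. ennreal s * indicator (cube z r) x + ennreal (s powr (1 - p)) * ennreal (\<bar>u x\<bar> powr p) \<partial>lborel)"
  proof (rule nn_integral_mono)
    fix x
    show "indicator (cube z r) x * ennreal \<bar>u x\<bar>
        \<le> ennreal s * indicator (cube z r) x + ennreal (s powr (1 - p)) * ennreal (\<bar>u x\<bar> powr p)"
      using pt[of x] s by (auto simp: indicator_def ennreal_mult'[symmetric] ennreal_plus[symmetric]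
          simp del: ennreal_plus intro!: ennreal_leI)
  qed
  also have "\<dots> = ennreal s * emeasure lborel (cube z r)
      + ennreal (s powr (1 - p)) * (\<integral>\<^sup>+x. ennreal (\<bar>u x\<bar> powr p) \<partial>lborel)"
    by (subst nn_integral_add) (simp_all add: nn_integral_cmult)
  also have "\<dots> \<le> ennreal s * ennreal ((2 * r) ^ CARD('n)) + ennreal (s powr (1 - p)) * ennreal A"
    using A r by (intro add_mono mult_left_mono) (auto simp: emeasure_cube)
  also have "\<dots> = ennreal (s * (2 * r) powr n + s powr (1 - p) * A)"
    using s r A by (simp add: ennreal_mult'[symmetric] ennreal_plus[symmetric] n_def powr_realpow
        del: ennreal_plus)
  also have "s * (2 * r) powr n = (2 * r) powr (n - n / p)"
    using r by (simp add: s_def powr_add[symmetric])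
  also have "s powr (1 - p) = (2 * r) powr (n - n / p)"
  proof -
    have "- (n / p) * (1 - p) = n - n / p" using p by (simp add: field_simps)
    then show ?thesis by (simp add: s_def powr_powr)
  qed
  finally show ?thesis by (simp add: n_def algebra_simps)
qed

text \<open>Used with a = n / p: convergence at 0 is where p > n enters the kernel estimate.\<close>

lemma nn_integral_powr_0_1:
  assumes "a < 1"
  shows "(\<integral>\<^sup>+t. indicator {0..1} t * ennreal (t powr (- a)) \<partial>lborel) = ennreal (1 / (1 - a))"
proof -
  have "((\<lambda>t. t powr (- a)) has_integral (1 powr (- a + 1) / (- a + 1))) {0..1}"
    using assms by (intro has_integral_powr_from_0) auto
  then show ?thesis
    by (subst nn_integral_has_integral_lebesgue'[of "{0..1}" "\<lambda>t. t powr (- a)", symmetric])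
      (simp_all add: mult.commute)
qed

text \<open>
  Writing the difference of values as an integral of the gradient over the segment from x to y and
  substituting z = x + t (y - x) for y leaves, for every z, an integral of u over a cube of
  side proportional to t.
\<close>

lemma kernel_estimate:
  fixes u \<phi> :: "real^'n \<Rightarrow> real"
  assumes u [measurable]: "u \<in> borel_measurable borel"
    and A: "(\<integral>\<^sup>+x. ennreal (\<bar>u x\<bar> powr p) \<partial>lborel) \<le> ennreal A" "A \<ge> 0"
    and p: "p > real CARD('n)" and e: "\<epsilon> > 0" and \<phi>: "\<phi> \<in> test_functions \<Omega>"
  shows "(\<integral>\<^sup>+x. (\<integral>\<^sup>+y. ennreal \<bar>u x\<bar> * (indicator (cube x \<epsilon>) y * ennreal \<bar>\<phi> x - \<phi> y\<bar>) \<partial>lborel) \<partial>lborel)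
    \<le> ennreal (real CARD('n) * \<epsilon> * ((1 + A) * (2 * \<epsilon>) powr (real CARD('n) - real CARD('n) / p))
        / (1 - real CARD('n) / p)) * (\<integral>\<^sup>+x. ennreal (norm (grad \<phi> x)) \<partial>lborel)"
proof -
  define n where "n = real CARD('n)"
  have n: "n \<ge> 1" unfolding n_def using zero_less_card_finite[where 'a = 'n] by linarith
  then have p1: "p \<ge> 1" using p unfolding n_def by linarith
  have [measurable]: "grad \<phi> \<in> borel_measurable borel" by (rule test_functions_grad_borel[OF \<phi>])
  let ?G = "\<lambda>x. ennreal (norm (grad \<phi> x))"
  let ?I = "\<integral>\<^sup>+x. ?G x \<partial>lborel"
  let ?U = "\<lambda>x. ennreal \<bar>u x\<bar>"
  define c where "c = (1 + A) * (2 * \<epsilon>) powr (n - n / p)"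
  have c: "c \<ge> 0" using A by (simp add: c_def)
  \<comment> \<open>For fixed t, the substitution contributes t^(-n), and the integral of u over the
    cube of half side t \<epsilon> around z contributes t^(n - n/p) by
    \<open>cube_integral_le\<close>.\<close>
  have inner: "(\<integral>\<^sup>+x. (\<integral>\<^sup>+y. ?U x * (indicator (cube x \<epsilon>) y * ?G (x + t *\<^sub>R (y - x))) \<partial>lborel) \<partial>lborel)
      \<le> ennreal (c * t powr (- (n / p))) * ?I" if t: "t > 0" for t
  proof -
    have y: "(\<integral>\<^sup>+y. indicator (cube x \<epsilon>) y * ?G (x + t *\<^sub>R (y - x)) \<partial>lborel)
        = ennreal ((1 / t) ^ CARD('n)) * (\<integral>\<^sup>+z. indicator (cube x (t * \<epsilon>)) z * ?G z \<partial>lborel)" for x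
    proof -
      have [measurable]: "cube x r \<in> sets borel" for r by (simp add: cube_eq_cbox)
      have "indicator (cube x \<epsilon>) y * ?G (x + t *\<^sub>R (y - x))
          = indicator (cube x (t * \<epsilon>)) ((x - t *\<^sub>R x) + t *\<^sub>R y) * ?G ((x - t *\<^sub>R x) + t *\<^sub>R y)" for y
      proof -
        have eq: "x + t *\<^sub>R (y - x) = (x - t *\<^sub>R x) + t *\<^sub>R y" by (simp add: algebra_simps)
        have "t * y $ i - t * x $ i = t * (y $ i - x $ i)" for i by (simp add: algebra_simps)
        then have "y \<in> cube x \<epsilon> \<longleftrightarrow> (x - t *\<^sub>R x) + t *\<^sub>R y \<in> cube x (t * \<epsilon>)"
          using t by (simp add: cube_def abs_mult)
        then show ?thesis by (simp add: eq indicator_def)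
      qed
      then show ?thesis
        using nn_integral_affine[of "\<lambda>z. indicator (cube x (t * \<epsilon>)) z * ?G z" t "x - t *\<^sub>R x"] t
        by simp
    qed
    have "(\<integral>\<^sup>+x. (\<integral>\<^sup>+y. ?U x * (indicator (cube x \<epsilon>) y * ?G (x + t *\<^sub>R (y - x))) \<partial>lborel) \<partial>lborel)
      = (\<integral>\<^sup>+x. ?U x * (\<integral>\<^sup>+y. indicator (cube x \<epsilon>) y * ?G (x + t *\<^sub>R (y - x)) \<partial>lborel) \<partial>lborel)"
      by (intro nn_integral_cong nn_integral_cmult) (simp add: cube_eq_cbox)
    also have "\<dots> = (\<integral>\<^sup>+x. ennreal ((1 / t) ^ CARD('n)) *
        (\<integral>\<^sup>+z. ?U x * (indicator (cube x (t * \<epsilon>)) z * ?G z) \<partial>lborel) \<partial>lborel)"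
      unfolding y by (intro nn_integral_cong) (simp add: nn_integral_cmult cube_eq_cbox mult_ac)
    also have "\<dots> = ennreal ((1 / t) ^ CARD('n)) *
        (\<integral>\<^sup>+x. (\<integral>\<^sup>+z. ?U x * (indicator (cube x (t * \<epsilon>)) z * ?G z) \<partial>lborel) \<partial>lborel)"
      by (intro nn_integral_cmult) measurable
    also have "(\<integral>\<^sup>+x. (\<integral>\<^sup>+z. ?U x * (indicator (cube x (t * \<epsilon>)) z * ?G z) \<partial>lborel) \<partial>lborel)
        = (\<integral>\<^sup>+z. (\<integral>\<^sup>+x. ?U x * (indicator (cube x (t * \<epsilon>)) z * ?G z) \<partial>lborel) \<partial>lborel)"
      by (rule lborel_pair.Fubini') measurable
    also have "\<dots> = (\<integral>\<^sup>+z. ?G z * (\<integral>\<^sup>+x. indicator (cube z (t * \<epsilon>)) x * ?U x \<partial>lborel) \<partial>lborel)"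
    proof (rule nn_integral_cong)
      fix z
      have "(\<integral>\<^sup>+x. ?U x * (indicator (cube x (t * \<epsilon>)) z * ?G z) \<partial>lborel)
          = (\<integral>\<^sup>+x. ?G z * (indicator (cube z (t * \<epsilon>)) x * ?U x) \<partial>lborel)"
        by (intro nn_integral_cong) (auto simp: indicator_def cube_sym mult_ac)
      then show "(\<integral>\<^sup>+x. ?U x * (indicator (cube x (t * \<epsilon>)) z * ?G z) \<partial>lborel)
          = ?G z * (\<integral>\<^sup>+x. indicator (cube z (t * \<epsilon>)) x * ?U x \<partial>lborel)"
        by (simp add: nn_integral_cmult cube_eq_cbox)
    qed
    also have "\<dots> \<le> (\<integral>\<^sup>+z. ?G z * ennreal ((1 + A) * (2 * (t * \<epsilon>)) powr (n - n / p)) \<partial>lborel)"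
      unfolding n_def using t e
      by (intro nn_integral_mono mult_left_mono cube_integral_le[OF u A p1]) auto
    also have "\<dots> = ?I * ennreal ((1 + A) * (2 * (t * \<epsilon>)) powr (n - n / p))"
      by (intro nn_integral_multc) measurable
    finally have "(\<integral>\<^sup>+x. (\<integral>\<^sup>+y. ?U x * (indicator (cube x \<epsilon>) y * ?G (x + t *\<^sub>R (y - x))) \<partial>lborel) \<partial>lborel)
      \<le> ennreal ((1 / t) ^ CARD('n)) * (?I * ennreal ((1 + A) * (2 * (t * \<epsilon>)) powr (n - n / p)))"
      by (simp add: mult_left_mono)
    also have "\<dots> = ennreal ((1 / t) ^ CARD('n) * ((1 + A) * (2 * (t * \<epsilon>)) powr (n - n / p))) * ?I"
      by (subst ennreal_mult'[of "(1 / t) ^ CARD('n)"]) (use t in \<open>simp_all only: mult_ac zero_le_power zero_le_divide_1_iff less_imp_le\<close>)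
    also have "(1 / t) ^ CARD('n) * ((1 + A) * (2 * (t * \<epsilon>)) powr (n - n / p)) = c * t powr (- (n / p))"
    proof -
      have "(1 / t) ^ CARD('n) = t powr (- n)"
        using t by (simp add: n_def powr_minus powr_realpow inverse_eq_divide power_one_over)
      moreover have "(2 * (t * \<epsilon>)) powr (n - n / p) = (2 * \<epsilon>) powr (n - n / p) * t powr (n - n / p)"
        using t e by (simp add: powr_mult[symmetric] mult_ac)
      moreover have "t powr (- n) * t powr (n - n / p) = t powr (- (n / p))"
        by (simp add: powr_add[symmetric])
      ultimately show ?thesis by (simp add: c_def mult_ac)
    qed
    finally show ?thesis .
  qed
  have "(\<integral>\<^sup>+x. (\<integral>\<^sup>+y. ?U x * (indicator (cube x \<epsilon>) y * ennreal \<bar>\<phi> x - \<phi> y\<bar>) \<partial>lborel) \<partial>lborel)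
    \<le> (\<integral>\<^sup>+x. (\<integral>\<^sup>+y. (\<integral>\<^sup>+t. ennreal (n * \<epsilon>) * (indicator {0..1} t *
        (?U x * (indicator (cube x \<epsilon>) y * ?G (x + t *\<^sub>R (y - x))))) \<partial>lborel) \<partial>lborel) \<partial>lborel)"
  proof (intro nn_integral_mono)
    fix x y :: "real^'n"
    let ?T = "\<integral>\<^sup>+t. indicator {0..1} t * ?G (x + t *\<^sub>R (y - x)) \<partial>lborel"
    have "indicator (cube x \<epsilon>) y * ennreal \<bar>\<phi> x - \<phi> y\<bar> \<le> ennreal (n * \<epsilon>) * (indicator (cube x \<epsilon>) y * ?T)"
    proof (cases "y \<in> cube x \<epsilon>")
      case True
      have "norm (x - y) \<le> (\<Sum>i\<in>UNIV. \<bar>(x - y) $ i\<bar>)" by (rule norm_le_l1_cart)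
      also have "\<dots> \<le> (\<Sum>i\<in>(UNIV::'n set). \<epsilon>)"
        using True by (intro sum_mono) (simp add: cube_def abs_minus_commute)
      finally have "norm (x - y) \<le> n * \<epsilon>" by (simp add: n_def)
      then show ?thesis
        using diff_le_integral_grad[OF \<phi>, of x y] True
        by (simp add: order_trans[OF _ mult_right_mono] ennreal_leI)
    qed simp
    then have "?U x * (indicator (cube x \<epsilon>) y * ennreal \<bar>\<phi> x - \<phi> y\<bar>)
        \<le> ?U x * (ennreal (n * \<epsilon>) * (indicator (cube x \<epsilon>) y * ?T))"
      by (rule mult_left_mono) simp
    also have "\<dots> = (ennreal (n * \<epsilon>) * ?U x * indicator (cube x \<epsilon>) y) * ?T"
      by (simp add: mult_ac)
    also have "\<dots> = (\<integral>\<^sup>+t. (ennreal (n * \<epsilon>) * ?U x * indicator (cube x \<epsilon>) y) * (indicator {0..1} t * ?G (x + t *\<^sub>R (y - x))) \<partial>lborel)"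
      by (rule nn_integral_cmult[symmetric]) measurable
    finally show "?U x * (indicator (cube x \<epsilon>) y * ennreal \<bar>\<phi> x - \<phi> y\<bar>)
        \<le> (\<integral>\<^sup>+t. ennreal (n * \<epsilon>) * (indicator {0..1} t *
        (?U x * (indicator (cube x \<epsilon>) y * ?G (x + t *\<^sub>R (y - x))))) \<partial>lborel)"
      by (simp add: mult_ac)
  qed
  also have "\<dots> = (\<integral>\<^sup>+x. (\<integral>\<^sup>+t. (\<integral>\<^sup>+y. ennreal (n * \<epsilon>) * (indicator {0..1} t *
        (?U x * (indicator (cube x \<epsilon>) y * ?G (x + t *\<^sub>R (y - x))))) \<partial>lborel) \<partial>lborel) \<partial>lborel)"
  proof (intro nn_integral_cong lborel_pair.Fubini')
    fix x :: "real^'n"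
    have [measurable]: "cube x \<epsilon> \<in> sets borel" by (simp add: cube_eq_cbox)
    show "(\<lambda>(t, y). ennreal (n * \<epsilon>) * (indicator {0..1} t *
        (?U x * (indicator (cube x \<epsilon>) y * ?G (x + t *\<^sub>R (y - x)))))) \<in> borel_measurable (lborel \<Otimes>\<^sub>M lborel)"
      by measurable
  qed
  also have "\<dots> = (\<integral>\<^sup>+t. (\<integral>\<^sup>+x. (\<integral>\<^sup>+y. ennreal (n * \<epsilon>) * (indicator {0..1} t *
        (?U x * (indicator (cube x \<epsilon>) y * ?G (x + t *\<^sub>R (y - x))))) \<partial>lborel) \<partial>lborel) \<partial>lborel)"
    by (intro lborel_pair.Fubini') measurable
  also have "\<dots> \<le> (\<integral>\<^sup>+t. (ennreal (n * \<epsilon>) * ennreal c * ?I) * (indicator {0..1} t * ennreal (t powr (- (n / p)))) \<partial>lborel)"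
  proof (rule nn_integral_mono_AE, rule AE_mp[OF AE_lborel_singleton[of 0]], intro AE_I2 impI)
    fix t :: real assume t0: "t \<noteq> 0"
    show "(\<integral>\<^sup>+x. (\<integral>\<^sup>+y. ennreal (n * \<epsilon>) * (indicator {0..1} t *
        (?U x * (indicator (cube x \<epsilon>) y * ?G (x + t *\<^sub>R (y - x))))) \<partial>lborel) \<partial>lborel)
      \<le> (ennreal (n * \<epsilon>) * ennreal c * ?I) * (indicator {0..1} t * ennreal (t powr (- (n / p))))"
    proof (cases "t \<in> {0..1}")
      case True
      then have t: "t > 0" using t0 by auto
      have "(\<integral>\<^sup>+x. (\<integral>\<^sup>+y. ennreal (n * \<epsilon>) * (?U x * (indicator (cube x \<epsilon>) y * ?G (x + t *\<^sub>R (y - x)))) \<partial>lborel) \<partial>lborel)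
        = (\<integral>\<^sup>+x. ennreal (n * \<epsilon>) * (\<integral>\<^sup>+y. ?U x * (indicator (cube x \<epsilon>) y * ?G (x + t *\<^sub>R (y - x))) \<partial>lborel) \<partial>lborel)"
        by (intro nn_integral_cong nn_integral_cmult) (simp add: cube_eq_cbox)
      also have "\<dots> = ennreal (n * \<epsilon>) * (\<integral>\<^sup>+x. (\<integral>\<^sup>+y. ?U x * (indicator (cube x \<epsilon>) y * ?G (x + t *\<^sub>R (y - x))) \<partial>lborel) \<partial>lborel)"
        by (intro nn_integral_cmult) measurable
      also have "\<dots> \<le> ennreal (n * \<epsilon>) * (ennreal (c * t powr (- (n / p))) * ?I)"
        by (intro mult_left_mono inner t) auto
      finally show ?thesis using True c by (simp add: ennreal_mult' mult_ac)
    qed simp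
  qed
  also have "\<dots> = (ennreal (n * \<epsilon>) * ennreal c * ?I) * ennreal (1 / (1 - n / p))"
  proof -
    have "n / p < 1" using p n by (simp add: n_def)
    then show ?thesis by (subst nn_integral_cmult) (auto simp: nn_integral_powr_0_1)
  qed
  also have "\<dots> = ennreal (n * \<epsilon> * c / (1 - n / p)) * ?I"
  proof -
    have "n / p < 1" using p n by (simp add: n_def)
    then have "ennreal (n * \<epsilon> * c / (1 - n / p)) = ennreal (n * \<epsilon>) * ennreal c * ennreal (1 / (1 - n / p))"
      using n e c by (simp add: ennreal_mult'[symmetric])
    then show ?thesis by (simp add: mult_ac)
  qed
  finally show ?thesis unfolding c_def n_def .
qed

section \<open>Weak convergence of controls tested with gradients\<close>

text \<open>Half-open grid cells of side 1 / m partition the space, so each point has exactly one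
  cell. Their labels form a countable type, as the diagonal argument over all cells and all m
  requires.\<close>

definition cell_index :: "nat \<Rightarrow> real^'n \<Rightarrow> 'n \<Rightarrow> int" where
  "cell_index m x = (\<lambda>i. \<lfloor>real m * x $ i\<rfloor>)"

definition cell :: "nat \<Rightarrow> ('n \<Rightarrow> int) \<Rightarrow> (real^'n) set" where
  "cell m z = {x. cell_index m x = z}"

lemma cell_subset_cube:
  assumes "m > 0" and "x \<in> cell m z" and "y \<in> cell m z"
  shows "y \<in> cube x (1 / real m)"
proof -
  have "\<bar>y $ i - x $ i\<bar> \<le> 1 / real m" for i
  proof -
    have "\<lfloor>real m * x $ i\<rfloor> = \<lfloor>real m * y $ i\<rfloor>"
      using assms unfolding cell_def cell_index_def by (simp add: fun_eq_iff)
    then have "\<bar>real m * y $ i - real m * x $ i\<bar> \<le> 1" by linarith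
    then have "real m * \<bar>y $ i - x $ i\<bar> \<le> 1"
      by (simp add: right_diff_distrib[symmetric] abs_mult)
    then show ?thesis using assms(1) by (simp add: field_simps)
  qed
  then show ?thesis by (simp add: cube_def)
qed

lemma cell_sets [measurable]: "cell m z \<in> sets borel"
proof -
  have "cell m z = (\<Inter>i\<in>UNIV. {x. of_int (z i) \<le> real m * x $ i} \<inter> {x. real m * x $ i < of_int (z i) + 1})"
    by (auto simp: cell_def cell_index_def fun_eq_iff floor_eq_iff)
  also have "\<dots> \<in> sets borel"
    by (intro sets.finite_INT sets.Int borel_closed borel_open closed_Collect_le open_Collect_less continuous_intros) auto
  finally show ?thesis .
qed

lemma emeasure_cell:
  fixes z :: "'n::finite \<Rightarrow> int"
  assumes "m > 0"
  shows "emeasure lborel (cell m z) = ennreal ((1 / real m) ^ CARD('n))"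
proof -
  define l u :: "real^'n" where "l = (\<chi> i. of_int (z i) / real m)" and "u = (\<chi> i. (of_int (z i) + 1) / real m)"
  have diff: "u - l = vec (1 / real m)"
    using assms by (simp add: l_def u_def vec_eq_iff diff_divide_distrib[symmetric])
  have lu: "l \<bullet> b \<le> u \<bullet> b" if "b \<in> Basis" for b
  proof -
    have "(u - l) \<bullet> b \<ge> 0" unfolding diff using that by (auto simp: Basis_vec_def inner_axis)
    then show ?thesis by (simp add: inner_diff_left)
  qed
  have prod: "(\<Prod>b\<in>Basis. (u - l) \<bullet> b) = (1 / real m) ^ CARD('n)"
  proof -
    have "(\<Prod>b\<in>Basis. (u - l) \<bullet> b) = (\<Prod>b\<in>(Basis::(real^'n) set). 1 / real m)"
      unfolding diff by (intro prod.cong) (auto simp: Basis_vec_def inner_axis)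
    then show ?thesis by simp
  qed
  have "box l u \<subseteq> cell m z" "cell m z \<subseteq> cbox l u"
    using assms by (auto simp: cell_def cell_index_def fun_eq_iff floor_eq_iff mem_box_cart l_def u_def field_simps less_imp_le)
  then have "emeasure lborel (box l u) \<le> emeasure lborel (cell m z)"
    "emeasure lborel (cell m z) \<le> emeasure lborel (cbox l u)"
    by (auto intro!: emeasure_mono)
  then show ?thesis
    using lu by (simp add: emeasure_lborel_box emeasure_lborel_cbox prod)
qed

lemma measure_cell:
  fixes z :: "'n::finite \<Rightarrow> int"
  shows "m > 0 \<Longrightarrow> measure lborel (cell m z) = (1 / real m) ^ CARD('n)"
  by (simp add: measure_def emeasure_cell)

lemma integrable_indicator_times:
  fixes f :: "'a \<Rightarrow> real"
  assumes "integrable M f" and [measurable]: "A \<in> sets M"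
  shows "integrable M (\<lambda>x. indicator A x * f x)"
  using integrable_mult_indicator[OF assms(2,1)] by simp

lemma test_functions_grad_integrable:
  fixes \<phi> :: "real^'n \<Rightarrow> real"
  assumes "\<phi> \<in> test_functions \<Omega>"
  shows "integrable lborel (\<lambda>x. norm (grad \<phi> x))"
proof (rule Bochner_Integration.integrable_bound)
  show "integrable lborel (\<lambda>x. \<Sum>i\<in>UNIV. \<bar>partial_deriv i \<phi> x\<bar>)"
    by (intro Bochner_Integration.integrable_sum integrable_abs
        test_functions_integrable[OF partial_deriv_test_functions[OF assms]])
  show "(\<lambda>x. norm (grad \<phi> x)) \<in> borel_measurable lborel"
    using test_functions_grad_borel[OF assms] by (simp add: borel_measurable_norm)
  show "AE x in lborel. norm (norm (grad \<phi> x)) \<le> norm (\<Sum>i\<in>UNIV. \<bar>partial_deriv i \<phi> x\<bar>)"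
    using norm_grad_le[of \<phi>] by (auto intro!: AE_I2 order_trans[OF norm_grad_le])
qed

definition cell_indices :: "nat \<Rightarrow> real \<Rightarrow> ('n::finite \<Rightarrow> int) set" where
  "cell_indices m R = {z. \<forall>i. \<bar>z i\<bar> \<le> \<lceil>real m * R\<rceil> + 1}"

lemma finite_cell_indices: "finite (cell_indices m R)"
proof -
  have "cell_indices m R \<subseteq> (UNIV \<rightarrow>\<^sub>E {- (\<lceil>real m * R\<rceil> + 1)..\<lceil>real m * R\<rceil> + 1})"
    by (auto simp: cell_indices_def PiE_iff abs_le_iff) (smt (verit))+
  then show ?thesis by (rule finite_subset) (intro finite_PiE; simp)
qed

lemma cell_index_in: "x \<in> cball 0 R \<Longrightarrow> cell_index m x \<in> cell_indices m R"
  unfolding cell_indices_def cell_index_def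
proof (intro CollectI allI)
  fix i assume "x \<in> cball 0 R"
  then have "\<bar>x $ i\<bar> \<le> R" using component_le_norm_cart[of x i] by simp
  then have "real m * \<bar>x $ i\<bar> \<le> real m * R" by (intro mult_left_mono) auto
  then have "\<bar>real m * x $ i\<bar> \<le> real m * R" by (simp add: abs_mult)
  then show "\<bar>\<lfloor>real m * x $ i\<rfloor>\<bar> \<le> \<lceil>real m * R\<rceil> + 1" by linarith
qed

text \<open>The cell volume times \<phi> x is the integral of \<phi> over the cell of x plus
  \<open>h x\<close>, the integral of \<phi> x - \<phi> y over y in that cell. The first part meets
  only the finitely many cell integrals of u. The second is handled by
  \<open>kernel_estimate\<close>, since a cell lies in the cube of half side 1 / m around each of
  its points.\<close>

lemma cell_estimate:
  fixes u \<phi> :: "real^'n \<Rightarrow> real"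
  assumes u: "integrable lborel u" and u0: "\<And>x. x \<notin> cball 0 R \<Longrightarrow> u x = 0"
    and A: "(\<integral>\<^sup>+x. ennreal (\<bar>u x\<bar> powr p) \<partial>lborel) \<le> ennreal A" "A \<ge> 0"
    and p: "p > real CARD('n)" and m: "m > 0" and \<phi>: "\<phi> \<in> test_functions \<Omega>"
  shows "(1 / real m) ^ CARD('n) * \<bar>LINT x|lborel. u x * \<phi> x\<bar>
    \<le> (\<Sum>z\<in>cell_indices m R. \<bar>LINT x|lborel. indicator (cell m z) x * u x\<bar>) * (LINT x|lborel. \<bar>\<phi> x\<bar>)
      + (real CARD('n) * (1 / real m) * ((1 + A) * (2 * (1 / real m)) powr (real CARD('n) - real CARD('n) / p))
        / (1 - real CARD('n) / p)) * (LINT x|lborel. norm (grad \<phi> x))"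
    (is "?v * _ \<le> ?S + ?C * ?I")
proof -
  have n: "real CARD('n) \<ge> 1" using zero_less_card_finite[where 'a = 'n] by linarith
  have [measurable]: "u \<in> borel_measurable borel" "\<phi> \<in> borel_measurable borel"
    using u test_functions_borel[OF \<phi>] by auto
  note \<phi>i = test_functions_integrable[OF \<phi>]
  obtain B where B: "\<And>x. \<bar>\<phi> x\<bar> \<le> B" using test_functions_bounded[OF \<phi>] by metis
  have B0: "0 \<le> B" using order_trans[OF abs_ge_zero B] .
  define a b where "a z = (LINT x|lborel. indicator (cell m z) x * u x)"
    and "b z = (LINT x|lborel. indicator (cell m z) x * \<phi> x)" for z :: "'n \<Rightarrow> int"
  define h where "h x = ?v * \<phi> x - b (cell_index m x)" for x
  have b_le: "\<bar>b z\<bar> \<le> (LINT x|lborel. \<bar>\<phi> x\<bar>)" for z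
    unfolding b_def
    by (rule integral_abs_bound_integral[OF integrable_indicator_times[OF \<phi>i] integrable_abs[OF \<phi>i]])
      (auto simp: indicator_def)
  have uh: "u x * h x = ?v * (u x * \<phi> x) - (\<Sum>z\<in>cell_indices m R. (indicator (cell m z) x * u x) * b z)" for x
  proof (cases "x \<in> cball 0 R")
    case True
    have "(\<Sum>z\<in>cell_indices m R. (indicator (cell m z) x * u x) * b z)
        = (\<Sum>z\<in>cell_indices m R. if z = cell_index m x then u x * b z else 0)"
      by (intro sum.cong) (auto simp: cell_def indicator_def)
    also have "\<dots> = u x * b (cell_index m x)"
      by (subst sum.delta[OF finite_cell_indices]) (simp add: cell_index_in[OF True])
    finally show ?thesis by (simp add: h_def algebra_simps)
  qed (simp add: u0)
  have i1: "integrable lborel (\<lambda>x. u x * \<phi> x)"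
  proof (rule Bochner_Integration.integrable_bound[of _ "\<lambda>x. B * u x"])
    show "AE x in lborel. norm (u x * \<phi> x) \<le> norm (B * u x)"
      using B B0 by (auto intro!: AE_I2 mult_left_mono simp: abs_mult mult.commute[of B])
  qed (use u in auto)
  have i2: "integrable lborel (\<lambda>x. \<Sum>z\<in>cell_indices m R. (indicator (cell m z) x * u x) * b z)"
    using u by (intro Bochner_Integration.integrable_sum integrable_mult_left integrable_indicator_times) auto
  have i3: "integrable lborel (\<lambda>x. u x * h x)" unfolding uh using i1 i2 by auto
  have int_uh: "(LINT x|lborel. u x * h x) = ?v * (LINT x|lborel. u x * \<phi> x) - (\<Sum>z\<in>cell_indices m R. a z * b z)"
  proof -
    have "(LINT x|lborel. (\<Sum>z\<in>cell_indices m R. (indicator (cell m z) x * u x) * b z)) = (\<Sum>z\<in>cell_indices m R. a z * b z)"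
      using u by (subst Bochner_Integration.integral_sum)
        (auto simp: a_def intro!: integrable_mult_left integrable_indicator_times)
    then show ?thesis unfolding uh using i1 i2 by simp
  qed
  have "ennreal \<bar>LINT x|lborel. u x * h x\<bar> \<le> (\<integral>\<^sup>+x. ennreal \<bar>u x * h x\<bar> \<partial>lborel)"
    using integral_norm_bound_ennreal[OF i3] by simp
  also have "\<dots> \<le> (\<integral>\<^sup>+x. (\<integral>\<^sup>+y. ennreal \<bar>u x\<bar> * (indicator (cube x (1 / real m)) y * ennreal \<bar>\<phi> x - \<phi> y\<bar>) \<partial>lborel) \<partial>lborel)"
  proof (rule nn_integral_mono)
    fix x :: "real^'n"
    let ?Q = "cell m (cell_index m x)"
    have [measurable]: "cube x r \<in> sets borel" for r by (simp add: cube_eq_cbox)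
    have c: "integrable lborel (\<lambda>y. indicator ?Q y * \<phi> x)"
      using emeasure_cell[OF m, of "cell_index m x"] by (intro integrable_mult_left) simp
    have i4: "integrable lborel (\<lambda>y. indicator ?Q y * (\<phi> x - \<phi> y))"
      using Bochner_Integration.integrable_diff[OF c integrable_indicator_times[OF \<phi>i], of ?Q]
      by (simp add: right_diff_distrib)
    have "h x = (LINT y|lborel. indicator ?Q y * (\<phi> x - \<phi> y))"
      using c integrable_indicator_times[OF \<phi>i, of ?Q] measure_cell[OF m, of "cell_index m x"]
      by (simp add: right_diff_distrib h_def b_def)
    then have "ennreal \<bar>h x\<bar> \<le> (\<integral>\<^sup>+y. ennreal \<bar>indicator ?Q y * (\<phi> x - \<phi> y)\<bar> \<partial>lborel)"
      using integral_norm_bound_ennreal[OF i4] by simp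
    also have "\<dots> \<le> (\<integral>\<^sup>+y. indicator (cube x (1 / real m)) y * ennreal \<bar>\<phi> x - \<phi> y\<bar> \<partial>lborel)"
    proof (rule nn_integral_mono)
      fix y
      show "ennreal \<bar>indicator ?Q y * (\<phi> x - \<phi> y)\<bar> \<le> indicator (cube x (1 / real m)) y * ennreal \<bar>\<phi> x - \<phi> y\<bar>"
        using cell_subset_cube[OF m, of x "cell_index m x" y] by (auto simp: indicator_def cell_def)
    qed
    finally have "ennreal \<bar>u x\<bar> * ennreal \<bar>h x\<bar>
      \<le> ennreal \<bar>u x\<bar> * (\<integral>\<^sup>+y. indicator (cube x (1 / real m)) y * ennreal \<bar>\<phi> x - \<phi> y\<bar> \<partial>lborel)"
      by (rule mult_left_mono) simp
    also have "\<dots> = (\<integral>\<^sup>+y. ennreal \<bar>u x\<bar> * (indicator (cube x (1 / real m)) y * ennreal \<bar>\<phi> x - \<phi> y\<bar>) \<partial>lborel)"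
      by (intro nn_integral_cmult[symmetric]) measurable
    finally show "ennreal \<bar>u x * h x\<bar>
      \<le> (\<integral>\<^sup>+y. ennreal \<bar>u x\<bar> * (indicator (cube x (1 / real m)) y * ennreal \<bar>\<phi> x - \<phi> y\<bar>) \<partial>lborel)"
      by (simp add: abs_mult ennreal_mult')
  qed
  also have "\<dots> \<le> ennreal ?C * (\<integral>\<^sup>+x. ennreal (norm (grad \<phi> x)) \<partial>lborel)"
    using m by (intro kernel_estimate[OF _ A p _ \<phi>]) auto
  also have "\<dots> = ennreal ?C * ennreal ?I"
    by (subst nn_integral_eq_integral) (auto intro: test_functions_grad_integrable[OF \<phi>])
  also have "\<dots> = ennreal (?C * ?I)"
    by (rule ennreal_mult''[symmetric]) simp
  finally have "\<bar>LINT x|lborel. u x * h x\<bar> \<le> ?C * ?I"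
  proof (subst (asm) ennreal_le_iff)
    have "0 \<le> ?C" using p n A(2) by (auto intro!: divide_nonneg_nonneg mult_nonneg_nonneg)
    then show "0 \<le> ?C * ?I" by (rule mult_nonneg_nonneg) simp
  qed
  moreover have "\<bar>\<Sum>z\<in>cell_indices m R. a z * b z\<bar> \<le> ?S"
  proof -
    have "\<bar>\<Sum>z\<in>cell_indices m R. a z * b z\<bar> \<le> (\<Sum>z\<in>cell_indices m R. \<bar>a z\<bar> * (LINT x|lborel. \<bar>\<phi> x\<bar>))"
      by (rule order_trans[OF sum_abs]) (auto intro!: sum_mono mult_left_mono b_le simp: abs_mult)
    then show ?thesis by (simp add: a_def sum_distrib_right)
  qed
  moreover have "\<bar>?v * (LINT x|lborel. u x * \<phi> x)\<bar> = ?v * \<bar>LINT x|lborel. u x * \<phi> x\<bar>"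
    by (simp add: abs_mult)
  ultimately show ?thesis using int_uh by linarith
qed

lemma poincare_real:
  fixes \<phi> :: "real^'n \<Rightarrow> real"
  assumes \<phi>: "\<phi> \<in> test_functions \<Omega>" and \<Omega>: "\<Omega> \<subseteq> cball 0 R" and R: "R \<ge> 0"
  shows "(LINT x|lborel. \<bar>\<phi> x\<bar>) \<le> (2 * R + 1) * (LINT x|lborel. norm (grad \<phi> x))"
proof -
  have "ennreal (LINT x|lborel. \<bar>\<phi> x\<bar>) = (\<integral>\<^sup>+x. ennreal \<bar>\<phi> x\<bar> \<partial>lborel)"
    using test_functions_integrable[OF \<phi>] by (intro nn_integral_eq_integral[symmetric]) auto
  also have "\<dots> \<le> ennreal (2 * R + 1) * (\<integral>\<^sup>+x. ennreal (norm (grad \<phi> x)) \<partial>lborel)"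
    by (rule poincare[OF \<phi> \<Omega> R])
  also have "\<dots> = ennreal ((2 * R + 1) * (LINT x|lborel. norm (grad \<phi> x)))"
    using R by (subst nn_integral_eq_integral) (auto simp: ennreal_mult intro: test_functions_grad_integrable[OF \<phi>])
  finally show ?thesis
    using R by (subst (asm) ennreal_le_iff) auto
qed

text \<open>The index k is chosen before \<phi>, so this is convergence in a dual norm. First m is
  fixed such that the oscillation inside cells costs at most half of e; for this m only finitely
  many cell integrals remain, and they tend to 0 together.\<close>

lemma weak_convergence_dual_bound:
  fixes u :: "nat \<Rightarrow> real^'n \<Rightarrow> real"
  assumes u: "\<And>k. integrable lborel (u k)" and u0: "\<And>k x. x \<notin> cball 0 R \<Longrightarrow> u k x = 0"
    and A: "\<And>k. (\<integral>\<^sup>+x. ennreal (\<bar>u k x\<bar> powr p) \<partial>lborel) \<le> ennreal A" "A \<ge> 0"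
    and p: "p > real CARD('n)" and \<Omega>: "\<Omega> \<subseteq> cball 0 R" and R: "R \<ge> 0"
    and lim: "\<And>m z. m > 0 \<Longrightarrow> (\<lambda>k. LINT x|lborel. indicator (cell m z) x * u k x) \<longlonglongrightarrow> 0"
    and e: "e > 0"
  shows "\<forall>\<^sub>F k in sequentially. \<forall>\<phi>\<in>test_functions \<Omega>.
    \<bar>LINT x|lborel. u k x * \<phi> x\<bar> \<le> e * (LINT x|lborel. norm (grad \<phi> x))"
proof -
  define n where "n = real CARD('n)"
  have n: "n \<ge> 1" unfolding n_def using zero_less_card_finite[where 'a = 'n] by linarith
  have np: "n / p < 1" using p n by (simp add: n_def)
  define c where "c = n * (1 + A) * 2 powr (n - n / p) / (1 - n / p)"
  define C where "C m = n * (1 / real m) * ((1 + A) * (2 * (1 / real m)) powr (n - n / p)) / (1 - n / p)" for m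
  \<comment> \<open>The cell volume is split off because it also multiplies the integral to be
    bounded; the remaining factor decays like m^(n/p - 1).\<close>
  have C_eq: "C m = (1 / real m) ^ CARD('n) * (c * real m powr (n / p - 1))" if m: "m > 0" for m
  proof -
    have e1: "(2 * (1 / real m)) powr (n - n / p) = 2 powr (n - n / p) * real m powr (n / p - n)"
    proof -
      have "(1 / real m) powr (n - n / p) = real m powr (- (n - n / p))"
        using m by (simp only: powr_minus_divide) (simp add: powr_divide)
      then show ?thesis using m by (subst powr_mult) simp_all
    qed
    have e2: "(1 / real m) * real m powr (n / p - n) = real m powr (- n) * real m powr (n / p - 1)"
    proof -
      have inv: "1 / real m = real m powr (-1)" using m by (simp add: powr_minus_divide)
      show ?thesis unfolding inv powr_add[symmetric] by (simp add: algebra_simps)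
    qed
    have e3: "real m powr (- n) = (1 / real m) ^ CARD('n)"
      using m by (simp add: n_def powr_minus powr_realpow inverse_eq_divide power_one_over)
    have "C m = n * (1 + A) * 2 powr (n - n / p) * ((1 / real m) * real m powr (n / p - n)) / (1 - n / p)"
      unfolding C_def e1 by (simp add: mult_ac)
    then show ?thesis unfolding e2 e3 c_def by (simp add: mult_ac)
  qed
  have "(\<lambda>m. c * real m powr (n / p - 1)) \<longlonglongrightarrow> c * 0"
    using np by (intro tendsto_intros tendsto_neg_powr filterlim_real_sequentially) auto
  then have "\<forall>\<^sub>F m in sequentially. c * real m powr (n / p - 1) < e / 2"
    using e by (intro order_tendstoD(2)) auto
  then have "\<forall>\<^sub>F m in sequentially. m > 0 \<and> c * real m powr (n / p - 1) < e / 2"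
    using eventually_gt_at_top[of 0] by eventually_elim auto
  then obtain m where m: "m > 0" and m2: "c * real m powr (n / p - 1) < e / 2"
    by (auto simp: eventually_sequentially)
  define v where "v = (1 / real m) ^ CARD('n)"
  have v: "v > 0" using m by (simp add: v_def)
  define s where "s k = (\<Sum>z\<in>cell_indices m R. \<bar>LINT x|lborel. indicator (cell m z) x * u k x\<bar>)" for k
  have "s \<longlonglongrightarrow> (\<Sum>z\<in>(cell_indices m R :: ('n \<Rightarrow> int) set). \<bar>0\<bar>)"
    unfolding s_def by (intro tendsto_intros lim m)
  \<comment> \<open>The factor 2 R + 1 is the Poincare constant that turns the L^1 norm of \<phi>
    into that of its gradient.\<close>
  then have "\<forall>\<^sub>F k in sequentially. s k < v * (e / 2) / (2 * R + 1)"
    using e v R by (intro order_tendstoD(2)) auto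
  then show ?thesis
  proof eventually_elim
    case (elim k)
    show ?case
    proof
      fix \<phi> assume \<phi>: "\<phi> \<in> test_functions \<Omega>"
      let ?I = "LINT x|lborel. norm (grad \<phi> x)"
      have I: "?I \<ge> 0" by simp
      have "s k \<ge> 0" unfolding s_def by (intro sum_nonneg) auto
      have "v * \<bar>LINT x|lborel. u k x * \<phi> x\<bar> \<le> s k * (LINT x|lborel. \<bar>\<phi> x\<bar>) + C m * ?I"
        unfolding v_def s_def C_def n_def by (rule cell_estimate[OF u u0 A p m \<phi>])
      also have "s k * (LINT x|lborel. \<bar>\<phi> x\<bar>) \<le> s k * ((2 * R + 1) * ?I)"
        by (intro mult_left_mono poincare_real[OF \<phi> \<Omega> R]) fact
      also have "\<dots> = (s k * (2 * R + 1)) * ?I" by simp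
      also have "\<dots> \<le> (v * (e / 2)) * ?I"
        using elim R I by (intro mult_right_mono) (auto simp: field_simps)
      also have "C m * ?I \<le> (v * (e / 2)) * ?I"
        unfolding C_eq[OF m] v_def[symmetric] using m2 v I
        by (intro mult_right_mono mult_left_mono) auto
      finally have "v * \<bar>LINT x|lborel. u k x * \<phi> x\<bar> \<le> v * (e * ?I)"
        by (simp add: algebra_simps)
      then show "\<bar>LINT x|lborel. u k x * \<phi> x\<bar> \<le> e * ?I"
        using v by simp
    qed
  qed
qed

section \<open>Weak compactness in L^2\<close>

text \<open>Dyadic convex combinations of the tail from k on. Midpoints suffice for the
  parallelogram identity, and a convex bound on the tail carries over to the hull by an induction
  that treats just two functions.\<close>

inductive_set midpoint_hull :: "(nat \<Rightarrow> 'a \<Rightarrow> real) \<Rightarrow> nat \<Rightarrow> ('a \<Rightarrow> real) set" for u k where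
  "j \<ge> k \<Longrightarrow> u j \<in> midpoint_hull u k"
| "f \<in> midpoint_hull u k \<Longrightarrow> g \<in> midpoint_hull u k \<Longrightarrow> (\<lambda>x. (f x + g x) / 2) \<in> midpoint_hull u k"

lemma midpoint_hull_antimono:
  assumes "k \<le> l" and "f \<in> midpoint_hull u l"
  shows "f \<in> midpoint_hull u k"
  using assms(2) by induction (use assms(1) in \<open>auto intro: midpoint_hull.intros\<close>)

lemma integrable_square_combination:
  fixes f g :: "'a \<Rightarrow> real"
  assumes [measurable]: "f \<in> borel_measurable M" "g \<in> borel_measurable M"
    and f: "integrable M (\<lambda>x. (f x)\<^sup>2)" and g: "integrable M (\<lambda>x. (g x)\<^sup>2)"
  shows "integrable M (\<lambda>x. ((f x + g x) / 2)\<^sup>2)" "integrable M (\<lambda>x. (f x - g x)\<^sup>2)"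
    "(LINT x|M. (f x - g x)\<^sup>2) = 2 * (LINT x|M. (f x)\<^sup>2) + 2 * (LINT x|M. (g x)\<^sup>2)
      - 4 * (LINT x|M. ((f x + g x) / 2)\<^sup>2)"
proof -
  have b': "integrable M (\<lambda>x. 2 * ((f x)\<^sup>2 + (g x)\<^sup>2))" using f g by auto
  have le: "((f x + g x) / 2)\<^sup>2 \<le> 2 * ((f x)\<^sup>2 + (g x)\<^sup>2)" "(f x - g x)\<^sup>2 \<le> 2 * ((f x)\<^sup>2 + (g x)\<^sup>2)" for x
  proof -
    have "0 \<le> (f x - g x)\<^sup>2" "0 \<le> (f x + g x)\<^sup>2" by simp_all
    then have "(f x + g x)\<^sup>2 \<le> 2 * ((f x)\<^sup>2 + (g x)\<^sup>2)" "(f x - g x)\<^sup>2 \<le> 2 * ((f x)\<^sup>2 + (g x)\<^sup>2)"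
      by (simp_all add: power2_sum power2_diff)
    moreover have "((f x + g x) / 2)\<^sup>2 \<le> (f x + g x)\<^sup>2" by (simp add: power_divide)
    ultimately show "((f x + g x) / 2)\<^sup>2 \<le> 2 * ((f x)\<^sup>2 + (g x)\<^sup>2)" "(f x - g x)\<^sup>2 \<le> 2 * ((f x)\<^sup>2 + (g x)\<^sup>2)"
      by linarith+
  qed
  show i1: "integrable M (\<lambda>x. ((f x + g x) / 2)\<^sup>2)"
    by (rule Bochner_Integration.integrable_bound[OF b']) (use le(1) in \<open>auto simp del: power_divide\<close>)
  show i2: "integrable M (\<lambda>x. (f x - g x)\<^sup>2)"
    by (rule Bochner_Integration.integrable_bound[OF b']) (use le(2) in auto)
  have "(f x - g x)\<^sup>2 = 2 * (f x)\<^sup>2 + 2 * (g x)\<^sup>2 - 4 * ((f x + g x) / 2)\<^sup>2" for x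
    by (simp add: power2_eq_square field_simps)
  then show "(LINT x|M. (f x - g x)\<^sup>2) = 2 * (LINT x|M. (f x)\<^sup>2) + 2 * (LINT x|M. (g x)\<^sup>2)
      - 4 * (LINT x|M. ((f x + g x) / 2)\<^sup>2)"
    using f g i1 by simp
qed

text \<open>A form of the Cauchy-Schwarz inequality with free parameter, integrated from |f| \<le> s
  + f^2 / s. Choosing s = (1/2)^k turns a squared norm of (1/4)^k into an L^1 norm of order
  (1/2)^k.\<close>

lemma (in finite_measure) L1_le_L2:
  fixes f :: "'a \<Rightarrow> real"
  assumes [measurable]: "f \<in> borel_measurable M" and f: "integrable M (\<lambda>x. (f x)\<^sup>2)" and s: "s > 0"
  shows "integrable M f" "(LINT x|M. \<bar>f x\<bar>) \<le> s * measure M (space M) + (LINT x|M. (f x)\<^sup>2) / s"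
proof -
  have i: "integrable M (\<lambda>x. s + (f x)\<^sup>2 / s)" using f by auto
  have le: "\<bar>f x\<bar> \<le> s + (f x)\<^sup>2 / s" for x
  proof (cases "\<bar>f x\<bar> \<le> s")
    case False
    then have "\<bar>f x\<bar> * s \<le> \<bar>f x\<bar> * \<bar>f x\<bar>" by (intro mult_left_mono) auto
    then have "\<bar>f x\<bar> \<le> (f x)\<^sup>2 / s" using s by (simp add: pos_le_divide_eq power2_eq_square)
    then show ?thesis using s by simp
  qed (use s in \<open>simp add: add_increasing2\<close>)
  show f1: "integrable M f"
  proof (rule Bochner_Integration.integrable_bound[OF i])
    show "AE x in M. norm (f x) \<le> norm (s + (f x)\<^sup>2 / s)"
      using order_trans[OF le abs_ge_self] by (intro AE_I2) simp
  qed simp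
  have "(LINT x|M. \<bar>f x\<bar>) \<le> (LINT x|M. s + (f x)\<^sup>2 / s)"
    using f1 le by (intro integral_mono i) auto
  also have "\<dots> = s * measure M (space M) + (LINT x|M. (f x)\<^sup>2) / s"
    using f by (simp add: mult.commute)
  finally show "(LINT x|M. \<bar>f x\<bar>) \<le> s * measure M (space M) + (LINT x|M. (f x)\<^sup>2) / s" .
qed

text \<open>Completeness of L^1 at a geometric rate: the sum of the consecutive differences has
  finite integral, so the sequence converges almost everywhere, and Fatou's lemma carries the rate
  to the limit. Both modes of convergence hold for the same w, along the whole sequence.\<close>

lemma (in finite_measure) convergent_L1_rapid:
  fixes v :: "nat \<Rightarrow> 'a \<Rightarrow> real"
  assumes v: "\<And>k. integrable M (v k)" and c: "c \<ge> 0"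
    and cauchy: "\<And>k l. k \<le> l \<Longrightarrow> (LINT x|M. \<bar>v k x - v l x\<bar>) \<le> c * (1 / 2) ^ k"
  obtains w where "integrable M w" "AE x in M. (\<lambda>k. v k x) \<longlonglongrightarrow> w x"
    "(\<lambda>k. LINT x|M. \<bar>v k x - w x\<bar>) \<longlonglongrightarrow> 0"
proof -
  have [measurable]: "v k \<in> borel_measurable M" for k using v by auto
  have nn: "(\<integral>\<^sup>+x. ennreal \<bar>v k x - v l x\<bar> \<partial>M) \<le> ennreal (c * (1 / 2) ^ k)" if "k \<le> l" for k l
    using cauchy[OF that] v by (subst nn_integral_eq_integral) (auto intro: ennreal_leI)
  have "(\<integral>\<^sup>+x. (\<Sum>k. ennreal \<bar>v k x - v (Suc k) x\<bar>) \<partial>M) = (\<Sum>k. \<integral>\<^sup>+x. ennreal \<bar>v k x - v (Suc k) x\<bar> \<partial>M)"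
    by (rule nn_integral_suminf) auto
  also have "\<dots> \<le> (\<Sum>k. ennreal (c * (1 / 2) ^ k))"
    by (intro suminf_le nn) auto
  also have "\<dots> = ennreal (\<Sum>k. c * (1 / 2) ^ k)"
    using c by (intro suminf_ennreal2 summable_mult summable_geometric) auto
  finally have "(\<integral>\<^sup>+x. (\<Sum>k. ennreal \<bar>v k x - v (Suc k) x\<bar>) \<partial>M) \<noteq> \<infinity>"
    by (auto simp: top_unique)
  then have "AE x in M. (\<Sum>k. ennreal \<bar>v k x - v (Suc k) x\<bar>) \<noteq> \<infinity>"
    by (intro nn_integral_noteq_infinite) auto
  then have conv: "AE x in M. convergent (\<lambda>k. v k x)"
  proof eventually_elim
    case (elim x)
    then have "summable (\<lambda>k. \<bar>v k x - v (Suc k) x\<bar>)"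
      by (intro summable_suminf_not_top) auto
    then have "summable (\<lambda>k. v k x - v (Suc k) x)" by (rule summable_rabs_cancel)
    then have "(\<lambda>n. \<Sum>k<n. v k x - v (Suc k) x) \<longlonglongrightarrow> (\<Sum>k. v k x - v (Suc k) x)"
      by (rule summable_LIMSEQ)
    then have "(\<lambda>n. v 0 x - v n x) \<longlonglongrightarrow> (\<Sum>k. v k x - v (Suc k) x)"
      by (simp only: sum_lessThan_telescope'[of "\<lambda>k. v k x"])
    then have "(\<lambda>n. v 0 x - (v 0 x - v n x)) \<longlonglongrightarrow> v 0 x - (\<Sum>k. v k x - v (Suc k) x)"
      by (intro tendsto_intros)
    then show ?case by (auto simp: convergent_def)
  qed
  define w where "w x = lim (\<lambda>k. v k x)" for x
  have [measurable]: "w \<in> borel_measurable M" unfolding w_def by measurable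
  have lim: "AE x in M. (\<lambda>k. v k x) \<longlonglongrightarrow> w x"
    using conv by eventually_elim (simp add: w_def convergent_LIMSEQ_iff)
  have bd: "(\<integral>\<^sup>+x. ennreal \<bar>v k x - w x\<bar> \<partial>M) \<le> ennreal (c * (1 / 2) ^ k)" for k
  proof -
    have "(\<integral>\<^sup>+x. ennreal \<bar>v k x - w x\<bar> \<partial>M) = (\<integral>\<^sup>+x. liminf (\<lambda>l. ennreal \<bar>v k x - v l x\<bar>) \<partial>M)"
    proof (rule nn_integral_cong_AE, use lim in eventually_elim)
      case (elim x)
      then have "(\<lambda>l. ennreal \<bar>v k x - v l x\<bar>) \<longlonglongrightarrow> ennreal \<bar>v k x - w x\<bar>"
        by (intro tendsto_intros tendsto_ennrealI)
      then show ?case by (rule lim_imp_Liminf[OF trivial_limit_sequentially, symmetric])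
    qed
    also have "\<dots> \<le> liminf (\<lambda>l. \<integral>\<^sup>+x. ennreal \<bar>v k x - v l x\<bar> \<partial>M)"
      by (rule nn_integral_liminf) auto
    also have "\<dots> \<le> ennreal (c * (1 / 2) ^ k)"
      by (intro Liminf_le eventually_mono[OF eventually_ge_at_top[of k]] nn) auto
    finally show ?thesis .
  qed
  have i: "integrable M (\<lambda>x. v 0 x - w x)"
    using bd[of 0] by (intro integrableI_bounded) (auto simp: le_less_trans)
  have wi: "integrable M w" using Bochner_Integration.integrable_diff[OF v[of 0] i] by simp
  have le: "(LINT x|M. \<bar>v k x - w x\<bar>) \<le> c * (1 / 2) ^ k" for k
  proof -
    have "integrable M (\<lambda>x. \<bar>v k x - w x\<bar>)" using v wi by auto
    then have "ennreal (LINT x|M. \<bar>v k x - w x\<bar>) = (\<integral>\<^sup>+x. ennreal \<bar>v k x - w x\<bar> \<partial>M)"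
      by (intro nn_integral_eq_integral[symmetric]) auto
    then have "ennreal (LINT x|M. \<bar>v k x - w x\<bar>) \<le> ennreal (c * (1 / 2) ^ k)"
      using bd[of k] by (simp only:)
    then show ?thesis using c by (subst (asm) ennreal_le_iff) auto
  qed
  have "(\<lambda>k. c * (1 / 2) ^ k) \<longlonglongrightarrow> c * 0"
    by (intro tendsto_mult tendsto_const LIMSEQ_power_zero) simp
  then have "(\<lambda>k. c * (1 / 2) ^ k) \<longlonglongrightarrow> 0" by simp
  then have "(\<lambda>k. LINT x|M. \<bar>v k x - w x\<bar>) \<longlonglongrightarrow> 0"
    by (rule tendsto_sandwich[OF _ _ tendsto_const, rotated 2]) (simp_all add: le)
  then show ?thesis by (rule that[OF wi lim])
qed

text \<open>By the parallelogram identity, almost minimizers of the norm on the hulls of the tails form a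
  Cauchy sequence.\<close>

lemma (in finite_measure) mazur_L2:
  fixes u :: "nat \<Rightarrow> 'a \<Rightarrow> real"
  assumes um: "\<And>k. u k \<in> borel_measurable M" and u2: "\<And>k. integrable M (\<lambda>x. (u k x)\<^sup>2)"
    and uB: "\<And>k. (LINT x|M. (u k x)\<^sup>2) \<le> B"
  obtains v w where "\<And>k. v k \<in> midpoint_hull u k" "integrable M w"
    "AE x in M. (\<lambda>k. v k x) \<longlonglongrightarrow> w x" "(\<lambda>k. LINT x|M. \<bar>v k x - w x\<bar>) \<longlonglongrightarrow> 0"
proof -
  define N where "N f = (LINT x|M. (f x)\<^sup>2)" for f :: "'a \<Rightarrow> real"
  have hull: "f \<in> borel_measurable M \<and> integrable M (\<lambda>x. (f x)\<^sup>2) \<and> N f \<le> B"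
    if "f \<in> midpoint_hull u k" for f k
    using that
  proof induction
    case (1 j)
    then show ?case using um u2 uB by (simp add: N_def)
  next
    case (2 f g)
    have "0 \<le> (LINT x|M. (f x - g x)\<^sup>2)" by simp
    then have "0 \<le> 2 * N f + 2 * N g - 4 * N (\<lambda>x. (f x + g x) / 2)"
      using integrable_square_combination(3)[of f M g] 2 unfolding N_def by simp
    then show ?case
      using 2 integrable_square_combination(1)[of f M g] by auto
  qed
  define d where "d k = (INF f\<in>midpoint_hull u k. N f)" for k
  have bdd: "bdd_below (N ` midpoint_hull u k)" for k
    by (rule bdd_belowI[of _ 0]) (auto simp: N_def)
  have ne: "midpoint_hull u k \<noteq> {}" for k using midpoint_hull.intros(1)[of k k u] by auto
  have d_le: "d k \<le> N f" if "f \<in> midpoint_hull u k" for f k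
    unfolding d_def using bdd that by (rule cINF_lower)
  have "incseq d"
    unfolding incseq_def d_def
    by (intro allI impI cINF_superset_mono ne bdd) (auto intro: midpoint_hull_antimono)
  moreover have "d k \<le> B" for k using ne[of k] d_le hull by (meson ex_in_conv order_trans)
  ultimately obtain L where L: "d \<longlonglongrightarrow> L" "\<And>k. d k \<le> L"
    using incseq_convergent[of d B] by auto
  have "\<exists>f\<in>midpoint_hull u k. N f < d k + 1 / real (Suc k)" for k
    using cINF_less_iff[OF ne bdd, of k "d k + 1 / real (Suc k)"] unfolding d_def by auto
  then obtain f where f: "\<And>k. f k \<in> midpoint_hull u k" "\<And>k. N (f k) < d k + 1 / real (Suc k)"
    by metis
  have fm: "f k \<in> borel_measurable M" "integrable M (\<lambda>x. (f k x)\<^sup>2)" for k using hull[OF f(1)] by auto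
  \<comment> \<open>The parallelogram identity gives 2 (d k + a) + 2 (L + a) - 4 d k with a = 1 / (k
    + 1): two almost minimizers, and a midpoint that still lies in the hull from k and so has value
    at least d k.\<close>
  define \<epsilon> where "\<epsilon> k = 2 * (L - d k) + 4 * (1 / real (Suc k))" for k
  have cauchy: "(LINT x|M. (f k x - f l x)\<^sup>2) \<le> \<epsilon> k" if "k \<le> l" for k l
  proof -
    have "(\<lambda>x. (f k x + f l x) / 2) \<in> midpoint_hull u k"
      by (rule midpoint_hull.intros(2)[OF f(1) midpoint_hull_antimono[OF that f(1)]])
    then have "d k \<le> N (\<lambda>x. (f k x + f l x) / 2)" by (rule d_le)
    moreover have "1 / real (Suc l) \<le> 1 / real (Suc k)" using that by (simp add: frac_le)
    moreover have "x \<le> 2 * (L - dk) + 4 * a"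
      if "dk \<le> C" "b \<le> a" "x = 2 * A + 2 * B - 4 * C" "A < dk + a" "B < dl + b" "dl \<le> L"
      for x A B C a b dk dl :: real
      using that by argo
    ultimately show ?thesis
      unfolding N_def \<epsilon>_def
      using integrable_square_combination(3)[OF fm(1) fm(1) fm(2) fm(2), of k l]
        f(2)[of k, unfolded N_def] f(2)[of l, unfolded N_def] L(2)[of l] by blast
  qed
  have "(\<lambda>k. 2 * (L - d k) + 4 * (1 / real (Suc k))) \<longlonglongrightarrow> 2 * (L - L) + 4 * 0"
    by (intro tendsto_intros L LIMSEQ_Suc lim_1_over_n)
  then have "\<epsilon> \<longlonglongrightarrow> 0" by (simp add: \<epsilon>_def[abs_def])
  then have "\<exists>n. \<forall>j\<ge>n. \<epsilon> j < (1 / 4) ^ k" for k :: nat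
    using order_tendstoD(2)[of \<epsilon> 0 sequentially "(1 / 4) ^ k"] by (auto simp: eventually_sequentially)
  then obtain n where n: "\<And>k j. j \<ge> n k \<Longrightarrow> \<epsilon> j < (1 / 4) ^ k" by metis
  \<comment> \<open>Summing the thresholds makes r monotone with r k \<ge> n k. The summand k keeps
    the selected function in the hull of the tail from k.\<close>
  define r where "r k = k + (\<Sum>i\<le>k. n i)" for k
  have r_mono: "r k \<le> r l" if "k \<le> l" for k l
    unfolding r_def using that by (intro add_mono sum_mono2) auto
  have r_n: "n k \<le> r k" for k
    unfolding r_def using member_le_sum[of k "{..k}" n] by auto
  define v where "v k = f (r k)" for k
  have v1: "v k \<in> midpoint_hull u k" for k
    unfolding v_def by (rule midpoint_hull_antimono[OF _ f(1)]) (simp add: r_def)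
  have v2: "integrable M (v k)" for k
    unfolding v_def using L1_le_L2(1)[OF fm zero_less_one] .
  have v3: "(LINT x|M. \<bar>v k x - v l x\<bar>) \<le> (measure M (space M) + 1) * (1 / 2) ^ k" if "k \<le> l" for k l
  proof -
    have [measurable]: "v k \<in> borel_measurable M" for k using fm(1) by (simp add: v_def)
    have "(LINT x|M. (v k x - v l x)\<^sup>2) \<le> (1 / 4) ^ k"
      unfolding v_def using cauchy[OF r_mono[OF that]] n[OF r_n, of k] by linarith
    then have "(LINT x|M. (v k x - v l x)\<^sup>2) / (1 / 2) ^ k \<le> (1 / 4) ^ k / (1 / 2) ^ k"
      by (rule divide_right_mono) simp
    also have "\<dots> = (1 / 2) ^ k" by (simp add: power_divide[symmetric])
    finally have "(LINT x|M. (v k x - v l x)\<^sup>2) / (1 / 2) ^ k \<le> (1 / 2) ^ k" .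
    moreover have "(LINT x|M. \<bar>v k x - v l x\<bar>)
        \<le> (1 / 2) ^ k * measure M (space M) + (LINT x|M. (v k x - v l x)\<^sup>2) / (1 / 2) ^ k"
      using integrable_square_combination(2)[OF fm(1) fm(1) fm(2) fm(2)]
      by (intro L1_le_L2(2)) (auto simp: v_def fm(1) intro!: borel_measurable_diff)
    ultimately show ?thesis by (simp add: algebra_simps)
  qed
  have "0 \<le> measure M (space M) + 1" by simp
  from convergent_L1_rapid[OF v2 this v3] obtain w where w: "integrable M w"
    "AE x in M. (\<lambda>k. v k x) \<longlonglongrightarrow> w x" "(\<lambda>k. LINT x|M. \<bar>v k x - w x\<bar>) \<longlonglongrightarrow> 0"
    by blast
  show ?thesis by (rule that[OF v1 w])
qed

lemma diagonal_convergent: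
  fixes c :: "'i::countable \<Rightarrow> nat \<Rightarrow> real"
  assumes "\<And>i k. \<bar>c i k\<bar> \<le> B i"
  obtains r where "strict_mono r" "\<And>i. convergent (\<lambda>k. c i (r k))"
proof -
  interpret subseqs "\<lambda>n s. convergent (\<lambda>k. c (from_nat n) (s k))"
  proof
    fix n and s :: "nat \<Rightarrow> nat"
    have "seq_compact (cball (0::real) (B (from_nat n)))"
      by (intro compact_imp_seq_compact compact_cball)
    moreover have "\<forall>k. c (from_nat n) (s k) \<in> cball 0 (B (from_nat n))" using assms by simp
    ultimately obtain l r where "strict_mono r" "((\<lambda>k. c (from_nat n) (s k)) \<circ> r) \<longlonglongrightarrow> l"
      by (rule seq_compactE)
    then show "\<exists>r. strict_mono r \<and> convergent (\<lambda>k. c (from_nat n) ((s \<circ> r) k))"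
      unfolding convergent_def o_def by blast
  qed
  have "convergent (\<lambda>k. c i (diagseq k))" for i
  proof -
    have "convergent (\<lambda>k. c (from_nat (to_nat i)) ((diagseq \<circ> (+) (Suc (to_nat i))) k))"
    proof (rule diagseq_holds)
      fix r s :: "nat \<Rightarrow> nat" and n
      assume "strict_mono r" "convergent (\<lambda>k. c (from_nat n) (s k))"
      then show "convergent (\<lambda>k. c (from_nat n) ((s \<circ> r) k))"
        using convergent_subseq_convergent[of "\<lambda>k. c (from_nat n) (s k)" r] by (simp add: o_def)
    qed
    then have "convergent (\<lambda>k. c i (diagseq (k + Suc (to_nat i))))"
      by (simp add: o_def add.commute)
    then obtain l where "(\<lambda>k. c i (diagseq (k + Suc (to_nat i)))) \<longlonglongrightarrow> l"
      by (rule convergentD[elim_format]) blast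
    then have "(\<lambda>k. c i (diagseq k)) \<longlonglongrightarrow> l" by (rule LIMSEQ_offset)
    then show ?thesis by (rule convergentI)
  qed
  then show ?thesis using that subseq_diagseq by blast
qed

section \<open>Stability of the state equation\<close>

definition flux :: "'a::real_inner \<Rightarrow> 'a" where
  "flux q = (1 / sqrt (1 + (norm q)\<^sup>2)) *\<^sub>R q"

lemma norm_flux_le: "norm (flux q) \<le> 1"
proof -
  have "norm q \<le> sqrt (1 + (norm q)\<^sup>2)" by (rule real_le_rsqrt) simp
  moreover have "sqrt (1 + (norm q)\<^sup>2) > 0" by (simp add: add_pos_nonneg)
  ultimately show ?thesis by (simp add: flux_def)
qed

lemma flux_borel [measurable]: "(flux :: real^'n \<Rightarrow> real^'n) \<in> borel_measurable borel"
proof (rule borel_measurable_continuous_onI)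
  have "sqrt (1 + (norm q)\<^sup>2) \<noteq> 0" for q :: "real^'n"
    by (metis add_pos_nonneg less_irrefl real_sqrt_eq_0_iff zero_le_power2 zero_less_one)
  then show "continuous_on UNIV (flux :: real^'n \<Rightarrow> real^'n)"
    unfolding flux_def by (intro continuous_intros) auto
qed

text \<open>Only q is bounded; p is arbitrary. With D = |p - q| the product is bounded below by a
  multiple of D^2 / (1 + D), which is only linear for large D. Replacing it by a multiple of D - e
  gives a bound that integrates directly to an L^1 norm.\<close>

lemma flux_monotone:
  fixes p q :: "'a::real_inner"
  assumes q: "norm q \<le> M" and e: "e > 0"
  shows "(flux p - flux q) \<bullet> (p - q) \<ge> e / (2 * sqrt (1 + M\<^sup>2) ^ 3 * (1 + e)) * (norm (p - q) - e)"
proof -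
  define P Q K D c where "P = sqrt (1 + (norm p)\<^sup>2)" and "Q = sqrt (1 + (norm q)\<^sup>2)"
    and "K = sqrt (1 + M\<^sup>2)" and "D = norm (p - q)" and "c = p \<bullet> q"
  have sq: "P\<^sup>2 = 1 + (norm p)\<^sup>2" "Q\<^sup>2 = 1 + (norm q)\<^sup>2"
    by (simp_all add: P_def Q_def add_nonneg_nonneg)
  have P1: "P \<ge> 1" and Q1: "Q \<ge> 1" by (simp_all add: P_def Q_def)
  have D0: "D \<ge> 0" by (simp add: D_def)
  have QK: "Q \<le> K"
    unfolding Q_def K_def using q by (intro real_sqrt_le_mono add_left_mono power_mono) auto
  have D2: "D\<^sup>2 = (norm p)\<^sup>2 + (norm q)\<^sup>2 - 2 * c"
    by (simp add: D_def c_def power2_norm_eq_inner inner_simps inner_commute)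
  have lhs: "(flux p - flux q) \<bullet> (p - q) = (P + Q) * (P * Q - 1 - c) / (P * Q)"
  proof -
    have "(flux p - flux q) \<bullet> (p - q) = (norm p)\<^sup>2 / P - c / P - c / Q + (norm q)\<^sup>2 / Q"
    proof -
      have "flux p = (1 / P) *\<^sub>R p" "flux q = (1 / Q) *\<^sub>R q"
        by (simp_all add: flux_def P_def Q_def)
      then show ?thesis
        by (simp add: inner_simps c_def power2_norm_eq_inner inner_commute diff_divide_distrib)
    qed
    also have "\<dots> = (P\<^sup>2 - 1 - c) / P + (Q\<^sup>2 - 1 - c) / Q"
      by (simp add: sq diff_divide_distrib)
    also have "\<dots> = (P + Q) * (P * Q - 1 - c) / (P * Q)"
      using P1 Q1 by (simp add: field_simps power2_eq_square)
    finally show ?thesis .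
  qed
  have "c\<^sup>2 \<le> (norm p)\<^sup>2 * (norm q)\<^sup>2"
    using Cauchy_Schwarz_ineq[of p q] by (simp add: c_def power2_norm_eq_inner)
  \<comment> \<open>The product on the right is P^2 Q^2 - (1 + c)^2, which equals D^2 plus the
    Cauchy-Schwarz defect of p and q. Since its second factor is at most 2 P Q, this bounds P Q - 1
    - c from below.\<close>
  then have key: "D\<^sup>2 \<le> (P * Q - 1 - c) * (P * Q + 1 + c)"
  proof -
    assume "c\<^sup>2 \<le> (norm p)\<^sup>2 * (norm q)\<^sup>2"
    moreover have "(P * Q - 1 - c) * (P * Q + 1 + c) = P\<^sup>2 * Q\<^sup>2 - (1 + c)\<^sup>2"
      by (simp add: power2_eq_square algebra_simps)
    moreover have "P\<^sup>2 * Q\<^sup>2 - (1 + c)\<^sup>2 = D\<^sup>2 + ((norm p)\<^sup>2 * (norm q)\<^sup>2 - c\<^sup>2)"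
      unfolding sq D2 by (simp add: power2_eq_square algebra_simps)
    ultimately show ?thesis by linarith
  qed
  have c_le: "1 + c \<le> P * Q"
  proof (rule power2_le_imp_le)
    have "(P * Q - 1 - c) * (P * Q + 1 + c) = (P * Q)\<^sup>2 - (1 + c)\<^sup>2"
      by (simp add: power2_eq_square algebra_simps)
    then show "(1 + c)\<^sup>2 \<le> (P * Q)\<^sup>2" using key zero_le_power2[of D] by linarith
    show "0 \<le> P * Q" using P1 Q1 by simp
  qed
  have "(P * Q - 1 - c) * (P * Q + 1 + c) \<le> (P * Q - 1 - c) * (2 * (P * Q))"
    using c_le by (intro mult_left_mono) auto
  then have "D\<^sup>2 \<le> (P * Q - 1 - c) * (2 * (P * Q))" using key by linarith
  then have "D\<^sup>2 / (2 * (P * Q)) \<le> P * Q - 1 - c"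
    using P1 Q1 by (simp add: pos_divide_le_eq)
  then have "(P + Q) * (D\<^sup>2 / (2 * (P * Q))) / (P * Q) \<le> (flux p - flux q) \<bullet> (p - q)"
    unfolding lhs using P1 Q1 by (intro divide_right_mono mult_left_mono) auto
  moreover have "P * (D\<^sup>2 / (2 * (P * Q))) / (P * Q) \<le> (P + Q) * (D\<^sup>2 / (2 * (P * Q))) / (P * Q)"
    using P1 Q1 by (intro divide_right_mono mult_right_mono) auto
  moreover have "P * (D\<^sup>2 / (2 * (P * Q))) / (P * Q) = D\<^sup>2 / (2 * P * Q\<^sup>2)"
    using P1 Q1 by (simp add: power2_eq_square field_simps)
  ultimately have l1: "D\<^sup>2 / (2 * P * Q\<^sup>2) \<le> (flux p - flux q) \<bullet> (p - q)" by simp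
  \<comment> \<open>P is the one quantity that K does not bound. It grows at most linearly in D,
    which leaves D^2 / (1 + D).\<close>
  have "P \<le> Q + D"
  proof (rule power2_le_imp_le)
    have "norm p \<le> norm q + D" unfolding D_def using norm_triangle_ineq[of q "p - q"] by simp
    then have "(norm p)\<^sup>2 \<le> (norm q + D)\<^sup>2" by (rule power_mono) simp
    moreover have "norm q \<le> Q" unfolding Q_def by (rule real_le_rsqrt) simp
    then have "norm q * D \<le> Q * D" using D0 by (rule mult_right_mono)
    ultimately show "P\<^sup>2 \<le> (Q + D)\<^sup>2" using sq by (simp add: power2_sum)
  qed (use Q1 D0 in simp)
  also have "\<dots> \<le> Q * (1 + D)" using Q1 D0 mult_right_mono[of 1 Q D] by (simp add: algebra_simps)
  also have "\<dots> \<le> K * (1 + D)" using QK D0 by (intro mult_right_mono) auto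
  finally have "P * Q\<^sup>2 \<le> (K * (1 + D)) * K\<^sup>2"
    using QK Q1 P1 D0 by (intro mult_mono power_mono) auto
  moreover have "2 * K ^ 3 * (1 + D) = 2 * ((K * (1 + D)) * K\<^sup>2)"
    by (simp add: power2_eq_square power3_eq_cube)
  ultimately have le: "2 * P * Q\<^sup>2 \<le> 2 * K ^ 3 * (1 + D)" by linarith
  have "0 < 2 * P * Q\<^sup>2" using P1 Q1 by simp
  then have "D\<^sup>2 / (2 * K ^ 3 * (1 + D)) \<le> D\<^sup>2 / (2 * P * Q\<^sup>2)"
    by (rule frac_le[OF zero_le_power2 order_refl _ le])
  moreover have "e / (2 * K ^ 3 * (1 + e)) * (D - e) \<le> D\<^sup>2 / (2 * K ^ 3 * (1 + D))"
  proof -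
    \<comment> \<open>This sum of nonnegative terms equals D^2 (1 + e) - e (D - e) (1 + D).\<close>
    have "0 \<le> (D - e / 2)\<^sup>2 + 3 / 4 * e\<^sup>2 + e\<^sup>2 * D" using D0 by simp
    then have "e * (D - e) * (1 + D) \<le> D\<^sup>2 * (1 + e)"
      by (simp add: power2_eq_square algebra_simps)
    then have "e * (D - e) / (1 + e) \<le> D\<^sup>2 / (1 + D)"
      using e D0 by (simp add: divide_simps mult_ac)
    then have "e * (D - e) / (1 + e) / (2 * K ^ 3) \<le> D\<^sup>2 / (1 + D) / (2 * K ^ 3)"
      using QK Q1 by (intro divide_right_mono) auto
    then show ?thesis by (simp add: mult_ac)
  qed
  ultimately show ?thesis using l1 unfolding K_def D_def by linarith
qed

section \<open>Representatives of weak gradients and of functions with zero trace\<close>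

lemma Lp_infinity_AE_bounded:
  assumes "f \<in> Lp \<Omega> \<infinity>"
  obtains M where "M \<ge> 0" "AE x in lebesgue_on \<Omega>. \<bar>f x\<bar> \<le> M" "f \<in> borel_measurable (lebesgue_on \<Omega>)"
proof -
  define E where "E = esssup (lebesgue_on \<Omega>) (\<lambda>x. ennreal \<bar>f x\<bar>)"
  have E: "E < \<infinity>" and m: "f \<in> borel_measurable (lebesgue_on \<Omega>)"
    using assms by (auto simp: Lp_def E_def)
  have "AE x in lebesgue_on \<Omega>. ennreal \<bar>f x\<bar> \<le> E" unfolding E_def by (rule esssup_AE)
  then have "AE x in lebesgue_on \<Omega>. \<bar>f x\<bar> \<le> enn2real E"
  proof eventually_elim
    case (elim x)
    then show ?case using enn2real_mono[OF elim] E by simp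
  qed
  then show ?thesis using that[of "enn2real E"] m by simp
qed

text \<open>A Borel representative of some bounded weak derivative is clamped, so that its bound
  holds everywhere. As \<open>weak_deriv\<close> is a \<open>SOME\<close> choice, uniqueness of weak
  derivatives is what links it to this representative.\<close>

lemma W1inf_weak_deriv:
  fixes y :: "real^'n \<Rightarrow> real"
  assumes "open \<Omega>" and y: "y \<in> Sobolev \<Omega> 1 \<infinity>"
  shows "has_weak_deriv \<Omega> [i] y (weak_deriv \<Omega> [i] y)"
    and "\<exists>G\<in>borel_measurable borel. \<exists>M. (\<forall>x. \<bar>G x\<bar> \<le> M) \<and> (\<forall>x. x \<notin> \<Omega> \<longrightarrow> G x = 0) \<and>
      (AE x in lebesgue_on \<Omega>. weak_deriv \<Omega> [i] y x = G x)"
proof -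
  obtain g where g: "g \<in> Lp \<Omega> \<infinity>" "has_weak_deriv \<Omega> [i] y g"
  proof -
    have "length [i] \<le> 1 \<longrightarrow> (\<exists>g\<in>Lp \<Omega> \<infinity>. has_weak_deriv \<Omega> [i] y g)"
      using y unfolding Sobolev_def by blast
    then show ?thesis using that by auto
  qed
  show w: "has_weak_deriv \<Omega> [i] y (weak_deriv \<Omega> [i] y)"
    unfolding weak_deriv_def by (rule someI[of "has_weak_deriv \<Omega> [i] y", OF g(2)])
  obtain M where M: "M \<ge> 0" "AE x in lebesgue_on \<Omega>. \<bar>g x\<bar> \<le> M" and m: "g \<in> borel_measurable (lebesgue_on \<Omega>)"
    using Lp_infinity_AE_bounded[OF g(1)] by metis
  obtain h where h [measurable]: "h \<in> borel_measurable borel" and h0: "\<And>x. x \<notin> \<Omega> \<Longrightarrow> h x = 0"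
    and hg: "AE x in lebesgue_on \<Omega>. g x = h x"
    using lebesgue_on_borel_rep[OF \<open>open \<Omega>\<close> m] by metis
  define G where "G x = max (- M) (min M (h x))" for x
  have "G \<in> borel_measurable borel" unfolding G_def by measurable
  moreover have "\<bar>G x\<bar> \<le> M" for x using M(1) by (auto simp: G_def)
  moreover have "G x = 0" if "x \<notin> \<Omega>" for x using h0[OF that] M(1) by (simp add: G_def)
  moreover have "AE x in lebesgue_on \<Omega>. weak_deriv \<Omega> [i] y x = G x"
    using hg M(2) has_weak_deriv_unique[OF \<open>open \<Omega>\<close> w g(2)] by eventually_elim (auto simp: G_def)
  ultimately show "\<exists>G\<in>borel_measurable borel. \<exists>M. (\<forall>x. \<bar>G x\<bar> \<le> M) \<and> (\<forall>x. x \<notin> \<Omega> \<longrightarrow> G x = 0) \<and>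
      (AE x in lebesgue_on \<Omega>. weak_deriv \<Omega> [i] y x = G x)" by blast
qed

lemma W1inf_weak_grad:
  fixes y :: "real^'n \<Rightarrow> real"
  assumes "open \<Omega>" and y: "y \<in> Sobolev \<Omega> 1 \<infinity>"
  obtains G :: "real^'n \<Rightarrow> real^'n" and M where "G \<in> borel_measurable borel" "\<And>x. norm (G x) \<le> M"
    "\<And>x. x \<notin> \<Omega> \<Longrightarrow> G x = 0" "AE x in lebesgue_on \<Omega>. weak_grad \<Omega> y x = G x"
proof -
  obtain g M where g: "\<And>i. g i \<in> borel_measurable borel" "\<And>i x. \<bar>g i x\<bar> \<le> M i"
    "\<And>i x. x \<notin> \<Omega> \<Longrightarrow> g i x = 0" "\<And>i. AE x in lebesgue_on \<Omega>. weak_deriv \<Omega> [i] y x = g i x"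
    using W1inf_weak_deriv(2)[OF assms] by metis
  define G where "G x = (\<chi> i. g i x)" for x
  have "G \<in> borel_measurable borel"
    unfolding G_def using g(1)
    by (subst borel_measurable_euclidean_space) (auto simp: Basis_vec_def inner_axis)
  moreover have "norm (G x) \<le> (\<Sum>i\<in>UNIV. M i)" for x
    using norm_le_l1_cart[of "G x"] sum_mono[of UNIV "\<lambda>i. \<bar>g i x\<bar>" M] g(2) by (force simp: G_def)
  moreover have "G x = 0" if "x \<notin> \<Omega>" for x using g(3)[OF that] by (simp add: G_def vec_eq_iff)
  moreover have "AE x in lebesgue_on \<Omega>. \<forall>i\<in>UNIV. weak_deriv \<Omega> [i] y x = g i x"
    by (rule AE_finite_allI) (use g(4) in auto)
  then have "AE x in lebesgue_on \<Omega>. weak_grad \<Omega> y x = G x"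
    by eventually_elim (simp add: weak_grad_def G_def)
  ultimately show ?thesis using that by blast
qed

text \<open>The closure and the complement of \<Omega> are closed and meet in the frontier, where F
  vanishes, so extension by zero is continuous.\<close>

lemma zero_trace_extension:
  assumes "open \<Omega>" and f: "f \<in> W1inf_zero_trace \<Omega>"
  obtains W where "continuous_on UNIV W" "\<And>x. x \<notin> \<Omega> \<Longrightarrow> W x = 0" "AE x in lebesgue_on \<Omega>. f x = W x"
proof -
  obtain F where F: "continuous_on (closure \<Omega>) F" "AE x in lebesgue_on \<Omega>. F x = f x"
    "\<And>x. x \<in> frontier \<Omega> \<Longrightarrow> F x = 0"
    using f by (auto simp: W1inf_zero_trace_def has_trace_def)
  define W where "W x = (if x \<in> \<Omega> then F x else 0)" for x
  have "continuous_on (closure \<Omega> \<union> - \<Omega>) W"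
    unfolding W_def
  proof (rule continuous_on_cases)
    show "\<forall>x. x \<in> closure \<Omega> \<and> x \<notin> \<Omega> \<or> x \<in> - \<Omega> \<and> x \<in> \<Omega> \<longrightarrow> F x = 0"
      using F(3) \<open>open \<Omega>\<close> by (auto simp: frontier_def interior_open)
  qed (use F(1) \<open>open \<Omega>\<close> in auto)
  moreover have "closure \<Omega> \<union> - \<Omega> = UNIV" using closure_subset by blast
  moreover have "AE x in lebesgue_on \<Omega>. f x = W x"
    using F(2) \<open>open \<Omega>\<close> by (auto simp: AE_lebesgue_on_iff W_def elim!: eventually_mono)
  ultimately show ?thesis using that[of W] by (simp add: W_def)
qed

lemma lebesgue_on_integral_rep:
  fixes f g :: "'a::euclidean_space \<Rightarrow> real"
  assumes "open \<Omega>" and f: "integrable (lebesgue_on \<Omega>) f"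
    and g: "g \<in> borel_measurable borel" "\<And>x. x \<notin> \<Omega> \<Longrightarrow> g x = 0" and eq: "AE x in lebesgue_on \<Omega>. f x = g x"
  shows "(LINT x|lebesgue_on \<Omega>. f x) = (LINT x|lborel. g x)" "integrable lborel g"
proof -
  have "g \<in> borel_measurable lebesgue" using g(1) by (intro measurable_completion) simp
  then have m: "g \<in> borel_measurable (lebesgue_on \<Omega>)" by (rule measurable_restrict_space1)
  have "(LINT x|lebesgue_on \<Omega>. f x) = (LINT x|lebesgue_on \<Omega>. g x)"
    using f m eq by (intro integral_cong_AE) auto
  then show "(LINT x|lebesgue_on \<Omega>. f x) = (LINT x|lborel. g x)"
    using integral_lebesgue_on_borel(1)[OF \<open>open \<Omega>\<close> g] by simp
  have "integrable (lebesgue_on \<Omega>) g"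
    using f m eq by (subst integrable_cong_AE[of g _ f]) auto
  then show "integrable lborel g" using integral_lebesgue_on_borel(2)[OF \<open>open \<Omega>\<close> g] by simp
qed

lemma state_eq_rep:
  fixes y u ub :: "real^'n \<Rightarrow> real" and G :: "real^'n \<Rightarrow> real^'n"
  assumes "open \<Omega>" and eq: "solves_state_eq \<Omega> u y"
    and G [measurable]: "G \<in> borel_measurable borel" and Gy: "AE x in lebesgue_on \<Omega>. weak_grad \<Omega> y x = G x"
    and ub [measurable]: "ub \<in> borel_measurable borel" and uub: "AE x in lebesgue_on \<Omega>. u x = ub x"
    and \<phi>: "\<phi> \<in> test_functions \<Omega>"
  shows "integrable lborel (\<lambda>x. flux (G x) \<bullet> grad \<phi> x)" "integrable lborel (\<lambda>x. ub x * \<phi> x)"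
    "(LINT x|lborel. flux (G x) \<bullet> grad \<phi> x) = (LINT x|lborel. ub x * \<phi> x)"
proof -
  let ?F = "\<lambda>x. (1 / Qop \<Omega> y x) *\<^sub>R weak_grad \<Omega> y x"
  have [measurable]: "grad \<phi> \<in> borel_measurable borel" "\<phi> \<in> borel_measurable borel"
    by (rule test_functions_grad_borel[OF \<phi>] test_functions_borel[OF \<phi>])+
  have F: "\<And>i. loc_integrable \<Omega> (\<lambda>x. ?F x $ i)" "loc_integrable \<Omega> (\<lambda>x. - u x)"
    and weak: "(LINT x|lebesgue_on \<Omega>. ?F x \<bullet> grad \<phi> x) = - (LINT x|lebesgue_on \<Omega>. - u x * \<phi> x)"
    using eq \<phi> unfolding solves_state_eq_def has_weak_div_def grad_def[symmetric] by blast+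
  have "integrable (lebesgue_on \<Omega>) (\<lambda>x. \<Sum>i\<in>UNIV. ?F x $ i * partial_deriv i \<phi> x)"
    by (intro Bochner_Integration.integrable_sum loc_integrable_times_test[OF \<open>open \<Omega>\<close> F(1)]
        partial_deriv_test_functions \<phi>)
  then have i1: "integrable (lebesgue_on \<Omega>) (\<lambda>x. ?F x \<bullet> grad \<phi> x)"
    by (simp add: inner_vec_def grad_def)
  have i2: "integrable (lebesgue_on \<Omega>) (\<lambda>x. u x * \<phi> x)"
    using loc_integrable_times_test[OF \<open>open \<Omega>\<close> F(2) \<phi>] by simp
  have ae: "AE x in lebesgue_on \<Omega>. ?F x \<bullet> grad \<phi> x = flux (G x) \<bullet> grad \<phi> x"
    using Gy by eventually_elim (simp add: flux_def Qop_def)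
  have ae2: "AE x in lebesgue_on \<Omega>. u x * \<phi> x = ub x * \<phi> x"
    using uub by eventually_elim simp
  have z: "flux (G x) \<bullet> grad \<phi> x = 0" "ub x * \<phi> x = 0" if "x \<notin> \<Omega>" for x
    using test_functions_grad_zero[OF \<phi> that] test_functions_zero[OF \<phi> that] by auto
  have m: "(\<lambda>x. flux (G x) \<bullet> grad \<phi> x) \<in> borel_measurable borel" "(\<lambda>x. ub x * \<phi> x) \<in> borel_measurable borel"
    by measurable
  note r1 = lebesgue_on_integral_rep[OF \<open>open \<Omega>\<close> i1 m(1) z(1) ae]
  note r2 = lebesgue_on_integral_rep[OF \<open>open \<Omega>\<close> i2 m(2) z(2) ae2]
  show "integrable lborel (\<lambda>x. flux (G x) \<bullet> grad \<phi> x)" by (rule r1(2))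
  show "integrable lborel (\<lambda>x. ub x * \<phi> x)" by (rule r2(2))
  show "(LINT x|lborel. flux (G x) \<bullet> grad \<phi> x) = (LINT x|lborel. ub x * \<phi> x)"
    using weak r1(1) r2(1) by simp
qed

lemma continuous_support_integrable:
  fixes W :: "'a::euclidean_space \<Rightarrow> real"
  assumes W: "continuous_on UNIV W" and z: "\<And>x. x \<notin> cball 0 R \<Longrightarrow> W x = 0"
  shows "integrable lborel W"
proof -
  have "integrable lborel (\<lambda>x. indicator (cball 0 R) x *\<^sub>R W x)"
    by (intro borel_integrable_compact) (auto intro: continuous_on_subset[OF W])
  moreover have "indicator (cball 0 R) x *\<^sub>R W x = W x" for x
    using z[of x] by (cases "x \<in> cball 0 R") (simp_all del: mem_cball)
  ultimately show ?thesis by (simp only:)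
qed

lemma norm_vec_integral_le:
  fixes f :: "real^'n \<Rightarrow> real^'n"
  assumes "\<And>i. integrable lborel (\<lambda>x. f x $ i)" and [measurable]: "f \<in> borel_measurable borel"
    and "\<And>i. (LINT x|lborel. \<bar>f x $ i\<bar>) \<le> e"
  shows "integrable lborel (\<lambda>x. norm (f x))" "(LINT x|lborel. norm (f x)) \<le> real CARD('n) * e"
proof -
  have i: "integrable lborel (\<lambda>x. \<Sum>i\<in>UNIV. \<bar>f x $ i\<bar>)"
    by (intro Bochner_Integration.integrable_sum integrable_abs assms(1))
  show n: "integrable lborel (\<lambda>x. norm (f x))"
    by (rule Bochner_Integration.integrable_bound[OF i])
      (use norm_le_l1_cart in \<open>auto intro!: AE_I2 order_trans[OF norm_le_l1_cart]\<close>)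
  have "(LINT x|lborel. norm (f x)) \<le> (LINT x|lborel. (\<Sum>i\<in>UNIV. \<bar>f x $ i\<bar>))"
    by (intro integral_mono n i norm_le_l1_cart)
  also have "\<dots> = (\<Sum>i\<in>UNIV. LINT x|lborel. \<bar>f x $ i\<bar>)"
    by (intro Bochner_Integration.integral_sum integrable_abs assms(1))
  also have "\<dots> \<le> (\<Sum>i\<in>(UNIV::'n set). e)" by (intro sum_mono assms(3))
  finally show "(LINT x|lborel. norm (f x)) \<le> real CARD('n) * e" by simp
qed

text \<open>The gradient is cut off where \<^term>\<open>W\<close> vanishes. It does vanish almost everywhere there, but
  this fact is never needed.\<close>

lemma test_limit_bounds:
  fixes W :: "real^'n \<Rightarrow> real" and g H :: "real^'n \<Rightarrow> real^'n"
  assumes "open \<Omega>" and \<Omega>R: "\<Omega> \<subseteq> cball 0 R" and R: "R \<ge> 0"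
    and W: "continuous_on UNIV W" and W0: "\<And>x. x \<notin> \<Omega> \<Longrightarrow> W x = 0"
    and g [measurable]: "g \<in> borel_measurable borel"
    and gM: "\<And>x. norm (g x) \<le> M" and g0: "\<And>x. x \<notin> \<Omega> \<Longrightarrow> g x = 0"
    and weak: "\<And>\<psi> i. \<psi> \<in> test_functions \<Omega> \<Longrightarrow>
      (LINT z|lborel. W z * partial_deriv i \<psi> z) = - (LINT z|lborel. g z $ i * \<psi> z)"
    and H [measurable]: "H \<in> borel_measurable borel" and H2: "\<And>x. norm (H x) \<le> 2"
    and \<delta>: "\<delta> \<ge> 0"
    and bound: "\<And>\<phi>. \<phi> \<in> test_functions \<Omega> \<Longrightarrow>
      \<bar>LINT x|lborel. H x \<bullet> grad \<phi> x\<bar> \<le> \<delta> * (LINT x|lborel. norm (grad \<phi> x))"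
  defines "g' \<equiv> \<lambda>x. if W x \<noteq> 0 then g x else 0"
  shows "integrable lborel (\<lambda>x. norm (g' x))" "integrable lborel (\<lambda>x. H x \<bullet> g' x)"
    "\<bar>LINT x|lborel. H x \<bullet> g' x\<bar> \<le> \<delta> * (LINT x|lborel. norm (g' x))"
    "(LINT x|lborel. \<bar>W x\<bar>) \<le> (2 * R + 1) * (LINT x|lborel. norm (g' x))"
proof -
  define n where "n = real CARD('n)"
  have n: "n \<ge> 1" unfolding n_def using zero_less_card_finite[where 'a = 'n] by linarith
  have [measurable]: "W \<in> borel_measurable borel" by (rule borel_measurable_continuous_onI[OF W])
  have nth [measurable]: "(\<lambda>x::real^'n. x $ i) \<in> borel_measurable borel" for i
    by (intro borel_measurable_continuous_onI continuous_intros)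
  have M0: "M \<ge> 0" using order_trans[OF norm_ge_zero gM] .
  have [measurable]: "g' \<in> borel_measurable borel" unfolding g'_def by measurable
  have g'M: "norm (g' x) \<le> M" for x using gM M0 by (simp add: g'_def)
  have g'0: "g' x = 0" if "x \<notin> cball 0 R" for x
  proof -
    have "x \<notin> \<Omega>" using that \<Omega>R by blast
    then show ?thesis by (simp add: g'_def g0)
  qed
  show i1: "integrable lborel (\<lambda>x. norm (g' x))"
    by (rule integrable_bounded_support[of _ M R]) (use g'M g'0 in auto)
  have Hv: "\<bar>H x \<bullet> v\<bar> \<le> 2 * norm v" for x v
    using Cauchy_Schwarz_ineq2[of "H x" v] mult_right_mono[OF H2[of x] norm_ge_zero[of v]] by linarith
  show i2: "integrable lborel (\<lambda>x. H x \<bullet> g' x)"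
    by (rule Bochner_Integration.integrable_bound[OF integrable_mult_right[OF i1, of 2]])
      (use Hv in auto)
  define I where "I = (LINT x|lborel. norm (g' x))"
  \<comment> \<open>A test function whose gradient is within e of \<open>g'\<close> in each
    component, hence within n e in L^1. As H is bounded by 2, replacing the gradient costs at most 2
    n e on the left; then e tends to 0.\<close>
  have approx: "\<bar>LINT x|lborel. H x \<bullet> g' x\<bar> \<le> \<delta> * (I + n * e) + 2 * (n * e) \<and>
      (LINT x|lborel. \<bar>W x\<bar>) \<le> (2 * R + 1) * (I + n * e) + e" if e: "e > 0" for e
  proof -
    obtain \<phi> where \<phi>: "\<phi> \<in> test_functions \<Omega>"
      and \<phi>1: "\<And>i. (LINT x|lborel. \<bar>partial_deriv i \<phi> x - (if W x \<noteq> 0 then 1 else 0) * (g x $ i)\<bar>) < e"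
      and \<phi>2: "(LINT x|lborel. \<bar>\<phi> x - W x\<bar>) < e"
    proof (rule test_approximation[OF \<open>open \<Omega>\<close> \<Omega>R W W0, where g = "\<lambda>i x. g x $ i" and M = M and e = e])
      show "\<bar>g x $ i\<bar> \<le> M" for i x using component_le_norm_cart[of "g x" i] gM[of x] by linarith
    qed (use weak e g0 in auto)
    have [measurable]: "grad \<phi> \<in> borel_measurable borel" "\<phi> \<in> borel_measurable borel"
      by (rule test_functions_grad_borel[OF \<phi>] test_functions_borel[OF \<phi>])+
    note Gi = test_functions_grad_integrable[OF \<phi>]
    let ?d = "\<lambda>x. grad \<phi> x - g' x"
    have g'i: "integrable lborel (\<lambda>x. g' x $ i)" for i
      by (rule Bochner_Integration.integrable_bound[OF i1]) (auto simp: component_le_norm_cart)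
    have di: "integrable lborel (\<lambda>x. ?d x $ i)" for i
      using g'i[of i] test_functions_integrable[OF partial_deriv_test_functions[OF \<phi>, of i]]
      by (simp add: grad_def)
    have de: "(LINT x|lborel. \<bar>?d x $ i\<bar>) \<le> e" for i
    proof -
      have "?d x $ i = partial_deriv i \<phi> x - (if W x \<noteq> 0 then 1 else 0) * (g x $ i)" for x
        by (simp add: grad_def g'_def)
      then show ?thesis using \<phi>1[of i] by simp
    qed
    have dm: "?d \<in> borel_measurable borel"
      using \<open>grad \<phi> \<in> borel_measurable borel\<close> \<open>g' \<in> borel_measurable borel\<close> by (rule borel_measurable_diff)
    note d = norm_vec_integral_le[OF di dm de, folded n_def]
    have "(LINT x|lborel. norm (grad \<phi> x)) \<le> (LINT x|lborel. norm (g' x) + norm (?d x))"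
      using norm_triangle_ineq[of "g' x" "?d x" for x] by (intro integral_mono Gi) (auto simp: i1 d(1))
    also have "\<dots> \<le> I + n * e" using i1 d by (simp add: I_def)
    finally have J: "(LINT x|lborel. norm (grad \<phi> x)) \<le> I + n * e" .
    have i3: "integrable lborel (\<lambda>x. H x \<bullet> ?d x)"
      by (rule Bochner_Integration.integrable_bound[OF integrable_mult_right[OF d(1), of 2]])
        (use Hv in auto)
    have "\<bar>LINT x|lborel. H x \<bullet> ?d x\<bar> \<le> (LINT x|lborel. 2 * norm (?d x))"
      using d(1) Hv by (intro integral_abs_bound_integral i3) auto
    also have "\<dots> \<le> 2 * (n * e)" using d(2) by simp
    finally have b1: "\<bar>LINT x|lborel. H x \<bullet> ?d x\<bar> \<le> 2 * (n * e)" .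
    have "H x \<bullet> grad \<phi> x = H x \<bullet> g' x + H x \<bullet> ?d x" for x
      by (simp add: inner_diff_right)
    then have "(LINT x|lborel. H x \<bullet> grad \<phi> x) = (LINT x|lborel. H x \<bullet> g' x) + (LINT x|lborel. H x \<bullet> ?d x)"
      using i2 i3 by simp
    moreover have "\<delta> * (LINT x|lborel. norm (grad \<phi> x)) \<le> \<delta> * (I + n * e)"
      by (rule mult_left_mono[OF J \<delta>])
    ultimately have "\<bar>LINT x|lborel. H x \<bullet> g' x\<bar> \<le> \<delta> * (I + n * e) + 2 * (n * e)"
      using bound[OF \<phi>] b1 by linarith
    moreover have "(LINT x|lborel. \<bar>W x\<bar>) \<le> (2 * R + 1) * (I + n * e) + e"
    proof -
      have Wi: "integrable lborel (\<lambda>x. \<phi> x - W x)"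
      proof -
        have "integrable lborel W"
          by (rule continuous_support_integrable[OF W]) (use W0 \<Omega>R in blast)
        then show ?thesis using test_functions_integrable[OF \<phi>] by auto
      qed
      have "(LINT x|lborel. \<bar>W x\<bar>) \<le> (LINT x|lborel. \<bar>\<phi> x\<bar> + \<bar>\<phi> x - W x\<bar>)"
        using Wi test_functions_integrable[OF \<phi>] by (intro integral_mono_AE') auto
      also have "\<dots> = (LINT x|lborel. \<bar>\<phi> x\<bar>) + (LINT x|lborel. \<bar>\<phi> x - W x\<bar>)"
        using Wi test_functions_integrable[OF \<phi>] by simp
      also have "\<dots> \<le> (2 * R + 1) * (LINT x|lborel. norm (grad \<phi> x)) + e"
        using poincare_real[OF \<phi> \<Omega>R R] \<phi>2 by linarith
      also have "\<dots> \<le> (2 * R + 1) * (I + n * e) + e"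
        using J R by (intro add_right_mono mult_left_mono) auto
      finally show ?thesis .
    qed
    ultimately show ?thesis by blast
  qed
  have lim: "((\<lambda>e. \<delta> * (I + n * e) + 2 * (n * e)) \<longlongrightarrow> \<delta> * (I + n * 0) + 2 * (n * 0)) (at_right 0)"
    "((\<lambda>e. (2 * R + 1) * (I + n * e) + e) \<longlongrightarrow> (2 * R + 1) * (I + n * 0) + 0) (at_right 0)"
    by (intro tendsto_intros)+
  have pos: "\<forall>\<^sub>F e in at_right (0::real). 0 < e" by (rule eventually_at_right_less)
  have "\<bar>LINT x|lborel. H x \<bullet> g' x\<bar> \<le> \<delta> * (I + n * 0) + 2 * (n * 0)"
    by (rule tendsto_lowerbound[OF lim(1) eventually_mono[OF pos]]) (use approx in auto)
  then show "\<bar>LINT x|lborel. H x \<bullet> g' x\<bar> \<le> \<delta> * (LINT x|lborel. norm (g' x))" by (simp add: I_def)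
  have "(LINT x|lborel. \<bar>W x\<bar>) \<le> (2 * R + 1) * (I + n * 0) + 0"
    by (rule tendsto_lowerbound[OF lim(2) eventually_mono[OF pos]]) (use approx in auto)
  then show "(LINT x|lborel. \<bar>W x\<bar>) \<le> (2 * R + 1) * (LINT x|lborel. norm (g' x))" by (simp add: I_def)
qed

text \<open>Let c be the constant of \<open>flux_monotone\<close>, m the L^1 norm of the cut off
  gradient of the difference, V the volume of the ball. Monotonicity from below and the tested
  equations from above give c (m - e V) \<le> \<delta> m, and \<delta> \<le> c / 2 yields m \<le> 2
  e V; the Poincare constant finishes. The roles are not symmetric: c depends on the gradient of y2
  alone, so y2 will be the limit state.\<close>

lemma state_difference_bound:
  fixes y1 y2 v :: "real^'n \<Rightarrow> real" and G2 :: "real^'n \<Rightarrow> real^'n"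
  assumes "open \<Omega>" and \<Omega>R: "\<Omega> \<subseteq> cball 0 R" and R: "R \<ge> 0"
    and y: "y1 \<in> Sobolev \<Omega> 1 \<infinity>" "y2 \<in> Sobolev \<Omega> 1 \<infinity>"
    and tr: "y1 - v \<in> W1inf_zero_trace \<Omega>" "y2 - v \<in> W1inf_zero_trace \<Omega>"
    and eq: "solves_state_eq \<Omega> u1 y1" "solves_state_eq \<Omega> u2 y2"
    and ub: "ub1 \<in> borel_measurable borel" "AE x in lebesgue_on \<Omega>. u1 x = ub1 x"
      "ub2 \<in> borel_measurable borel" "AE x in lebesgue_on \<Omega>. u2 x = ub2 x"
    and G2 [measurable]: "G2 \<in> borel_measurable borel" and G2M: "\<And>x. norm (G2 x) \<le> M"
    and G20: "\<And>x. x \<notin> \<Omega> \<Longrightarrow> G2 x = 0" and G2y: "AE x in lebesgue_on \<Omega>. weak_grad \<Omega> y2 x = G2 x"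
    and e: "e > 0" and \<delta>: "\<delta> \<ge> 0" "2 * \<delta> \<le> e / (2 * sqrt (1 + M\<^sup>2) ^ 3 * (1 + e))"
    and bound: "\<And>\<phi>. \<phi> \<in> test_functions \<Omega> \<Longrightarrow>
      \<bar>LINT x|lborel. (ub1 x - ub2 x) * \<phi> x\<bar> \<le> \<delta> * (LINT x|lborel. norm (grad \<phi> x))"
  shows "(LINT x|lebesgue_on \<Omega>. \<bar>y1 x - y2 x\<bar>) \<le> (2 * R + 1) * (2 * e * measure lborel (cball (0::real^'n) R))"
    "integrable (lebesgue_on \<Omega>) (\<lambda>x. y1 x - y2 x)"
proof -
  obtain G1 :: "real^'n \<Rightarrow> real^'n" and M1 where G1 [measurable]: "G1 \<in> borel_measurable borel"
    and G1M: "\<And>x. norm (G1 x) \<le> M1" and G10: "\<And>x. x \<notin> \<Omega> \<Longrightarrow> G1 x = 0"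
    and G1y: "AE x in lebesgue_on \<Omega>. weak_grad \<Omega> y1 x = G1 x"
    using W1inf_weak_grad[OF \<open>open \<Omega>\<close> y(1)] by metis
  obtain W1 where W1: "continuous_on UNIV W1" "\<And>x. x \<notin> \<Omega> \<Longrightarrow> W1 x = 0"
    "AE x in lebesgue_on \<Omega>. (y1 - v) x = W1 x"
    using zero_trace_extension[OF \<open>open \<Omega>\<close> tr(1)] by metis
  obtain W2 where W2: "continuous_on UNIV W2" "\<And>x. x \<notin> \<Omega> \<Longrightarrow> W2 x = 0"
    "AE x in lebesgue_on \<Omega>. (y2 - v) x = W2 x"
    using zero_trace_extension[OF \<open>open \<Omega>\<close> tr(2)] by metis
  define W where "W x = W1 x - W2 x" for x
  define g where "g x = G1 x - G2 x" for x
  define H where "H x = flux (G1 x) - flux (G2 x)" for x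
  have W: "continuous_on UNIV W" unfolding W_def by (intro continuous_intros W1 W2)
  have [measurable]: "W \<in> borel_measurable borel" by (rule borel_measurable_continuous_onI[OF W])
  have W0: "W x = 0" if "x \<notin> \<Omega>" for x using W1(2)[OF that] W2(2)[OF that] by (simp add: W_def)
  have Wy: "AE x in lebesgue_on \<Omega>. y1 x - y2 x = W x"
    using W1(3) W2(3) by eventually_elim (simp add: W_def)
  have [measurable]: "g \<in> borel_measurable borel" "H \<in> borel_measurable borel"
    unfolding g_def H_def by measurable
  have gM: "norm (g x) \<le> M1 + M" for x
    unfolding g_def using norm_triangle_ineq4[of "G1 x" "G2 x"] G1M[of x] G2M[of x] by linarith
  have g0: "g x = 0" if "x \<notin> \<Omega>" for x using G10[OF that] G20[OF that] by (simp add: g_def)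
  have H2: "norm (H x) \<le> 2" for x
    unfolding H_def using norm_triangle_ineq4[of "flux (G1 x)" "flux (G2 x)"]
      norm_flux_le[of "G1 x"] norm_flux_le[of "G2 x"] by linarith
  have weak: "(LINT z|lborel. W z * partial_deriv i \<psi> z) = - (LINT z|lborel. g z $ i * \<psi> z)"
    if \<psi>: "\<psi> \<in> test_functions \<Omega>" for \<psi> i
  proof -
    note d\<psi> = partial_deriv_test_functions[OF \<psi>, of i]
    have [measurable]: "\<psi> \<in> borel_measurable borel" "partial_deriv i \<psi> \<in> borel_measurable borel"
      by (rule test_functions_borel[OF \<psi>] test_functions_borel[OF d\<psi>])+
    have [measurable]: "(\<lambda>x::real^'n. x $ i) \<in> borel_measurable borel"
      by (intro borel_measurable_continuous_onI continuous_intros)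
    have wd: "has_weak_deriv \<Omega> [i] (\<lambda>x. y1 x - y2 x) (\<lambda>x. weak_deriv \<Omega> [i] y1 x - weak_deriv \<Omega> [i] y2 x)"
      by (intro has_weak_deriv_diff W1inf_weak_deriv \<open>open \<Omega>\<close> y)
    have l: "loc_integrable \<Omega> (\<lambda>x. y1 x - y2 x)"
      "loc_integrable \<Omega> (\<lambda>x. weak_deriv \<Omega> [i] y1 x - weak_deriv \<Omega> [i] y2 x)"
      and id: "(LINT x|lebesgue_on \<Omega>. (y1 x - y2 x) * partial_deriv i \<psi> x) =
        - (LINT x|lebesgue_on \<Omega>. (weak_deriv \<Omega> [i] y1 x - weak_deriv \<Omega> [i] y2 x) * \<psi> x)"
      using wd \<psi> by (auto simp: has_weak_deriv_def)
    have a1: "AE x in lebesgue_on \<Omega>. (y1 x - y2 x) * partial_deriv i \<psi> x = W x * partial_deriv i \<psi> x"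
      using Wy by eventually_elim simp
    have a2: "AE x in lebesgue_on \<Omega>. (weak_deriv \<Omega> [i] y1 x - weak_deriv \<Omega> [i] y2 x) * \<psi> x = g x $ i * \<psi> x"
      using G1y G2y by eventually_elim (simp add: weak_grad_def vec_eq_iff g_def)
    have "(LINT x|lebesgue_on \<Omega>. (y1 x - y2 x) * partial_deriv i \<psi> x) = (LINT z|lborel. W z * partial_deriv i \<psi> z)"
      by (rule lebesgue_on_integral_rep(1)[OF \<open>open \<Omega>\<close> loc_integrable_times_test[OF \<open>open \<Omega>\<close> l(1) d\<psi>] _ _ a1])
        (auto simp: W0)
    moreover have "(LINT x|lebesgue_on \<Omega>. (weak_deriv \<Omega> [i] y1 x - weak_deriv \<Omega> [i] y2 x) * \<psi> x)
        = (LINT z|lborel. g z $ i * \<psi> z)"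
      by (rule lebesgue_on_integral_rep(1)[OF \<open>open \<Omega>\<close> loc_integrable_times_test[OF \<open>open \<Omega>\<close> l(2) \<psi>] _ _ a2])
        (auto simp: g0)
    ultimately show ?thesis using id by simp
  qed
  have Hb: "\<bar>LINT x|lborel. H x \<bullet> grad \<phi> x\<bar> \<le> \<delta> * (LINT x|lborel. norm (grad \<phi> x))"
    if \<phi>: "\<phi> \<in> test_functions \<Omega>" for \<phi>
  proof -
    note r1 = state_eq_rep[OF \<open>open \<Omega>\<close> eq(1) G1 G1y ub(1,2) \<phi>]
    note r2 = state_eq_rep[OF \<open>open \<Omega>\<close> eq(2) G2 G2y ub(3,4) \<phi>]
    have "(LINT x|lborel. H x \<bullet> grad \<phi> x) = (LINT x|lborel. (ub1 x - ub2 x) * \<phi> x)"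
      using r1 r2 by (simp add: H_def inner_diff_left left_diff_distrib)
    then show ?thesis using bound[OF \<phi>] by simp
  qed
  let ?g = "\<lambda>x. if W x \<noteq> 0 then g x else 0"
  note B = test_limit_bounds[OF \<open>open \<Omega>\<close> \<Omega>R R W W0 _ gM g0 weak _ H2 \<delta>(1) Hb, simplified measurable_lborel1]
  define m where "m = (LINT x|lborel. norm (?g x))"
  define V where "V = measure lborel (cball (0::real^'n) R)"
  define c where "c = e / (2 * sqrt (1 + M\<^sup>2) ^ 3 * (1 + e))"
  have B1: "integrable lborel (\<lambda>x. norm (?g x))" and B2: "integrable lborel (\<lambda>x. H x \<bullet> ?g x)"
    and B3: "\<bar>LINT x|lborel. H x \<bullet> ?g x\<bar> \<le> \<delta> * m" and B4: "(LINT x|lborel. \<bar>W x\<bar>) \<le> (2 * R + 1) * m"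
    unfolding m_def by (rule B; measurable)+
  have m0: "m \<ge> 0" unfolding m_def by simp
  have "1 + M\<^sup>2 > 0" by (simp add: add_pos_nonneg)
  then have c: "c > 0" unfolding c_def using e by simp
  have iV: "integrable lborel (\<lambda>x. indicator (cball (0::real^'n) R) x :: real)"
    using emeasure_lborel_cball_finite[of "0::real^'n" R] by simp
  \<comment> \<open>Where W vanishes, the right side is 0 and the left side is not positive, so the
    cutoff of the gradient is harmless. The indicator keeps the error e integrable.\<close>
  have pt: "c * (norm (?g x) - e * indicator (cball 0 R) x) \<le> H x \<bullet> ?g x" for x
  proof (cases "W x \<noteq> 0")
    case True
    then have "x \<in> cball 0 R" using W0 \<Omega>R by blast
    then show ?thesis
      using flux_monotone[OF G2M[of x] e, of "G1 x"] True by (simp add: c_def H_def g_def del: mem_cball)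
  qed (use c e in \<open>auto simp: indicator_def\<close>)
  have "c * (m - e * V) = (LINT x|lborel. c * (norm (?g x) - e * indicator (cball 0 R) x))"
    using B1 iV by (simp add: m_def V_def)
  also have "\<dots> \<le> (LINT x|lborel. H x \<bullet> ?g x)"
    using B1 iV by (intro integral_mono B2 pt) auto
  also have "\<dots> \<le> \<delta> * m" using B3 by linarith
  also have "\<dots> \<le> c / 2 * m" using \<delta>(2)[folded c_def] m0 by (intro mult_right_mono) auto
  finally have "c * (m - e * V) \<le> c * (m / 2)" by simp
  then have "m \<le> 2 * e * V" using c by simp
  then have "(2 * R + 1) * m \<le> (2 * R + 1) * (2 * e * V)" using R by (intro mult_left_mono) auto
  then have fin: "(LINT x|lborel. \<bar>W x\<bar>) \<le> (2 * R + 1) * (2 * e * V)" using B4 by linarith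
  have Wl: "integrable lborel W"
    by (rule continuous_support_integrable[OF W]) (use W0 \<Omega>R in blast)
  have Wi: "integrable (lebesgue_on \<Omega>) W"
    using integral_lebesgue_on_borel(2)[OF \<open>open \<Omega>\<close> _ W0] Wl by simp
  have ym: "(\<lambda>x. y1 x - y2 x) \<in> borel_measurable (lebesgue_on \<Omega>)"
    using y by (auto simp: Sobolev_def Lp_def)
  show "integrable (lebesgue_on \<Omega>) (\<lambda>x. y1 x - y2 x)"
    using Wi Wy ym by (subst integrable_cong_AE[of _ _ W]) auto
  have "(LINT x|lebesgue_on \<Omega>. \<bar>y1 x - y2 x\<bar>) = (LINT x|lebesgue_on \<Omega>. \<bar>W x\<bar>)"
    using Wy ym Wi by (intro integral_cong_AE) (auto elim!: eventually_mono)
  also have "\<dots> = (LINT x|lborel. \<bar>W x\<bar>)"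
    by (intro integral_lebesgue_on_borel(1) \<open>open \<Omega>\<close>) (auto simp: W0)
  finally show "(LINT x|lebesgue_on \<Omega>. \<bar>y1 x - y2 x\<bar>) \<le> (2 * R + 1) * (2 * e * measure lborel (cball (0::real^'n) R))"
    using fin by (simp add: V_def)
qed

section \<open>Convex bounds on midpoint hulls and their passage to limits\<close>

lemma powr_midpoint:
  fixes a b p :: real
  assumes "p \<ge> 1"
  shows "\<bar>(a + b) / 2\<bar> powr p \<le> (\<bar>a\<bar> powr p + \<bar>b\<bar> powr p) / 2"
proof -
  have half: "(x / 2) powr p \<le> x powr p / 2" if "x \<ge> 0" for x :: real
  proof -
    have "2 powr 1 \<le> 2 powr p" using assms by (intro powr_mono) auto
    then have "x powr p / 2 powr p \<le> x powr p / 2" by (intro divide_left_mono) auto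
    then show ?thesis using that by (simp add: powr_divide)
  qed
  have "((x + y) / 2) powr p \<le> (x powr p + y powr p) / 2" if "x \<ge> 0" "y \<ge> 0" for x y :: real
  \<comment> \<open>Convexity is applied on the open half line; with a vanishing argument the claim
    is \<open>half\<close>, which holds since 2 \<le> 2 powr p.\<close>
  proof (cases "x = 0 \<or> y = 0")
    case True
    then show ?thesis using half[OF that(1)] half[OF that(2)] by auto
  next
    case False
    then have "x \<in> {0<..}" "y \<in> {0<..}" using that by auto
    from convex_onD[OF powr_convex[OF assms], OF _ _ this, of "1 / 2"] show ?thesis
      by (simp add: field_simps)
  qed
  from this[of "\<bar>a\<bar>" "\<bar>b\<bar>"]
  have "((\<bar>a\<bar> + \<bar>b\<bar>) / 2) powr p \<le> (\<bar>a\<bar> powr p + \<bar>b\<bar> powr p) / 2" by simp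
  moreover have "\<bar>(a + b) / 2\<bar> powr p \<le> ((\<bar>a\<bar> + \<bar>b\<bar>) / 2) powr p"
    using assms by (intro powr_mono2) (auto simp: abs_triangle_ineq)
  ultimately show ?thesis by linarith
qed

lemma midpoint_hull_measurable:
  assumes "f \<in> midpoint_hull u k" and "\<And>j. u j \<in> borel_measurable M"
  shows "f \<in> borel_measurable M"
  using assms(1) by induction (use assms(2) in auto)

lemma midpoint_hull_square_le:
  assumes f: "f \<in> midpoint_hull u k" and um: "\<And>j. u j \<in> borel_measurable M"
    and u2: "\<And>j. integrable M (\<lambda>x. (u j x)\<^sup>2)"
    and b: "\<And>j. j \<ge> k \<Longrightarrow> (LINT x|M. (u j x)\<^sup>2) \<le> b"
  shows "integrable M (\<lambda>x. (f x)\<^sup>2) \<and> (LINT x|M. (f x)\<^sup>2) \<le> b"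
  using f
proof induction
  case (1 j)
  then show ?case using u2 b by simp
next
  case (2 f g)
  have m: "f \<in> borel_measurable M" "g \<in> borel_measurable M"
    using 2 midpoint_hull_measurable um by blast+
  have "0 \<le> (LINT x|M. (f x - g x)\<^sup>2)" by simp
  then show ?case
    using integrable_square_combination(1,3)[of f M g] m 2 by simp
qed

lemma midpoint_hull_powr_le:
  assumes f: "f \<in> midpoint_hull u k" and um: "\<And>j. u j \<in> borel_measurable M" and p: "p \<ge> 1"
    and b: "\<And>j. (\<integral>\<^sup>+x. ennreal (\<bar>u j x\<bar> powr p) \<partial>M) \<le> ennreal b" and b0: "b \<ge> 0"
  shows "(\<integral>\<^sup>+x. ennreal (\<bar>f x\<bar> powr p) \<partial>M) \<le> ennreal b"
  using f
proof induction
  case (1 j)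
  then show ?case using b by simp
next
  case (2 f g)
  have [measurable]: "f \<in> borel_measurable M" "g \<in> borel_measurable M"
    using 2 midpoint_hull_measurable um by blast+
  have "(\<integral>\<^sup>+x. ennreal (\<bar>(f x + g x) / 2\<bar> powr p) \<partial>M)
      \<le> (\<integral>\<^sup>+x. ennreal (1 / 2) * ennreal (\<bar>f x\<bar> powr p) + ennreal (1 / 2) * ennreal (\<bar>g x\<bar> powr p) \<partial>M)"
  proof (rule nn_integral_mono)
    fix x
    have "ennreal (\<bar>(f x + g x) / 2\<bar> powr p) \<le> ennreal ((1 / 2) * \<bar>f x\<bar> powr p + (1 / 2) * \<bar>g x\<bar> powr p)"
      using powr_midpoint[OF p, of "f x" "g x"] by (intro ennreal_leI) simp
    then show "ennreal (\<bar>(f x + g x) / 2\<bar> powr p)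
        \<le> ennreal (1 / 2) * ennreal (\<bar>f x\<bar> powr p) + ennreal (1 / 2) * ennreal (\<bar>g x\<bar> powr p)"
      by (simp only: ennreal_mult'[symmetric] ennreal_plus[symmetric] powr_ge_zero zero_le_divide_1_iff
          zero_le_numeral mult_nonneg_nonneg)
  qed
  also have "\<dots> = ennreal (1 / 2) * (\<integral>\<^sup>+x. ennreal (\<bar>f x\<bar> powr p) \<partial>M)
      + ennreal (1 / 2) * (\<integral>\<^sup>+x. ennreal (\<bar>g x\<bar> powr p) \<partial>M)"
    by (subst nn_integral_add) (auto simp: nn_integral_cmult)
  also have "\<dots> \<le> ennreal (1 / 2) * ennreal b + ennreal (1 / 2) * ennreal b"
    using 2 by (intro add_mono mult_left_mono) auto
  also have "\<dots> = ennreal b"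
  proof -
    have "ennreal (1 / 2) * ennreal b + ennreal (1 / 2) * ennreal b = ennreal ((1 / 2) * b + (1 / 2) * b)"
      using b0 by (simp only: ennreal_mult'[symmetric] ennreal_plus[symmetric] zero_le_divide_1_iff
          zero_le_numeral mult_nonneg_nonneg)
    then show ?thesis by simp
  qed
  finally show ?case .
qed

lemma midpoint_hull_integral_near:
  assumes f: "f \<in> midpoint_hull u k" and u: "\<And>j. integrable M (\<lambda>x. h x * u j x)"
    and b: "\<And>j. j \<ge> k \<Longrightarrow> \<bar>(LINT x|M. h x * u j x) - c\<bar> \<le> b"
  shows "integrable M (\<lambda>x. h x * f x) \<and> \<bar>(LINT x|M. h x * f x) - c\<bar> \<le> b"
  using f
proof induction
  case (1 j)
  then show ?case using u b by simp
next
  case (2 f g)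
  have eq: "h x * ((f x + g x) / 2) = (h x * f x + h x * g x) / 2" for x by (simp add: algebra_simps)
  have "(LINT x|M. h x * ((f x + g x) / 2)) = ((LINT x|M. h x * f x) + (LINT x|M. h x * g x)) / 2"
    unfolding eq using 2 by simp
  moreover have "integrable M (\<lambda>x. h x * ((f x + g x) / 2))" unfolding eq using 2 by auto
  ultimately show ?case using 2 by (auto simp: abs_le_iff field_simps)
qed

lemma nn_integral_AE_limit_le:
  fixes f :: "nat \<Rightarrow> 'a \<Rightarrow> ennreal"
  assumes [measurable]: "\<And>k. f k \<in> borel_measurable M"
    and lim: "AE x in M. (\<lambda>k. f k x) \<longlonglongrightarrow> g x"
    and b: "\<forall>\<^sub>F k in sequentially. (\<integral>\<^sup>+x. f k x \<partial>M) \<le> b"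
  shows "(\<integral>\<^sup>+x. g x \<partial>M) \<le> b"
proof -
  have "(\<integral>\<^sup>+x. g x \<partial>M) = (\<integral>\<^sup>+x. liminf (\<lambda>k. f k x) \<partial>M)"
  proof (rule nn_integral_cong_AE, use lim in eventually_elim)
    case (elim x)
    then show ?case by (rule lim_imp_Liminf[OF trivial_limit_sequentially, symmetric])
  qed
  also have "\<dots> \<le> liminf (\<lambda>k. \<integral>\<^sup>+x. f k x \<partial>M)"
    by (rule nn_integral_liminf) auto
  also have "\<dots> \<le> b"
    by (rule Liminf_le[OF trivial_limit_sequentially b])
  finally show ?thesis .
qed

text \<open>Fatou's lemma for squares. The slack e admits sequences whose integrals approach b from
  above.\<close>

lemma square_integral_AE_limit_le:
  fixes f :: "nat \<Rightarrow> 'a \<Rightarrow> real"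
  assumes [measurable]: "\<And>k. f k \<in> borel_measurable M" "g \<in> borel_measurable M"
    and f2: "\<And>k. integrable M (\<lambda>x. (f k x)\<^sup>2)"
    and lim: "AE x in M. (\<lambda>k. f k x) \<longlonglongrightarrow> g x"
    and b: "\<And>e. e > 0 \<Longrightarrow> \<forall>\<^sub>F k in sequentially. (LINT x|M. (f k x)\<^sup>2) \<le> b + e"
  shows "integrable M (\<lambda>x. (g x)\<^sup>2)" "(LINT x|M. (g x)\<^sup>2) \<le> b"
proof -
  have le: "(\<integral>\<^sup>+x. ennreal ((g x)\<^sup>2) \<partial>M) \<le> ennreal (b + e)" if "e > 0" for e
  proof (rule nn_integral_AE_limit_le)
    show "AE x in M. (\<lambda>k. ennreal ((f k x)\<^sup>2)) \<longlonglongrightarrow> ennreal ((g x)\<^sup>2)"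
      using lim by eventually_elim (intro tendsto_ennrealI tendsto_power)
    show "\<forall>\<^sub>F k in sequentially. (\<integral>\<^sup>+x. ennreal ((f k x)\<^sup>2) \<partial>M) \<le> ennreal (b + e)"
      using b[OF that] by eventually_elim (subst nn_integral_eq_integral[OF f2], auto intro: ennreal_leI)
  qed measurable
  show i: "integrable M (\<lambda>x. (g x)\<^sup>2)"
    using le[OF zero_less_one] by (intro integrableI_bounded) (auto simp: le_less_trans)
  have "(LINT x|M. (g x)\<^sup>2) \<le> b + e" if "e > 0" for e
  proof -
    have "\<forall>\<^sub>F k in sequentially. 0 \<le> b + e"
      using b[OF that] by eventually_elim (erule order_trans[rotated], simp)
    then have "0 \<le> b + e" by simp
    moreover have "ennreal (LINT x|M. (g x)\<^sup>2) = (\<integral>\<^sup>+x. ennreal ((g x)\<^sup>2) \<partial>M)"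
      using i by (intro nn_integral_eq_integral[symmetric]) auto
    ultimately show ?thesis
      using le[OF that] by (metis ennreal_le_iff)
  qed
  then show "(LINT x|M. (g x)\<^sup>2) \<le> b" by (rule field_le_epsilon)
qed

text \<open>The limit w is that of the convex combinations from \<open>mazur_L2\<close>. The L^p
  bound and, up to any e, the L^2 bound of the tails hold on the hulls and pass to w by Fatou's
  lemma. The integrals over each E i of combinations of the tail from k have the same limit as those
  of u k, and L^1 convergence identifies it with the integral of w.\<close>

lemma (in finite_measure) weak_limit_L2:
  fixes u :: "nat \<Rightarrow> 'a \<Rightarrow> real" and E :: "'i \<Rightarrow> 'a set"
  assumes um [measurable]: "\<And>k. u k \<in> borel_measurable M" and u2: "\<And>k. integrable M (\<lambda>x. (u k x)\<^sup>2)"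
    and lim2: "(\<lambda>k. LINT x|M. (u k x)\<^sup>2) \<longlonglongrightarrow> \<beta>"
    and p: "p \<ge> 1" and up: "\<And>k. (\<integral>\<^sup>+x. ennreal (\<bar>u k x\<bar> powr p) \<partial>M) \<le> ennreal b" and b0: "b \<ge> 0"
    and E [measurable]: "\<And>i. E i \<in> sets M" and conv: "\<And>i. convergent (\<lambda>k. LINT x|M. indicator (E i) x * u k x)"
  obtains w where "w \<in> borel_measurable M" "integrable M (\<lambda>x. (w x)\<^sup>2)" "(LINT x|M. (w x)\<^sup>2) \<le> \<beta>"
    "(\<integral>\<^sup>+x. ennreal (\<bar>w x\<bar> powr p) \<partial>M) \<le> ennreal b"
    "\<And>i. (\<lambda>k. LINT x|M. indicator (E i) x * (u k x - w x)) \<longlonglongrightarrow> 0"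
proof -
  have "bounded (range (\<lambda>k. LINT x|M. (u k x)\<^sup>2))"
    using lim2 by (intro convergent_imp_bounded) (auto simp: convergent_def)
  then obtain B where "\<forall>s\<in>range (\<lambda>k. LINT x|M. (u k x)\<^sup>2). norm s \<le> B"
    unfolding bounded_iff by blast
  then have B: "(LINT x|M. (u k x)\<^sup>2) \<le> B" for k by (simp add: abs_le_iff)
  from mazur_L2[of u B, OF um u2 B]
  obtain v w where v: "\<And>k. v k \<in> midpoint_hull u k" and w: "integrable M w"
    and ae: "AE x in M. (\<lambda>k. v k x) \<longlonglongrightarrow> w x" and L1: "(\<lambda>k. LINT x|M. \<bar>v k x - w x\<bar>) \<longlonglongrightarrow> 0"
    by blast
  have wm [measurable]: "w \<in> borel_measurable M" using w by auto
  have vm [measurable]: "v k \<in> borel_measurable M" for k using midpoint_hull_measurable[OF v um] .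
  have v2: "integrable M (\<lambda>x. (v k x)\<^sup>2)" for k
    using midpoint_hull_square_le[OF v um u2 B] by blast
  have vi: "integrable M (v k)" and ui: "integrable M (u k)" for k
    using L1_le_L2(1)[OF vm v2 zero_less_one] L1_le_L2(1)[OF um u2 zero_less_one] by auto
  have "\<forall>\<^sub>F k in sequentially. (LINT x|M. (v k x)\<^sup>2) \<le> \<beta> + e" if "e > 0" for e
  proof -
    have "\<forall>\<^sub>F k in sequentially. (LINT x|M. (u k x)\<^sup>2) < \<beta> + e"
      using that by (intro order_tendstoD(2)[OF lim2]) simp
    then obtain N where N: "\<And>j. j \<ge> N \<Longrightarrow> (LINT x|M. (u j x)\<^sup>2) < \<beta> + e"
      by (auto simp: eventually_sequentially)
    have "(LINT x|M. (v k x)\<^sup>2) \<le> \<beta> + e" if "k \<ge> N" for k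
      using midpoint_hull_square_le[OF v um u2, of k "\<beta> + e"] N that by (meson less_imp_le order_trans)
    then show ?thesis by (auto simp: eventually_sequentially)
  qed
  note w2 = square_integral_AE_limit_le[OF vm wm v2 ae this]
  have wp: "(\<integral>\<^sup>+x. ennreal (\<bar>w x\<bar> powr p) \<partial>M) \<le> ennreal b"
  proof (rule nn_integral_AE_limit_le)
    show "AE x in M. (\<lambda>k. ennreal (\<bar>v k x\<bar> powr p)) \<longlonglongrightarrow> ennreal (\<bar>w x\<bar> powr p)"
      using ae
    proof eventually_elim
      case (elim x)
      have "(\<lambda>k. \<bar>v k x\<bar> powr p) \<longlonglongrightarrow> \<bar>w x\<bar> powr p"
        using p by (intro tendsto_powr' tendsto_rabs elim tendsto_const) auto
      then show ?case by (rule tendsto_ennrealI)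
    qed
    show "\<forall>\<^sub>F k in sequentially. (\<integral>\<^sup>+x. ennreal (\<bar>v k x\<bar> powr p) \<partial>M) \<le> ennreal b"
      using midpoint_hull_powr_le[OF v um p up b0] by simp
  qed measurable
  have cells: "(\<lambda>k. LINT x|M. indicator (E i) x * (u k x - w x)) \<longlonglongrightarrow> 0" for i
  proof -
    have Ei: "integrable M (\<lambda>x. indicator (E i) x * f x)" if "integrable M f" for f :: "'a \<Rightarrow> real"
      using that E by (rule integrable_indicator_times)
    obtain c where c: "(\<lambda>k. LINT x|M. indicator (E i) x * u k x) \<longlonglongrightarrow> c"
      using conv[of i] by (auto simp: convergent_def)
    have "(\<lambda>k. LINT x|M. indicator (E i) x * v k x) \<longlonglongrightarrow> c"
    proof (rule LIMSEQ_I)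
      fix e :: real assume "e > 0"
      then obtain N where N: "\<And>j. j \<ge> N \<Longrightarrow> \<bar>(LINT x|M. indicator (E i) x * u j x) - c\<bar> < e / 2"
        using LIMSEQ_D[OF c, of "e / 2"] by (auto simp: real_norm_def)
      have "\<bar>(LINT x|M. indicator (E i) x * v k x) - c\<bar> \<le> e / 2" if "k \<ge> N" for k
        using midpoint_hull_integral_near[OF v Ei[OF ui], of k c "e / 2"] N that
        by (meson less_imp_le order_trans)
      then show "\<exists>N. \<forall>k\<ge>N. norm ((LINT x|M. indicator (E i) x * v k x) - c) < e"
        using \<open>e > 0\<close> by (intro exI[of _ N]) (force simp: real_norm_def)
    qed
    moreover have "(\<lambda>k. LINT x|M. indicator (E i) x * v k x) \<longlonglongrightarrow> (LINT x|M. indicator (E i) x * w x)"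
    proof (rule Lim_transform2[OF tendsto_const], rule Lim_null_comparison[OF _ L1], intro always_eventually allI)
      fix k
      have "(LINT x|M. indicator (E i) x * w x) - (LINT x|M. indicator (E i) x * v k x)
          = (LINT x|M. indicator (E i) x * (w x - v k x))"
        using Ei[OF w] Ei[OF vi] by (simp add: right_diff_distrib)
      also have "\<bar>\<dots>\<bar> \<le> (LINT x|M. \<bar>v k x - w x\<bar>)"
      proof (rule order_trans[OF integral_abs_bound integral_mono])
        have d: "integrable M (\<lambda>x. w x - v k x)" using w vi by auto
        show "integrable M (\<lambda>x. \<bar>indicator (E i) x * (w x - v k x)\<bar>)"
          using Ei[OF d] by (rule integrable_abs)
        show "integrable M (\<lambda>x. \<bar>v k x - w x\<bar>)" using w vi by auto
        show "\<bar>indicator (E i) x * (w x - v k x)\<bar> \<le> \<bar>v k x - w x\<bar>" for x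
          by (auto simp: indicator_def)
      qed
      finally show "norm ((LINT x|M. indicator (E i) x * w x) - (LINT x|M. indicator (E i) x * v k x))
          \<le> (LINT x|M. \<bar>v k x - w x\<bar>)" by simp
    qed
    ultimately have "c = (LINT x|M. indicator (E i) x * w x)" by (rule LIMSEQ_unique)
    then have "(\<lambda>k. (LINT x|M. indicator (E i) x * u k x) - (LINT x|M. indicator (E i) x * w x)) \<longlonglongrightarrow> 0"
      using tendsto_diff[OF c tendsto_const, of c] by simp
    then show ?thesis using Ei[OF ui] Ei[OF w] by (simp add: right_diff_distrib)
  qed
  show ?thesis by (rule that[OF wm w2(1) w2(2) wp cells])
qed

section \<open>Cost and admissible controls expressed by integrals\<close>

lemma Lp_norm_2_square: "(Lp_norm \<Omega> 2 f)\<^sup>2 = (LINT x|lebesgue_on \<Omega>. (f x)\<^sup>2)"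
proof -
  have "(LINT x|lebesgue_on \<Omega>. \<bar>f x\<bar> powr enn2real 2) = (LINT x|lebesgue_on \<Omega>. (f x)\<^sup>2)"
    by (simp add: powr_numeral)
  then show ?thesis by (simp add: Lp_norm_def powr_half_sqrt)
qed

lemma Lp_2_iff: "f \<in> Lp \<Omega> 2 \<longleftrightarrow> f \<in> borel_measurable (lebesgue_on \<Omega>) \<and> integrable (lebesgue_on \<Omega>) (\<lambda>x. (f x)\<^sup>2)"
  by (simp add: Lp_def powr_numeral)

text \<open>One inequality for a nonnegative integral encodes both integrability and the norm bound.
  In this form the ball is stable under Fatou's lemma, with no default value of the Bochner integral
  to watch.\<close>

lemma Lp_norm_le_iff:
  assumes "p > 0" and "\<theta> \<ge> 0"
  shows "f \<in> Lp \<Omega> (ennreal p) \<and> Lp_norm \<Omega> (ennreal p) f \<le> \<theta> \<longleftrightarrow>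
    f \<in> borel_measurable (lebesgue_on \<Omega>) \<and>
    (\<integral>\<^sup>+x. ennreal (\<bar>f x\<bar> powr p) \<partial>lebesgue_on \<Omega>) \<le> ennreal (\<theta> powr p)"
    (is "?L \<longleftrightarrow> ?R")
proof -
  let ?M = "lebesgue_on \<Omega>"
  have norm: "Lp_norm \<Omega> (ennreal p) f = (LINT x|?M. \<bar>f x\<bar> powr p) powr (1 / p)"
    using assms by (simp add: Lp_norm_def)
  have iff: "I powr (1 / p) \<le> \<theta> \<longleftrightarrow> I \<le> \<theta> powr p" if "I \<ge> 0" for I
  proof
    assume "I powr (1 / p) \<le> \<theta>"
    then have "(I powr (1 / p)) powr p \<le> \<theta> powr p" using assms by (intro powr_mono2) auto
    then show "I \<le> \<theta> powr p" using that assms by (simp add: powr_powr)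
  next
    assume "I \<le> \<theta> powr p"
    then have "I powr (1 / p) \<le> (\<theta> powr p) powr (1 / p)" using assms that by (intro powr_mono2) auto
    then show "I powr (1 / p) \<le> \<theta>" using assms by (simp add: powr_powr)
  qed
  have int: "(\<integral>\<^sup>+x. ennreal (\<bar>f x\<bar> powr p) \<partial>?M) = ennreal (LINT x|?M. \<bar>f x\<bar> powr p)"
    if "integrable ?M (\<lambda>x. \<bar>f x\<bar> powr p)"
    using that by (intro nn_integral_eq_integral) auto
  show ?thesis
  proof
    assume ?L
    then have i: "integrable ?M (\<lambda>x. \<bar>f x\<bar> powr p)" and "f \<in> borel_measurable ?M"
      and "(LINT x|?M. \<bar>f x\<bar> powr p) \<le> \<theta> powr p"
      using assms norm iff by (auto simp: Lp_def)
    then show ?R by (simp add: int ennreal_leI)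
  next
    assume R: ?R
    then have [measurable]: "f \<in> borel_measurable ?M" by simp
    have i: "integrable ?M (\<lambda>x. \<bar>f x\<bar> powr p)"
      using R by (intro integrableI_bounded) (auto simp: le_less_trans)
    then have "(LINT x|?M. \<bar>f x\<bar> powr p) \<le> \<theta> powr p" using R int by (simp add: ennreal_le_iff)
    then show ?L using i assms norm iff by (simp add: Lp_def)
  qed
qed

section \<open>Existence of an optimal control\<close>

lemma finite_measure_lebesgue_on_open_bounded:
  assumes "open \<Omega>" "bounded \<Omega>"
  shows "finite_measure (lebesgue_on \<Omega>)"
  using assms by (intro finite_measure_lebesgue_on lmeasurable_open)

lemma Lp_infinity_square_integrable:
  assumes \<Omega>: "open \<Omega>" "bounded \<Omega>" and f: "f \<in> Lp \<Omega> \<infinity>"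
  shows "f \<in> borel_measurable (lebesgue_on \<Omega>)" "integrable (lebesgue_on \<Omega>) (\<lambda>x. (f x)\<^sup>2)"
proof -
  obtain M where M: "M \<ge> 0" "AE x in lebesgue_on \<Omega>. \<bar>f x\<bar> \<le> M"
    and m [measurable]: "f \<in> borel_measurable (lebesgue_on \<Omega>)"
    using Lp_infinity_AE_bounded[OF f] by metis
  show "f \<in> borel_measurable (lebesgue_on \<Omega>)" by (rule m)
  have "AE x in lebesgue_on \<Omega>. norm ((f x)\<^sup>2) \<le> M\<^sup>2"
    using M(2)
  proof eventually_elim
    case (elim x)
    then show ?case using power_mono[OF elim abs_ge_zero, of 2] by simp
  qed
  then show "integrable (lebesgue_on \<Omega>) (\<lambda>x. (f x)\<^sup>2)"
    by (intro finite_measure.integrable_const_bound[OF finite_measure_lebesgue_on_open_bounded[OF \<Omega>]]) auto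
qed

lemma cell_inter_sets: "cell m z \<inter> \<Omega> \<in> sets (lebesgue_on \<Omega>)"
  unfolding sets_restrict_space
  by (rule image_eqI[of _ _ "cell m z"]) (auto intro: sets_completionI_sets)

lemma powr_diff_le:
  fixes a b :: real
  assumes "p \<ge> 0"
  shows "\<bar>a - b\<bar> powr p \<le> 2 powr p * (\<bar>a\<bar> powr p + \<bar>b\<bar> powr p)"
proof -
  have "\<bar>a - b\<bar> powr p \<le> (2 * max \<bar>a\<bar> \<bar>b\<bar>) powr p"
    using assms by (intro powr_mono2) auto
  also have "\<dots> = 2 powr p * max \<bar>a\<bar> \<bar>b\<bar> powr p" by (simp add: powr_mult)
  also have "max \<bar>a\<bar> \<bar>b\<bar> powr p \<le> \<bar>a\<bar> powr p + \<bar>b\<bar> powr p" by (simp add: max_def)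
  finally show ?thesis by simp
qed

lemma control_rep:
  fixes u :: "real^'n \<Rightarrow> real"
  assumes \<Omega>: "open \<Omega>" "bounded \<Omega>" and um: "u \<in> borel_measurable (lebesgue_on \<Omega>)"
    and u2: "integrable (lebesgue_on \<Omega>) (\<lambda>x. (u x)\<^sup>2)"
    and up: "(\<integral>\<^sup>+x. ennreal (\<bar>u x\<bar> powr p) \<partial>lebesgue_on \<Omega>) \<le> ennreal b"
  obtains ub where "ub \<in> borel_measurable borel" "\<And>x. x \<notin> \<Omega> \<Longrightarrow> ub x = 0" "AE x in lebesgue_on \<Omega>. u x = ub x"
    "integrable lborel ub" "(\<integral>\<^sup>+x. ennreal (\<bar>ub x\<bar> powr p) \<partial>lborel) \<le> ennreal b"
proof -
  obtain ub where ub [measurable]: "ub \<in> borel_measurable borel" and ub0: "\<And>x. x \<notin> \<Omega> \<Longrightarrow> ub x = 0"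
    and ae: "AE x in lebesgue_on \<Omega>. u x = ub x"
    using lebesgue_on_borel_rep[OF \<Omega>(1) um] by metis
  have "integrable (lebesgue_on \<Omega>) u"
    by (rule finite_measure.L1_le_L2(1)[OF finite_measure_lebesgue_on_open_bounded[OF \<Omega>] um u2 zero_less_one])
  then have i: "integrable lborel ub" by (rule lebesgue_on_integral_rep(2)[OF \<Omega>(1) _ ub ub0 ae])
  have ip: "integrable (lebesgue_on \<Omega>) (\<lambda>x. \<bar>u x\<bar> powr p)"
    using um up by (intro integrableI_bounded) (auto simp: le_less_trans)
  have ae': "AE x in lebesgue_on \<Omega>. \<bar>u x\<bar> powr p = \<bar>ub x\<bar> powr p"
    using ae by eventually_elim simp
  have z: "\<bar>ub x\<bar> powr p = 0" if "x \<notin> \<Omega>" for x using ub0[OF that] by simp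
  have m: "(\<lambda>x. \<bar>ub x\<bar> powr p) \<in> borel_measurable borel" by measurable
  note r = lebesgue_on_integral_rep[OF \<Omega>(1) ip m z ae']
  have "(\<integral>\<^sup>+x. ennreal (\<bar>ub x\<bar> powr p) \<partial>lborel) = ennreal (LINT x|lborel. \<bar>ub x\<bar> powr p)"
    using r(2) by (intro nn_integral_eq_integral) auto
  also have "\<dots> = ennreal (LINT x|lebesgue_on \<Omega>. \<bar>u x\<bar> powr p)" using r(1) by simp
  also have "\<dots> = (\<integral>\<^sup>+x. ennreal (\<bar>u x\<bar> powr p) \<partial>lebesgue_on \<Omega>)"
    using ip by (intro nn_integral_eq_integral[symmetric]) auto
  finally have bp: "(\<integral>\<^sup>+x. ennreal (\<bar>ub x\<bar> powr p) \<partial>lborel) \<le> ennreal b" using up by simp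
  show ?thesis by (rule that) (fact ub ub0 ae i bp)+
qed

text \<open>The gradient bound M of the limit state and the target accuracy determine e and
  \<delta>; only then does \<open>weak_convergence_dual_bound\<close> select the index from which
  \<open>state_difference_bound\<close> applies.\<close>

lemma state_convergence:
  fixes u y :: "nat \<Rightarrow> real^'n \<Rightarrow> real" and u0 y0 v :: "real^'n \<Rightarrow> real"
  assumes \<Omega>: "open \<Omega>" "bounded \<Omega>" and p: "p > real CARD('n)" and b: "b \<ge> 0"
    and y: "\<And>k. y k \<in> Sobolev \<Omega> 1 \<infinity>" "y0 \<in> Sobolev \<Omega> 1 \<infinity>"
    and tr: "\<And>k. y k - v \<in> W1inf_zero_trace \<Omega>" "y0 - v \<in> W1inf_zero_trace \<Omega>"
    and eq: "\<And>k. solves_state_eq \<Omega> (u k) (y k)" "solves_state_eq \<Omega> u0 y0"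
    and u: "\<And>k. u k \<in> borel_measurable (lebesgue_on \<Omega>)" "\<And>k. integrable (lebesgue_on \<Omega>) (\<lambda>x. (u k x)\<^sup>2)"
      "\<And>k. (\<integral>\<^sup>+x. ennreal (\<bar>u k x\<bar> powr p) \<partial>lebesgue_on \<Omega>) \<le> ennreal b"
    and u0: "u0 \<in> borel_measurable (lebesgue_on \<Omega>)" "integrable (lebesgue_on \<Omega>) (\<lambda>x. (u0 x)\<^sup>2)"
      "(\<integral>\<^sup>+x. ennreal (\<bar>u0 x\<bar> powr p) \<partial>lebesgue_on \<Omega>) \<le> ennreal b"
    and lim: "\<And>m z. m > 0 \<Longrightarrow> (\<lambda>k. LINT x|lebesgue_on \<Omega>. indicator (cell m z) x * (u k x - u0 x)) \<longlonglongrightarrow> 0"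
  shows "(\<lambda>k. LINT x|lebesgue_on \<Omega>. \<bar>y k x - y0 x\<bar>) \<longlonglongrightarrow> 0"
proof -
  have p0: "p \<ge> 0" by (rule less_imp_le[OF le_less_trans[OF of_nat_0_le_iff p]])
  obtain R0 where R0: "\<And>x. x \<in> \<Omega> \<Longrightarrow> norm x \<le> R0" using \<Omega>(2) by (auto simp: bounded_iff)
  define R where "R = max 0 R0"
  have R: "R \<ge> 0" "\<Omega> \<subseteq> cball 0 R" using R0 by (auto simp: R_def le_max_iff_disj)
  have "\<forall>k. \<exists>ub. ub \<in> borel_measurable borel \<and> (\<forall>x. x \<notin> \<Omega> \<longrightarrow> ub x = 0) \<and> (AE x in lebesgue_on \<Omega>. u k x = ub x) \<and>
      integrable lborel ub \<and> (\<integral>\<^sup>+x. ennreal (\<bar>ub x\<bar> powr p) \<partial>lborel) \<le> ennreal b"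
    by (intro allI, rule control_rep[OF \<Omega> u]) blast
  from choice[OF this] obtain ub where ub_all: "\<forall>k. ub k \<in> borel_measurable borel \<and> (\<forall>x. x \<notin> \<Omega> \<longrightarrow> ub k x = 0) \<and>
      (AE x in lebesgue_on \<Omega>. u k x = ub k x) \<and>
      integrable lborel (ub k) \<and> (\<integral>\<^sup>+x. ennreal (\<bar>ub k x\<bar> powr p) \<partial>lborel) \<le> ennreal b"
    by (elim exE)
  have ub [measurable]: "\<And>k. ub k \<in> borel_measurable borel" and ubz: "\<And>k x. x \<notin> \<Omega> \<Longrightarrow> ub k x = 0"
    and uba: "\<And>k. AE x in lebesgue_on \<Omega>. u k x = ub k x" and ubi: "\<And>k. integrable lborel (ub k)"
    and ubp: "\<And>k. (\<integral>\<^sup>+x. ennreal (\<bar>ub k x\<bar> powr p) \<partial>lborel) \<le> ennreal b"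
    using ub_all by blast+
  obtain u0b where u0b [measurable]: "u0b \<in> borel_measurable borel" and u0z: "\<And>x. x \<notin> \<Omega> \<Longrightarrow> u0b x = 0"
    and u0a: "AE x in lebesgue_on \<Omega>. u0 x = u0b x" and u0i: "integrable lborel u0b"
    and u0p: "(\<integral>\<^sup>+x. ennreal (\<bar>u0b x\<bar> powr p) \<partial>lborel) \<le> ennreal b"
    using control_rep[OF \<Omega> u0] by blast
  obtain G :: "real^'n \<Rightarrow> real^'n" and M where G: "G \<in> borel_measurable borel" "\<And>x. norm (G x) \<le> M"
    "\<And>x. x \<notin> \<Omega> \<Longrightarrow> G x = 0" "AE x in lebesgue_on \<Omega>. weak_grad \<Omega> y0 x = G x"
    using W1inf_weak_grad[OF \<Omega>(1) y(2)] by metis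
  define V where "V = measure lborel (cball (0::real^'n) R)"
  have V: "V \<ge> 0" by (simp add: V_def)
  \<comment> \<open>From |s - t|^p \<le> 2^p (|s|^p + |t|^p), with b bounding the integrals of both
    p-th powers.\<close>
  define A where "A = 2 powr p * (b + b)"
  have A: "A \<ge> 0" using b by (simp add: A_def)
  have wp: "(\<integral>\<^sup>+x. ennreal (\<bar>ub k x - u0b x\<bar> powr p) \<partial>lborel) \<le> ennreal A" for k
  proof -
    have "(\<integral>\<^sup>+x. ennreal (\<bar>ub k x - u0b x\<bar> powr p) \<partial>lborel)
        \<le> (\<integral>\<^sup>+x. ennreal (2 powr p) * (ennreal (\<bar>ub k x\<bar> powr p) + ennreal (\<bar>u0b x\<bar> powr p)) \<partial>lborel)"
    proof (rule nn_integral_mono)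
      fix x
      have "ennreal (\<bar>ub k x - u0b x\<bar> powr p) \<le> ennreal (2 powr p * (\<bar>ub k x\<bar> powr p + \<bar>u0b x\<bar> powr p))"
        by (intro ennreal_leI powr_diff_le p0)
      also have "\<dots> = ennreal (2 powr p) * (ennreal (\<bar>ub k x\<bar> powr p) + ennreal (\<bar>u0b x\<bar> powr p))"
        by (subst ennreal_mult') (auto simp: ennreal_plus)
      finally show "ennreal (\<bar>ub k x - u0b x\<bar> powr p)
          \<le> ennreal (2 powr p) * (ennreal (\<bar>ub k x\<bar> powr p) + ennreal (\<bar>u0b x\<bar> powr p))" .
    qed
    also have "\<dots> = ennreal (2 powr p) * ((\<integral>\<^sup>+x. ennreal (\<bar>ub k x\<bar> powr p) \<partial>lborel)
        + (\<integral>\<^sup>+x. ennreal (\<bar>u0b x\<bar> powr p) \<partial>lborel))"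
      by (subst nn_integral_cmult, measurable) (subst nn_integral_add, auto)
    also have "\<dots> \<le> ennreal (2 powr p) * (ennreal b + ennreal b)"
      by (intro mult_left_mono add_mono ubp u0p) auto
    also have "\<dots> = ennreal A"
      by (simp only: A_def ennreal_mult'[OF powr_ge_zero] ennreal_plus[OF b b])
    finally show ?thesis .
  qed
  have lim': "(\<lambda>k. LINT x|lborel. indicator (cell m z) x * (ub k x - u0b x)) \<longlonglongrightarrow> 0" if "m > 0" for m z
  proof -
    have "(LINT x|lebesgue_on \<Omega>. indicator (cell m z) x * (u k x - u0 x))
        = (LINT x|lborel. indicator (cell m z) x * (ub k x - u0b x))" for k
    proof (rule lebesgue_on_integral_rep(1)[OF \<Omega>(1)])
      interpret finite_measure "lebesgue_on \<Omega>" by (rule finite_measure_lebesgue_on_open_bounded[OF \<Omega>])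
      have c: "cell m z \<inter> \<Omega> \<in> sets (lebesgue_on \<Omega>)"
        by (rule cell_inter_sets)
      have "integrable (lebesgue_on \<Omega>) (\<lambda>x. u k x - u0 x)"
        using L1_le_L2(1)[OF u(1,2) zero_less_one] L1_le_L2(1)[OF u0(1,2) zero_less_one] by auto
      then have "integrable (lebesgue_on \<Omega>) (\<lambda>x. indicator (cell m z \<inter> \<Omega>) x * (u k x - u0 x))"
        by (rule integrable_indicator_times[OF _ c])
      then show "integrable (lebesgue_on \<Omega>) (\<lambda>x. indicator (cell m z) x * (u k x - u0 x))"
        by (rule Bochner_Integration.integrable_cong[THEN iffD1, rotated -1]) (auto simp: indicator_def)
      show "AE x in lebesgue_on \<Omega>. indicator (cell m z) x * (u k x - u0 x) = indicator (cell m z) x * (ub k x - u0b x)"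
        using uba[of k] u0a by eventually_elim simp
    qed (auto simp: ubz u0z)
    then show ?thesis using lim[OF that, of z] by simp
  qed
  show ?thesis
  proof (rule LIMSEQ_I)
    fix r :: real assume r: "r > 0"
    \<comment> \<open>Makes the bound of \<open>state_difference_bound\<close> at most r / 2; V + 1
      instead of V keeps the denominator positive.\<close>
    define e where "e = r / (2 * ((2 * R + 1) * (2 * (V + 1))))"
    have pos: "(2 * R + 1) * (2 * (V + 1)) > 0" using R V by (intro mult_pos_pos) auto
    have e: "e > 0" unfolding e_def using r pos by simp
    have "(2 * R + 1) * (2 * e * V) \<le> (2 * R + 1) * (2 * e * (V + 1))"
      using R e by (intro mult_left_mono) auto
    also have "\<dots> = e * ((2 * R + 1) * (2 * (V + 1)))" by simp
    also have "\<dots> = r / 2" unfolding e_def using pos by (simp add: field_simps)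
    finally have small: "(2 * R + 1) * (2 * e * V) < r" using r by linarith
    define c where "c = e / (2 * sqrt (1 + M\<^sup>2) ^ 3 * (1 + e))"
    define \<delta> where "\<delta> = c / 2"
    have \<delta>2: "2 * \<delta> \<le> e / (2 * sqrt (1 + M\<^sup>2) ^ 3 * (1 + e))" unfolding c_def[symmetric] \<delta>_def by simp
    have "1 + M\<^sup>2 > 0" by (simp add: add_pos_nonneg)
    then have \<delta>: "\<delta> > 0" unfolding \<delta>_def c_def using e by simp
    have "\<forall>\<^sub>F k in sequentially. \<forall>\<phi>\<in>test_functions \<Omega>.
        \<bar>LINT x|lborel. (ub k x - u0b x) * \<phi> x\<bar> \<le> \<delta> * (LINT x|lborel. norm (grad \<phi> x))"
    proof (rule weak_convergence_dual_bound[OF _ _ wp A p R(2,1) lim' \<delta>])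
      show "ub k x - u0b x = 0" if "x \<notin> cball 0 R" for k x
      proof -
        have "x \<notin> \<Omega>" using that R(2) by blast
        then show ?thesis by (simp add: ubz u0z)
      qed
    qed (use ubi u0i in auto)
    then obtain N where N: "\<And>k \<phi>. k \<ge> N \<Longrightarrow> \<phi> \<in> test_functions \<Omega> \<Longrightarrow>
        \<bar>LINT x|lborel. (ub k x - u0b x) * \<phi> x\<bar> \<le> \<delta> * (LINT x|lborel. norm (grad \<phi> x))"
      by (auto simp: eventually_sequentially)
    have "(LINT x|lebesgue_on \<Omega>. \<bar>y k x - y0 x\<bar>) \<le> (2 * R + 1) * (2 * e * V)" if "k \<ge> N" for k
      unfolding V_def
      by (rule state_difference_bound(1)[OF \<Omega>(1) R(2,1) y(1) y(2) tr(1) tr(2) eq(1) eq(2) ub uba u0b u0a G e _ \<delta>2 N[OF that]])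
        (use \<delta> in auto)
    then show "\<exists>N. \<forall>k\<ge>N. norm ((LINT x|lebesgue_on \<Omega>. \<bar>y k x - y0 x\<bar>) - 0) < r"
      using small by (intro exI[of _ N]) (auto intro: le_less_trans)
  qed
qed

theorem theorem2p2:
  fixes \<Omega> :: "(real^'n) set" and p :: real
    and v yd :: "real^'n \<Rightarrow> real"
    and \<alpha> \<theta> B1 B2 B3 C\<Omega> CS :: real
    and U3 :: "(real^'n \<Rightarrow> real) set"
    and S :: "(real^'n \<Rightarrow> real) \<Rightarrow> real^'n \<Rightarrow> real"
    and T :: "(real^'n \<Rightarrow> real) \<Rightarrow> (real^'n \<Rightarrow> real) \<Rightarrow> real^'n \<Rightarrow> real"
  assumes "open \<Omega>" and "bounded \<Omega>" and "C11_boundary \<Omega>"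
    and "p > real CARD('n)"
    and "v \<in> Sobolev \<Omega> 2 (ennreal p)"
    and "yd \<in> Lp \<Omega> 2"
    and "\<alpha> > 0"
    and U3: "Lp_open \<Omega> (ennreal p) U3" "(\<lambda>_. 0) \<in> U3"
    and S: "control_to_state_map \<Omega> p v U3 S"
    and "B1 > 1" and "B2 > 0" and "B3 > 0" and "C\<Omega> > 0"
    and CS: "\<forall>y\<in>Sobolev \<Omega> 2 (ennreal p). y \<in> Sobolev \<Omega> 1 \<infinity> \<and>
               Sobolev_norm \<Omega> 1 \<infinity> y \<le> CS * Sobolev_norm \<Omega> 2 (ennreal p) y"
    and T: "\<forall>u\<in>Lp \<Omega> (ennreal p). \<forall>y\<in>state_ball \<Omega> p v B1.
               T u y \<in> state_space \<Omega> p v \<and> solves_linear_eq \<Omega> u y (T u y)"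
    and constants: "\<forall>u\<in>Lp \<Omega> (ennreal p). small_data \<Omega> p v B1 B2 B3 C\<Omega> u \<longrightarrow>
          (\<forall>y\<in>state_ball \<Omega> p v B1. T u y \<in> state_ball \<Omega> p v B1) \<and>
          (\<exists>q. 0 \<le> q \<and> q < 1 \<and>
             (\<forall>y\<in>state_ball \<Omega> p v B1. \<forall>z\<in>state_ball \<Omega> p v B1.
                Sobolev_norm \<Omega> 2 (ennreal p) (T u y - T u z)
                  \<le> q * Sobolev_norm \<Omega> 2 (ennreal p) (y - z))) \<and>
          (\<forall>y\<in>state_ball \<Omega> p v B1. solves_state_eq \<Omega> u y \<longrightarrow>
             CS * Sobolev_norm \<Omega> 2 (ennreal p) y \<le> 1 / (B1 * sqrt (1 + CS\<^sup>2 * B1\<^sup>2)))"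
    and "\<theta> > 0" and "U_ad \<Omega> p \<theta> \<subseteq> U_set \<Omega> p v B1 B2 B3 C\<Omega> U3"
  shows "\<exists>u0\<in>U_ad \<Omega> p \<theta>. \<forall>u\<in>U_ad \<Omega> p \<theta>. cost \<Omega> S yd \<alpha> u0 \<le> cost \<Omega> S yd \<alpha> u"
proof -
  let ?M = "lebesgue_on \<Omega>" and ?U = "U_ad \<Omega> p \<theta>" and ?J = "cost \<Omega> S yd \<alpha>"
  note \<Omega> = \<open>open \<Omega>\<close> \<open>bounded \<Omega>\<close> and p = \<open>p > real CARD('n)\<close>
  interpret finite_measure ?M by (rule finite_measure_lebesgue_on_open_bounded[OF \<Omega>])
  have n: "real CARD('n) \<ge> 1" using zero_less_card_finite[where 'a = 'n] by linarith
  then have p1: "p \<ge> 1" using p by linarith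
  have U_iff: "u \<in> ?U \<longleftrightarrow> u \<in> borel_measurable ?M \<and> integrable ?M (\<lambda>x. (u x)\<^sup>2) \<and>
      (\<integral>\<^sup>+x. ennreal (\<bar>u x\<bar> powr p) \<partial>?M) \<le> ennreal (\<theta> powr p)" for u
    using Lp_norm_le_iff[of p \<theta> u \<Omega>] p1 \<open>\<theta> > 0\<close> by (auto simp: U_ad_def Lp_2_iff)
  have J_eq: "?J u = 1 / 2 * (LINT x|?M. (S u x - yd x)\<^sup>2) + \<alpha> / 2 * (LINT x|?M. (u x)\<^sup>2)" for u
    by (simp add: cost_def Lp_norm_2_square)
  have yd: "yd \<in> borel_measurable ?M" "integrable ?M (\<lambda>x. (yd x)\<^sup>2)"
    using \<open>yd \<in> Lp \<Omega> 2\<close> by (auto simp: Lp_2_iff)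
  have SU: "S u \<in> Sobolev \<Omega> 1 \<infinity>" "S u - v \<in> W1inf_zero_trace \<Omega>" "solves_state_eq \<Omega> u (S u)" if "u \<in> ?U" for u
  proof -
    have "u \<in> U3" using that \<open>?U \<subseteq> _\<close> by (auto simp: U_set_def)
    then have "S u \<in> state_space \<Omega> p v" "solves_state_eq \<Omega> u (S u)"
      using S by (auto simp: control_to_state_map_def is_C2_solution_map_def)
    then show "S u \<in> Sobolev \<Omega> 1 \<infinity>" "S u - v \<in> W1inf_zero_trace \<Omega>" "solves_state_eq \<Omega> u (S u)"
      using CS by (auto simp: state_space_def)
  qed
  have Sm: "S u \<in> borel_measurable ?M" "integrable ?M (\<lambda>x. (S u x)\<^sup>2)" if "u \<in> ?U" for u
    using Lp_infinity_square_integrable[OF \<Omega>, of "S u"] SU(1)[OF that] by (auto simp: Sobolev_def)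
  have J0: "?J u \<ge> 0" for u unfolding J_eq using \<open>\<alpha> > 0\<close> by (intro add_nonneg_nonneg mult_nonneg_nonneg) auto
  define I where "I = (INF u\<in>?U. ?J u)"
  \<comment> \<open>An admissible control exists, so the real infimum I is meaningful.\<close>
  have zero: "(\<lambda>_. 0) \<in> ?U" by (simp add: U_iff)
  have bdd: "bdd_below (?J ` ?U)" using J0 by (intro bdd_belowI[of _ 0]) auto
  have I_le: "I \<le> ?J u" if "u \<in> ?U" for u unfolding I_def using bdd that by (rule cINF_lower)
  have "\<exists>u\<in>?U. ?J u < I + 1 / real (Suc k)" for k
    using cINF_less_iff[of ?U ?J "I + 1 / real (Suc k)", OF _ bdd] zero unfolding I_def by auto
  then obtain u where uU: "\<And>k. u k \<in> ?U" and uJ: "\<And>k. ?J (u k) < I + 1 / real (Suc k)" by metis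
  have u2: "u k \<in> borel_measurable ?M" "integrable ?M (\<lambda>x. (u k x)\<^sup>2)"
    "(\<integral>\<^sup>+x. ennreal (\<bar>u k x\<bar> powr p) \<partial>?M) \<le> ennreal (\<theta> powr p)" for k
    using uU[of k] by (auto simp: U_iff)
  \<comment> \<open>The tracking term is nonnegative, so \<alpha> / 2 times the squared norm of u k
    is below the cost, which is less than I + 1 / (k + 1) \<le> I + 1.\<close>
  define B where "B = 2 * (I + 1) / \<alpha>"
  have uB: "(LINT x|?M. (u k x)\<^sup>2) \<le> B" for k
  proof -
    have "1 / real (Suc k) \<le> 1" by simp
    then have "\<alpha> / 2 * (LINT x|?M. (u k x)\<^sup>2) \<le> I + 1"
      using uJ[of k] unfolding J_eq by (smt (verit) Bochner_Integration.integral_nonneg zero_le_power2 mult_nonneg_nonneg divide_nonneg_pos)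
    then show ?thesis using \<open>\<alpha> > 0\<close> by (simp add: B_def field_simps)
  qed
  \<comment> \<open>Measurable sets of \<open>?M\<close> lie inside \<Omega>, so cells enter
    intersected with it; integrals over \<open>?M\<close> do not see the difference.\<close>
  have cm: "cell m z \<inter> \<Omega> \<in> sets ?M" for m z
    by (rule cell_inter_sets)
  \<comment> \<open>\<open>None\<close> records the squared norms and \<open>Some\<close> the cell
    integrals, so that one diagonal subsequence makes all of them converge.\<close>
  define c where "c i k = (case i of None \<Rightarrow> LINT x|?M. (u k x)\<^sup>2
    | Some (m, z) \<Rightarrow> LINT x|?M. indicator (cell m z \<inter> \<Omega>) x * u k x)" for i :: "(nat \<times> ('n \<Rightarrow> int)) option" and k
  \<comment> \<open>A cell integral is at most the L^1 norm, which \<open>L1_le_L2\<close> with s =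
    1 bounds by the volume of \<Omega> plus B.\<close>
  have "\<bar>c i k\<bar> \<le> B + measure ?M (space ?M)" for i k
  proof (cases i)
    case None
    then show ?thesis using uB[of k] by (simp add: c_def add_increasing2)
  next
    case (Some mz)
    obtain m z where mz: "mz = (m, z)" by (cases mz)
    note L = L1_le_L2[OF u2(1,2) zero_less_one, of k]
    have "\<bar>c i k\<bar> \<le> (LINT x|?M. \<bar>indicator (cell m z \<inter> \<Omega>) x * u k x\<bar>)"
      unfolding c_def Some mz by (simp add: integral_abs_bound)
    also have "\<dots> \<le> (LINT x|?M. \<bar>u k x\<bar>)"
      using integrable_indicator_times[OF L(1) cm] L(1)
      by (intro integral_mono integrable_abs) (auto simp: indicator_def)
    finally show ?thesis using L(2) uB[of k] by simp
  qed
  then obtain r where r: "strict_mono r" and cr: "\<And>i. convergent (\<lambda>k. c i (r k))"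
    using diagonal_convergent[of c "\<lambda>_. B + measure ?M (space ?M)"] by blast
  define w where "w k = u (r k)" for k
  have wU: "w k \<in> ?U" for k by (simp add: w_def uU)
  have w2: "w k \<in> borel_measurable ?M" "integrable ?M (\<lambda>x. (w k x)\<^sup>2)"
    "(\<integral>\<^sup>+x. ennreal (\<bar>w k x\<bar> powr p) \<partial>?M) \<le> ennreal (\<theta> powr p)" for k
    by (simp_all add: w_def u2)
  obtain \<beta> where \<beta>: "(\<lambda>k. LINT x|?M. (w k x)\<^sup>2) \<longlonglongrightarrow> \<beta>"
    using cr[of None] by (auto simp: c_def w_def convergent_def)
  have conv: "convergent (\<lambda>k. LINT x|?M. indicator (case i of (m, z) \<Rightarrow> cell m z \<inter> \<Omega>) x * w k x)" for i
    using cr[of "Some i"] by (cases i) (simp add: c_def w_def)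
  from weak_limit_L2[of w \<beta> p "\<theta> powr p" "\<lambda>i. case i of (m, z) \<Rightarrow> cell m z \<inter> \<Omega>",
      OF w2(1) w2(2) \<beta> p1 w2(3) _ _ conv]
  obtain u0 where u0: "u0 \<in> borel_measurable ?M" "integrable ?M (\<lambda>x. (u0 x)\<^sup>2)" "(LINT x|?M. (u0 x)\<^sup>2) \<le> \<beta>"
    "(\<integral>\<^sup>+x. ennreal (\<bar>u0 x\<bar> powr p) \<partial>?M) \<le> ennreal (\<theta> powr p)"
    and cells: "\<And>i. (\<lambda>k. LINT x|?M. indicator (case i of (m, z) \<Rightarrow> cell m z \<inter> \<Omega>) x * (w k x - u0 x)) \<longlonglongrightarrow> 0"
    using cm by (auto split: prod.splits)
  have u0U: "u0 \<in> ?U" using u0 by (simp add: U_iff)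
  have L1: "(\<lambda>k. LINT x|?M. \<bar>S (w k) x - S u0 x\<bar>) \<longlonglongrightarrow> 0"
  proof (rule state_convergence[OF \<Omega> p _ SU(1)[OF wU] SU(1)[OF u0U] SU(2)[OF wU] SU(2)[OF u0U]
        SU(3)[OF wU] SU(3)[OF u0U] w2 u0(1,2,4)])
    fix m z
    have "(LINT x|?M. indicator (cell m z) x * (w k x - u0 x))
        = (LINT x|?M. indicator (cell m z \<inter> \<Omega>) x * (w k x - u0 x))" for k
      by (intro Bochner_Integration.integral_cong) (auto simp: indicator_def)
    then show "(\<lambda>k. LINT x|?M. indicator (cell m z) x * (w k x - u0 x)) \<longlonglongrightarrow> 0"
      using cells[of "(m, z)"] by simp
  qed simp
  have di: "integrable ?M (\<lambda>x. S (w k) x - S u0 x)" for k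
    using L1_le_L2(1)[OF Sm[OF wU] zero_less_one] L1_le_L2(1)[OF Sm[OF u0U] zero_less_one] by auto
  \<comment> \<open>Fatou's lemma asks for pointwise convergence, which L^1 convergence provides
    along a further subsequence.\<close>
  obtain s where s: "strict_mono s" and ae: "AE x in ?M. (\<lambda>k. S (w (s k)) x - S u0 x) \<longlonglongrightarrow> 0"
    using tendsto_L1_AE_subseq[of ?M "\<lambda>k x. S (w k) x - S u0 x"] di L1 by (auto simp: real_norm_def)
  have Jw: "(\<lambda>k. ?J (w k)) \<longlonglongrightarrow> I"
  proof (rule tendsto_sandwich[OF _ _ tendsto_const])
    show "\<forall>\<^sub>F k in sequentially. I \<le> ?J (w k)" using I_le wU by simp
    show "\<forall>\<^sub>F k in sequentially. ?J (w k) \<le> I + 1 / real (Suc (r k))"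
      using uJ by (simp add: w_def less_imp_le)
    have "(\<lambda>k. I + 1 / real (Suc (r k))) \<longlonglongrightarrow> I + 0"
      by (intro tendsto_add tendsto_const LIMSEQ_subseq_LIMSEQ[OF LIMSEQ_Suc[OF lim_1_over_n] r, unfolded o_def])
    then show "(\<lambda>k. I + 1 / real (Suc (r k))) \<longlonglongrightarrow> I" by simp
  qed
  \<comment> \<open>The costs tend to I and the squared control norms to \<beta>, which forces the
    squared tracking norms to converge to \<gamma>. Bounding those of the limit by \<gamma> and
    \<beta> gives a cost of at most \<gamma> / 2 + \<alpha> \<beta> / 2 = I.\<close>
  define \<gamma> where "\<gamma> = 2 * I - \<alpha> * \<beta>"
  have "(\<lambda>k. 2 * ?J (w k) - \<alpha> * (LINT x|?M. (w k x)\<^sup>2)) \<longlonglongrightarrow> \<gamma>"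
    unfolding \<gamma>_def by (intro tendsto_intros Jw \<beta>)
  then have "(\<lambda>k. LINT x|?M. (S (w k) x - yd x)\<^sup>2) \<longlonglongrightarrow> \<gamma>"
    by (simp add: J_eq algebra_simps)
  from LIMSEQ_subseq_LIMSEQ[OF this s]
  have \<gamma>: "(\<lambda>k. LINT x|?M. (S (w (s k)) x - yd x)\<^sup>2) \<longlonglongrightarrow> \<gamma>" by (simp add: o_def)
  have "(LINT x|?M. (S u0 x - yd x)\<^sup>2) \<le> \<gamma>"
  proof (rule square_integral_AE_limit_le(2))
    show "(\<lambda>x. S (w (s k)) x - yd x) \<in> borel_measurable ?M" for k
      using Sm(1)[OF wU] yd(1) by (rule borel_measurable_diff)
    show "(\<lambda>x. S u0 x - yd x) \<in> borel_measurable ?M"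
      using Sm(1)[OF u0U] yd(1) by (rule borel_measurable_diff)
    show "integrable ?M (\<lambda>x. (S (w (s k)) x - yd x)\<^sup>2)" for k
      by (rule integrable_square_combination(2)[OF Sm(1)[OF wU] yd(1) Sm(2)[OF wU] yd(2)])
    show "AE x in ?M. (\<lambda>k. S (w (s k)) x - yd x) \<longlonglongrightarrow> S u0 x - yd x"
      using ae
    proof eventually_elim
      case (elim x)
      then have "(\<lambda>k. (S (w (s k)) x - S u0 x) + (S u0 x - yd x)) \<longlonglongrightarrow> 0 + (S u0 x - yd x)"
        by (intro tendsto_add tendsto_const)
      then show ?case by simp
    qed
    show "\<forall>\<^sub>F k in sequentially. (LINT x|?M. (S (w (s k)) x - yd x)\<^sup>2) \<le> \<gamma> + e" if "e > 0" for e
    proof -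
      have "\<forall>\<^sub>F k in sequentially. (LINT x|?M. (S (w (s k)) x - yd x)\<^sup>2) < \<gamma> + e"
        using that by (intro order_tendstoD(2)[OF \<gamma>]) simp
      then show ?thesis by (rule eventually_mono) simp
    qed
  qed
  moreover have "\<alpha> * (LINT x|?M. (u0 x)\<^sup>2) \<le> \<alpha> * \<beta>"
    using u0(3) \<open>\<alpha> > 0\<close> by (intro mult_left_mono) auto
  ultimately have "?J u0 \<le> I" unfolding J_eq \<gamma>_def by simp
  then show ?thesis using u0U I_le by (meson order_trans)
qed

end
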